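(* The variety $NMal_6$ of six-dimensional nilpotent Malcev algebra structures over $\mathbb{C}$ has exactly two irreducible components $\mathcal{C}_1$ and $\mathcal{C}_2$, where $$\mathcal{C}_1=\overline{O(g_6)}=NLie_6,$$ $$\mathcal{C}_2=\overline{\bigcup_{\epsilon\in\mathbb{C}}O(M_6^{\epsilon})}=NMal_6\setminus\left(O(g_6)\cup O(g_5)\cup O(g_8)\cup O(g_7)\cup O(g_{14})\cup O(g_9)\cup O(g_{23})\right).$$ In particular, up to isomorphism, the sets of rigid algebras satisfy $Rig(NMal_6)=Rig(NLie_6)=\{g_6\}$.
   Context: All algebras are over $\mathbb{C}$. With $J(x,y,z)=(xy)z+(yz)x+(zx)y$, an algebra is a Malcev algebra if it satisfies $xy=-yx$ and $J(x,y,xz)=J(x,y,z)x$. Fix an $n$-dimensional vector space $V$ (here $n=6$). $NMal_n$ (resp. $NLie_n$) is the Zariski closed subset of $\mathrm{Hom}(V\otimes V,V)\cong\mathbb{C}^{n^3}$ consisting of nilpotent Malcev (resp. nilpotent Lie) multiplications on $V$. $GL_n(\mathbb{C})$ acts by $(g*\mu)(x\otimes y)=g(\mu(g^{-1}x\otimes g^{-1}y))$; for an $n$-dimensional algebra $A$, $O(A)$ denotes the orbit of structures isomorphic to $A$. Closures are Zariski closures. An irreducible component is a maximal irreducible closed subset. An algebra $A$ is rigid in a variety if $O(A)$ is an open subset of the variety; $Rig(\cdot)$ is the set of rigid algebras up to isomorphism. Known classification: every six-dimensional nilpotent Malcev algebra is isomorphic to one of the following, given in a basis $e_1,\dots,e_6$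 (products not listed are zero or follow from anticommutativity). Lie algebras: $\mathbb{C}^6$: zero multiplication. $g_1$: $e_1e_2=e_3$, $e_1e_3=e_4$, $e_1e_4=e_6$, $e_2e_3=e_6$, $e_2e_5=e_6$. $g_2$: $e_1e_2=e_3$, $e_1e_3=e_4$, $e_1e_4=e_6$, $e_2e_5=e_6$. $g_3$: $e_1e_2=e_3$, $e_1e_3=e_6$, $e_4e_5=e_6$. $g_5$: $e_1e_2=e_3$, $e_1e_3=e_4$, $e_1e_4=e_5$, $e_1e_5=e_6$, $e_2e_3=e_5$, $e_2e_4=e_6$. $g_6$: $e_1e_2=e_3$, $e_1e_3=e_4$, $e_1e_4=e_5$, $e_2e_3=e_5$, $e_2e_5=e_6$, $e_3e_4=-e_6$. $g_7$: $e_1e_2=e_3$, $e_1e_3=e_4$, $e_1e_4=e_5$, $e_1e_5=e_6$, $e_2e_3=e_6$. $g_8$: $e_1e_2=e_3$, $e_1e_3=e_4$, $e_1e_4=e_5$, $e_2e_5=e_6$, $e_3e_4=-e_6$. $g_9$: $e_1e_2=e_3$, $e_1e_3=e_4$, $e_1e_4=e_5$, $e_1e_5=e_6$. $g_{10}$: $e_1e_2=e_4$, $e_1e_3=e_5$, $e_1e_4=e_6$, $e_3e_5=e_6$. $g_{14}$: $e_1e_2=e_3$, $e_1e_3=e_4$, $e_1e_5=e_6$, $e_2e_3=e_5$, $e_2e_4=e_6$. $g_{15}$: $e_1e_2=e_3$, $e_1e_3=e_5$, $e_1e_4=e_6$, $e_2e_3=e_6$. $g_{16}$: $e_1e_2=e_3$,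 $e_1e_3=e_5$, $e_1e_4=e_5$, $e_2e_3=e_6$. $g_{17}$: $e_1e_2=e_3$, $e_1e_3=e_5$, $e_1e_4=e_6$. $g_{18}$: $e_1e_2=e_3$, $e_1e_3=e_5$, $e_2e_4=e_6$. $g_{20}$: $e_1e_2=e_3$, $e_1e_3=e_5$, $e_1e_4=e_6$, $e_2e_4=e_5$. $g_{21}$: $e_1e_2=e_5$, $e_1e_3=e_6$, $e_3e_4=e_5$. $g_{23}$: $e_1e_2=e_3$, $e_1e_3=e_4$, $e_1e_4=e_5$, $e_2e_3=e_6$. $g_{24}$: $e_1e_2=e_4$, $e_1e_3=e_5$, $e_2e_3=e_6$. $g_1^{\mathbb{C}}$: $e_1e_2=e_5$, $e_3e_4=e_5$. $g_2^{\mathbb{C}}$: $e_1e_2=e_4$, $e_1e_3=e_5$. $g_3^{\mathbb{C}}$: $e_1e_2=e_3$, $e_1e_4=e_5$, $e_2e_3=e_5$. $g_4^{\mathbb{C}}$: $e_1e_2=e_3$, $e_1e_3=e_4$, $e_2e_3=e_5$. $g_5^{\mathbb{C}}$: $e_1e_2=e_3$, $e_1e_3=e_4$, $e_1e_4=e_5$. $g_6^{\mathbb{C}}$: $e_1e_2=e_3$, $e_1e_3=e_4$, $e_1e_4=e_5$, $e_2e_3=e_5$. $n_3\oplus n_3$: $e_1e_3=e_5$, $e_2e_4=e_6$. $n_4\oplus\mathbb{C}^2$: $e_1e_2=e_3$, $e_1e_3=e_4$. $n_3\oplus\mathbb{C}^3$: $e_1e_2=e_3$. Further algebras (non-Lie,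 except $M_2^1$ and $M_6^1$, which are Lie): $M_5^{\mathbb{C}}$: $e_1e_2=e_5$, $e_3e_5=e_6$. $M_1^{0,1}$: $e_1e_2=e_5$, $e_3e_4=e_5$, $e_3e_5=e_6$. $M_1^{1,0}$: $e_1e_2=e_5$, $e_1e_4=e_6$, $e_3e_5=e_6$. $M_1^{1,1}$: $e_1e_2=e_5$, $e_1e_4=e_6$, $e_3e_4=e_5$, $e_3e_5=e_6$. $M_2^{\epsilon}$ ($\epsilon\in\mathbb{C}$): $e_1e_2=e_4$, $e_1e_3=e_5$, $e_2e_5=e_6$, $e_3e_4=\epsilon e_6$. $M_3$: $e_1e_2=e_4$, $e_1e_3=e_5$, $e_2e_4=e_6$, $e_2e_5=e_6$, $e_3e_4=-e_6$. $M_4$: $e_1e_2=e_4$, $e_1e_3=e_5$, $e_1e_5=e_6$, $e_3e_4=e_6$. $M_5^0$: $e_1e_2=e_4$, $e_2e_4=e_5$, $e_3e_4=e_6$. $M_5^1$: $e_1e_2=e_4$, $e_1e_3=e_5$, $e_2e_4=e_5$, $e_3e_4=e_6$. $M_6^{\epsilon}$ ($\epsilon\in\mathbb{C}$): $e_1e_2=e_3$, $e_1e_3=e_5$, $e_1e_5=e_6$, $e_2e_4=\epsilon e_5$, $e_3e_4=e_6$. $M_7^0$: $e_1e_2=e_4$, $e_1e_4=e_5$, $e_1e_5=e_6$, $e_2e_3=e_5$. $M_7^1$: $e_1e_2=e_4$, $e_1e_4=e_5$, $e_1e_5=e_6$, $e_2e_3=e_5$, $e_2e_4=e_6$. The only isomorphisms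 between these are $M_2^{\epsilon}\cong M_2^{\epsilon'}$ iff $\epsilon=\epsilon'$ or $\epsilon\epsilon'=1$. *)

theory Defs
  imports "HOL-Analysis.Analysis"
begin

type_synonym 'n multiplication = "complex ^ 'n \<Rightarrow> complex ^ 'n \<Rightarrow> complex ^ 'n"

text \<open>
  The space Hom(V \<open>\<otimes>\<close> V, V), realised as the complex-bilinear maps.  The constant
  \<open>bilinear\<close> of the library is bilinearity over the reals, hence the explicit scalar
  multiplications below.
\<close>

definition bilinear_maps :: "'n::finite multiplication set" where
  "bilinear_maps =
    {\<mu>. (\<forall>x. Vector_Spaces.linear (*s) (*s) (\<mu> x)) \<and>
         (\<forall>y. Vector_Spaces.linear (*s) (*s) (\<lambda>x. \<mu> x y))}"

definition anticommutative :: "'n::finite multiplication \<Rightarrow> bool" where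
  "anticommutative \<mu> \<longleftrightarrow> (\<forall>x y. \<mu> x y = - \<mu> y x)"

definition jacobian ::
    "'n::finite multiplication \<Rightarrow> complex ^ 'n \<Rightarrow> complex ^ 'n \<Rightarrow> complex ^ 'n \<Rightarrow> complex ^ 'n" where
  "jacobian \<mu> x y z = \<mu> (\<mu> x y) z + \<mu> (\<mu> y z) x + \<mu> (\<mu> z x) y"

definition malcev :: "'n::finite multiplication \<Rightarrow> bool" where
  "malcev \<mu> \<longleftrightarrow> anticommutative \<mu> \<and>
    (\<forall>x y z. jacobian \<mu> x y (\<mu> x z) = \<mu> (jacobian \<mu> x y z) x)"

text \<open>In characteristic 0, \<open>xx = 0\<close> and anticommutativity are the same condition.\<close>

definition lie :: "'n::finite multiplication \<Rightarrow> bool" where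
  "lie \<mu> \<longleftrightarrow> anticommutative \<mu> \<and> (\<forall>x y z. jacobian \<mu> x y z = 0)"

text \<open>
  The powers of a nonassociative algebra, with the index shifted by one: \<open>alg_power \<mu> k\<close> is
  \<open>A\<^sup>k\<^sup>+\<^sup>1\<close>, where \<open>A\<^sup>1 = A\<close> and \<open>A\<^sup>m\<close> is the linear span of all \<open>A\<^sup>i A\<^sup>j\<close> with
  \<open>i + j = m\<close> and \<open>i, j \<ge> 1\<close>.
\<close>

fun alg_power :: "'n::finite multiplication \<Rightarrow> nat \<Rightarrow> (complex ^ 'n) set" where
  "alg_power \<mu> 0 = UNIV"
| "alg_power \<mu> (Suc k) =
     vec.span (\<Union>i\<in>{..k}. {\<mu> x y | x y. x \<in> alg_power \<mu> i \<and> y \<in> alg_power \<mu> (k - i)})"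

definition nilpotent :: "'n::finite multiplication \<Rightarrow> bool" where
  "nilpotent \<mu> \<longleftrightarrow> (\<exists>k. alg_power \<mu> k = {0})"

definition NMal :: "'n::finite multiplication set" where
  "NMal = {\<mu> \<in> bilinear_maps. malcev \<mu> \<and> nilpotent \<mu>}"

definition NLie :: "'n::finite multiplication set" where
  "NLie = {\<mu> \<in> bilinear_maps. lie \<mu> \<and> nilpotent \<mu>}"

definition gl_act :: "complex ^ 'n ^ 'n \<Rightarrow> 'n::finite multiplication \<Rightarrow> 'n multiplication" where
  "gl_act g \<mu> = (\<lambda>x y. g *v \<mu> (matrix_inv g *v x) (matrix_inv g *v y))"

definition orbit :: "'n::finite multiplication \<Rightarrow> 'n multiplication set" where
  "orbit \<mu> = {gl_act g \<mu> | g. invertible g}"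

text \<open>
  Polynomial functions in the structure constants of a multiplication with respect to the
  standard basis.
\<close>

inductive polyfun :: "('n::finite multiplication \<Rightarrow> complex) \<Rightarrow> bool" where
  const: "polyfun (\<lambda>\<mu>. c)"
| coord: "polyfun (\<lambda>\<mu>. \<mu> (axis i 1) (axis j 1) $ k)"
| add: "polyfun p \<Longrightarrow> polyfun q \<Longrightarrow> polyfun (\<lambda>\<mu>. p \<mu> + q \<mu>)"
| mult: "polyfun p \<Longrightarrow> polyfun q \<Longrightarrow> polyfun (\<lambda>\<mu>. p \<mu> * q \<mu>)"

definition zero_locus :: "('n::finite multiplication \<Rightarrow> complex) set \<Rightarrow> 'n multiplication set" where
  "zero_locus P = {\<mu> \<in> bilinear_maps. \<forall>p\<in>P. p \<mu> = 0}"

definition zariski :: "'n::finite multiplication topology" where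
  "zariski = topology (\<lambda>U. \<exists>P. Ball P polyfun \<and> U = bilinear_maps - zero_locus P)"

lemma mem_Diff_zero_locus:
  "\<mu> \<in> bilinear_maps - zero_locus P \<longleftrightarrow> \<mu> \<in> bilinear_maps \<and> (\<exists>p\<in>P. p \<mu> \<noteq> 0)"
  by (auto simp: zero_locus_def)

lemma istopology_zariski:
  "istopology (\<lambda>U :: 'n::finite multiplication set.
     \<exists>P. Ball P polyfun \<and> U = bilinear_maps - zero_locus P)"
  unfolding istopology_def
proof (intro conjI allI impI)
  fix S T :: "'n multiplication set"
  assume "\<exists>P. Ball P polyfun \<and> S = bilinear_maps - zero_locus P"
    and "\<exists>P. Ball P polyfun \<and> T = bilinear_maps - zero_locus P"
  then obtain P Q :: "('n multiplication \<Rightarrow> complex) set"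
    where P: "Ball P polyfun" "S = bilinear_maps - zero_locus P"
      and Q: "Ball Q polyfun" "T = bilinear_maps - zero_locus Q"
    by blast
  let ?R = "{\<lambda>\<mu>. p \<mu> * q \<mu> | p q. p \<in> P \<and> q \<in> Q}"
  have "Ball ?R polyfun"
    using P(1) Q(1) by (auto intro: polyfun.mult)
  moreover have "S \<inter> T = bilinear_maps - zero_locus ?R"
  proof (rule set_eqI)
    fix \<mu> :: "'n multiplication"
    have "(\<exists>r\<in>?R. r \<mu> \<noteq> 0) \<longleftrightarrow> (\<exists>p\<in>P. \<exists>q\<in>Q. p \<mu> * q \<mu> \<noteq> 0)"
      by (simp only: Bex_def mem_Collect_eq) fast
    also have "\<dots> \<longleftrightarrow> (\<exists>p\<in>P. p \<mu> \<noteq> 0) \<and> (\<exists>q\<in>Q. q \<mu> \<noteq> 0)"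
      by auto
    finally show "\<mu> \<in> S \<inter> T \<longleftrightarrow> \<mu> \<in> bilinear_maps - zero_locus ?R"
      unfolding P(2) Q(2) Int_iff mem_Diff_zero_locus by argo
  qed
  ultimately show "\<exists>P. Ball P polyfun \<and> S \<inter> T = bilinear_maps - zero_locus P"
    by blast
next
  fix K :: "'n multiplication set set"
  assume "\<forall>U\<in>K. \<exists>P. Ball P polyfun \<and> U = bilinear_maps - zero_locus P"
  from bchoice[OF this] obtain P
    where P: "\<forall>U\<in>K. Ball (P U) polyfun \<and> U = bilinear_maps - zero_locus (P U)" ..
  have "\<Union>K = (\<Union>U\<in>K. bilinear_maps - zero_locus (P U))"
    using P by auto
  also have "\<dots> = bilinear_maps - zero_locus (\<Union>(P ` K))"
    unfolding zero_locus_def by auto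
  finally have "\<Union>K = bilinear_maps - zero_locus (\<Union>(P ` K))" .
  moreover have "Ball (\<Union>(P ` K)) polyfun"
    using P by blast
  ultimately show "\<exists>P. Ball P polyfun \<and> \<Union>K = bilinear_maps - zero_locus P"
    by blast
qed

lemma openin_zariski:
  "openin zariski U \<longleftrightarrow> (\<exists>P. Ball P polyfun \<and> U = bilinear_maps - zero_locus P)"
  unfolding zariski_def topology_inverse'[OF istopology_zariski] by (rule refl)

lemma topspace_zariski [simp]: "topspace zariski = bilinear_maps"
proof
  show "topspace zariski \<subseteq> bilinear_maps"
    unfolding topspace_def openin_zariski by blast
  have "bilinear_maps = bilinear_maps - zero_locus {\<lambda>\<mu>. 1}"
    by (simp add: zero_locus_def)
  then have "openin zariski bilinear_maps"
    unfolding openin_zariski by (intro exI[of _ "{\<lambda>\<mu>. 1}"]) (auto intro: polyfun.const)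
  then show "bilinear_maps \<subseteq> topspace zariski"
    by (rule openin_subset)
qed

lemma closedin_zariski: "closedin zariski S \<longleftrightarrow> (\<exists>P. Ball P polyfun \<and> S = zero_locus P)"
proof -
  have "zero_locus P \<subseteq> bilinear_maps" for P :: "('a multiplication \<Rightarrow> complex) set"
    by (auto simp: zero_locus_def)
  then have "S \<subseteq> bilinear_maps \<and> bilinear_maps - S = bilinear_maps - zero_locus P \<longleftrightarrow> S = zero_locus P"
    for P by blast
  then show ?thesis
    unfolding closedin_def openin_zariski topspace_zariski by blast
qed

definition irreducible_in :: "'a topology \<Rightarrow> 'a set \<Rightarrow> bool" where
  "irreducible_in X S \<longleftrightarrow> S \<subseteq> topspace X \<and> S \<noteq> {} \<and>
    (\<forall>A B. closedin X A \<and> closedin X B \<and> S \<subseteq> A \<union> B \<longrightarrow> S \<subseteq> A \<or> S \<subseteq> B)"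

definition irreducible_components :: "'a topology \<Rightarrow> 'a set set" where
  "irreducible_components X =
    {C. closedin X C \<and> irreducible_in X C \<and>
        (\<forall>D. closedin X D \<and> irreducible_in X D \<and> C \<subseteq> D \<longrightarrow> D = C)}"

text \<open>
  Isomorphism classes of algebra structures on \<open>V\<close> are orbits, so the set of rigid algebras
  up to isomorphism is a set of orbits.
\<close>

definition Rig :: "'n::finite multiplication set \<Rightarrow> 'n multiplication set set" where
  "Rig X = {orbit \<mu> | \<mu>. \<mu> \<in> X \<and> openin (subtopology zariski X) (orbit \<mu>)}"

text \<open>
  In the index type \<open>6\<close> the numerals \<open>1, \<dots>, 6\<close> denote its six distinct elements
  (with \<open>6 = 0\<close>), so \<open>e 1, \<dots>, e 6\<close> is the standard basis.
\<close>

abbreviation e :: "6 \<Rightarrow> complex ^ 6" where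
  "e i \<equiv> axis i 1"

text \<open>
  A triple \<open>(i, j, v)\<close> in the table stands for \<open>e\<^sub>i e\<^sub>j = v\<close> and \<open>e\<^sub>j e\<^sub>i = - v\<close>, extended
  bilinearly; products of basis vectors not covered by the table vanish.
\<close>

definition alg :: "('n \<times> 'n \<times> (complex ^ 'n)) list \<Rightarrow> 'n::finite multiplication" where
  "alg T x y = (\<Sum>(i, j, v)\<leftarrow>T. (x $ i * y $ j - x $ j * y $ i) *s v)"

definition g5 :: "6 multiplication" where
  "g5 = alg [(1, 2, e 3), (1, 3, e 4), (1, 4, e 5), (1, 5, e 6), (2, 3, e 5), (2, 4, e 6)]"

definition g6 :: "6 multiplication" where
  "g6 = alg [(1, 2, e 3), (1, 3, e 4), (1, 4, e 5), (2, 3, e 5), (2, 5, e 6), (3, 4, - e 6)]"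

definition g7 :: "6 multiplication" where
  "g7 = alg [(1, 2, e 3), (1, 3, e 4), (1, 4, e 5), (1, 5, e 6), (2, 3, e 6)]"

definition g8 :: "6 multiplication" where
  "g8 = alg [(1, 2, e 3), (1, 3, e 4), (1, 4, e 5), (2, 5, e 6), (3, 4, - e 6)]"

definition g9 :: "6 multiplication" where
  "g9 = alg [(1, 2, e 3), (1, 3, e 4), (1, 4, e 5), (1, 5, e 6)]"

definition g14 :: "6 multiplication" where
  "g14 = alg [(1, 2, e 3), (1, 3, e 4), (1, 5, e 6), (2, 3, e 5), (2, 4, e 6)]"

definition g23 :: "6 multiplication" where
  "g23 = alg [(1, 2, e 3), (1, 3, e 4), (1, 4, e 5), (2, 3, e 6)]"

definition M6 :: "complex \<Rightarrow> 6 multiplication" where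
  "M6 \<epsilon> = alg [(1, 2, e 3), (1, 3, e 5), (1, 5, e 6), (2, 4, \<epsilon> *s e 5), (3, 4, e 6)]"

end

(* A nilpotent Malcev algebra A of dimension 6 has dim A^2 = 4 or dim A^2 <= 3.

   If dim A^2 = 4, then A is generated by two elements x, y, and the Malcev identity makes the
   products of x, y, w = xy, xw, yw, ... so rigid that a basis with an explicit multiplication table
   exists; this gives the seven orbits.  The tables form two families whose generic members are
   isomorphic to g6, so all of these algebras are degenerations of g6.

   If dim A^2 <= 3, then A has a multiplicative filtration with dimensions 6, 5, 3, 2, 1.  The
   multiplications compatible with a fixed filtration of this kind form a vector space, and a
   generic element of it is isomorphic to some M6 epsilon.  The Lie multiplications among them form
   an irreducible quadric whose generic element is M6 1, and M6 1 is itself a degeneration of g6.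

   Degenerations are limits in the Euclidean topology.  The two closures are told apart by
   determinants that vanish when dim A^2 <= 3, and irreducibility of the two closures follows by
   joining two points of a family of orbits by a rational curve. *)

theory Submission
  imports Defs
begin

section \<open>Bilinear maps and isomorphism\<close>

text \<open>For dim A^2 <= 3 the obstacle is the five-dimensional term F_2. An element x maps
  \<open>b4\<close> to a(x) \<open>b5\<close> modulo \<open>b6\<close>, and \<open>b5\<close> to
  c(x) \<open>b6\<close>; F_2 must lie in the kernels of both forms a and c. The instance x(y(xy)) =
  y(x(xy)) of the Malcev identity makes a and c proportional, so a common hyperplane exists; where
  this fails to give a basis at once, the flag inside A^2 is changed.

  For dim A^2 = 4 the same instance says J(x,y,xy) = 0 for the generators, and J(x,y,xz) = J(x,y,z)x
  carries this zero down the lower central series, which leaves few structure constants.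

  Normal forms are found for generic tables only. A special table is moved into general position by
  adding \<open>t\<close> to the constants that must not vanish, and the closure of a union of
  orbits is stable under isomorphism.

  The parameter \<epsilon> is an isomorphism invariant, so no open orbit can meet the second
  component, where the family is dense. Openness of the orbit of \<open>g6\<close> rests on an
  explicit polynomial covariant that vanishes on all other orbits.\<close>

lemma linear_cart_iff:
  fixes f :: "complex ^ 'n::finite \<Rightarrow> complex ^ 'm::finite"
  shows "Vector_Spaces.linear (*s) (*s) f \<longleftrightarrow>
    (\<forall>x y. f (x + y) = f x + f y) \<and> (\<forall>c x. f (c *s x) = c *s f x)"
  by (simp add: Vector_Spaces.linear_iff vec.vector_space_axioms)

lemma bilinear_maps_iff:
  "\<mu> \<in> bilinear_maps \<longleftrightarrow>
    (\<forall>x y z. \<mu> x (y + z) = \<mu> x y + \<mu> x z) \<and> (\<forall>c x y. \<mu> x (c *s y) = c *s \<mu> x y) \<and>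
    (\<forall>x y z. \<mu> (x + y) z = \<mu> x z + \<mu> y z) \<and> (\<forall>c x y. \<mu> (c *s x) y = c *s \<mu> x y)"
  unfolding bilinear_maps_def linear_cart_iff by blast

lemma bilinear_mapsD:
  assumes "\<mu> \<in> bilinear_maps"
  shows "\<mu> x (y + z) = \<mu> x y + \<mu> x z" "\<mu> x (c *s y) = c *s \<mu> x y"
    "\<mu> (x + y) z = \<mu> x z + \<mu> y z" "\<mu> (c *s x) y = c *s \<mu> x y"
    "\<mu> x 0 = 0" "\<mu> 0 x = 0" "\<mu> x (- y) = - \<mu> x y" "\<mu> (- x) y = - \<mu> x y"
    "\<mu> x (y - z) = \<mu> x y - \<mu> x z" "\<mu> (x - y) z = \<mu> x z - \<mu> y z"
proof -
  show add: "\<mu> x (y + z) = \<mu> x y + \<mu> x z" "\<mu> x (c *s y) = c *s \<mu> x y"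
    "\<mu> (x + y) z = \<mu> x z + \<mu> y z" "\<mu> (c *s x) y = c *s \<mu> x y" for x y z c
    using assms unfolding bilinear_maps_iff by blast+
  show "\<mu> x 0 = 0" "\<mu> 0 x = 0" for x
    using add(2)[of x 0 0] add(4)[of 0 0 x] by simp_all
  show neg: "\<mu> x (- y) = - \<mu> x y" "\<mu> (- x) y = - \<mu> x y" for x y
    using add(2)[of x "-1" y] add(4)[of "-1" x y] by (simp_all flip: vector_sneg_minus1)
  show "\<mu> x (y - z) = \<mu> x y - \<mu> x z" "\<mu> (x - y) z = \<mu> x z - \<mu> y z" for x y z
    using add(1)[of x y "-z"] add(3)[of x "-y" z] neg by simp_all
qed

lemma bilinear_sum_right:
  assumes "\<mu> \<in> bilinear_maps"
  shows "\<mu> x (\<Sum>i\<in>A. f i) = (\<Sum>i\<in>A. \<mu> x (f i))"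
  by (induction A rule: infinite_finite_induct) (auto simp: bilinear_mapsD[OF assms])

lemma bilinear_sum_left:
  assumes "\<mu> \<in> bilinear_maps"
  shows "\<mu> (\<Sum>i\<in>A. f i) x = (\<Sum>i\<in>A. \<mu> (f i) x)"
  by (induction A rule: infinite_finite_induct) (auto simp: bilinear_mapsD[OF assms])

lemma bilinear_expand:
  fixes \<mu> :: "'n::finite multiplication"
  assumes "\<mu> \<in> bilinear_maps"
  shows "\<mu> x y = (\<Sum>i\<in>UNIV. \<Sum>j\<in>UNIV. (x $ i * y $ j) *s \<mu> (axis i 1) (axis j 1))"
proof -
  have "\<mu> x y = \<mu> (\<Sum>i\<in>UNIV. x $ i *s axis i 1) (\<Sum>j\<in>UNIV. y $ j *s axis j 1)"
    by (simp only: basis_expansion)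
  also have "\<dots> = (\<Sum>i\<in>UNIV. \<Sum>j\<in>UNIV. x $ i *s (y $ j *s \<mu> (axis i 1) (axis j 1)))"
    by (simp add: bilinear_sum_right[OF assms] bilinear_sum_left[OF assms] bilinear_mapsD[OF assms]
      vec.scale_sum_right mult.commute) (rule sum.swap)
  finally show ?thesis by simp
qed

lemma alg_Nil: "alg [] x y = 0"
  and alg_Cons: "alg ((i, j, v) # T) x y = (x $ i * y $ j - x $ j * y $ i) *s v + alg T x y"
  by (simp_all add: alg_def)

lemma alg_bilinear: "alg T \<in> bilinear_maps"
  unfolding bilinear_maps_iff
  by (induction T) (auto simp: alg_Nil alg_Cons vec_eq_iff algebra_simps)

lemma alg_anticommutative: "anticommutative (alg T)"
proof -
  have "alg T x y + alg T y x = 0" for x y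
    by (induction T) (auto simp: alg_Nil alg_Cons vec_eq_iff algebra_simps)
  then show ?thesis
    unfolding anticommutative_def by (simp add: eq_neg_iff_add_eq_0)
qed

text \<open>Linear bijections replace matrices: symmetry and transitivity of the orbit relation and
  the transport of identities then come from inverting and composing maps.\<close>

lemma orbit_iff:
  fixes \<mu> \<nu> :: "'n::finite multiplication"
  shows "\<nu> \<in> orbit \<mu> \<longleftrightarrow>
    (\<exists>f. Vector_Spaces.linear (*s) (*s) f \<and> bij f \<and> (\<forall>x y. f (\<mu> x y) = \<nu> (f x) (f y)))"
proof
  assume "\<nu> \<in> orbit \<mu>"
  then obtain g where g: "invertible g" "\<nu> = gl_act g \<mu>"
    by (auto simp: orbit_def)
  have inv: "g ** matrix_inv g = mat 1" "matrix_inv g ** g = mat 1"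
    using g(1) by (simp_all add: invertible_def matrix_inv_def)
      (metis (mono_tags, lifting) someI_ex)+
  then have "bij ((*v) g)"
    by (intro o_bij[where g = "(*v) (matrix_inv g)"])
      (auto simp: fun_eq_iff matrix_vector_mul_assoc)
  moreover have "g *v \<mu> x y = \<nu> (g *v x) (g *v y)" for x y
    by (simp add: g(2) gl_act_def matrix_vector_mul_assoc inv)
  ultimately show "\<exists>f. Vector_Spaces.linear (*s) (*s) f \<and> bij f \<and> (\<forall>x y. f (\<mu> x y) = \<nu> (f x) (f y))"
    by (intro exI[of _ "(*v) g"]) auto
next
  assume "\<exists>f. Vector_Spaces.linear (*s) (*s) f \<and> bij f \<and> (\<forall>x y. f (\<mu> x y) = \<nu> (f x) (f y))"
  then obtain f where f: "Vector_Spaces.linear (*s) (*s) f" "bij f"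
    "\<And>x y. f (\<mu> x y) = \<nu> (f x) (f y)" by blast
  define g where "g = matrix f"
  have gf: "(*v) g = f"
    using f(1) unfolding g_def by simp
  have "inj ((*v) g)"
    using f(2) gf by (simp add: bij_is_inj)
  then have ginv: "invertible g"
    using matrix_left_invertible_injective invertible_left_inverse by blast
  then have inv: "g ** matrix_inv g = mat 1"
    by (simp add: invertible_def matrix_inv_def) (metis (mono_tags, lifting) someI_ex)
  have "\<nu> x y = gl_act g \<mu> x y" for x y
  proof -
    have "f (matrix_inv g *v z) = z" for z
      using inv by (simp flip: gf add: matrix_vector_mul_assoc)
    then show ?thesis
      by (simp add: gl_act_def gf f(3))
  qed
  then show "\<nu> \<in> orbit \<mu>"
    using ginv unfolding orbit_def by blast
qed

lemma orbit_refl: "\<mu> \<in> orbit \<mu>"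
  unfolding orbit_iff by (intro exI[of _ id]) (auto simp: linear_cart_iff)

lemma orbit_sym: "\<nu> \<in> orbit \<mu> \<Longrightarrow> \<mu> \<in> orbit \<nu>"
  unfolding orbit_iff
proof (elim exE conjE)
  fix f assume f: "Vector_Spaces.linear (*s) (*s) f" "bij f" "\<forall>x y. f (\<mu> x y) = \<nu> (f x) (f y)"
  have i: "f (inv f x) = x" "inv f (f x) = x" for x
    using f(2) by (simp_all add: bij_is_surj surj_f_inv_f bij_is_inj)
  have "inv f (x + y) = inv f x + inv f y" "inv f (c *s x) = c *s inv f x" for c x y
    using f(1) i unfolding linear_cart_iff by metis+
  then show "\<exists>f. Vector_Spaces.linear (*s) (*s) f \<and> bij f \<and> (\<forall>x y. f (\<nu> x y) = \<mu> (f x) (f y))"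
    using f i by (intro exI[of _ "inv f"]) (auto simp: linear_cart_iff bij_imp_bij_inv, metis)
qed

lemma orbit_trans:
  assumes "\<rho> \<in> orbit \<nu>" "\<nu> \<in> orbit \<mu>"
  shows "\<rho> \<in> orbit \<mu>"
proof -
  obtain f g where f: "Vector_Spaces.linear (*s) (*s) f" "bij f" "\<forall>x y. f (\<mu> x y) = \<nu> (f x) (f y)"
    and g: "Vector_Spaces.linear (*s) (*s) g" "bij g" "\<forall>x y. g (\<nu> x y) = \<rho> (g x) (g y)"
    using assms unfolding orbit_iff by blast
  then show ?thesis
    unfolding orbit_iff by (intro exI[of _ "g \<circ> f"]) (auto simp: linear_cart_iff bij_comp)
qed

lemma orbit_eq: "\<nu> \<in> orbit \<mu> \<Longrightarrow> orbit \<nu> = orbit \<mu>"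
  using orbit_sym orbit_trans by blast

lemma orbit_bilinear:
  assumes "\<mu> \<in> bilinear_maps" "\<nu> \<in> orbit \<mu>"
  shows "\<nu> \<in> bilinear_maps"
proof -
  obtain g where "\<nu> = gl_act g \<mu>"
    using assms(2) by (auto simp: orbit_def)
  then show ?thesis
    unfolding bilinear_maps_iff gl_act_def
    by (simp add: bilinear_mapsD[OF assms(1)] matrix_vector_right_distrib vec.scale_right_distrib
       matrix_vector_mult_scaleR vector_scalar_commute)
qed

lemma orbit_anticommutative:
  assumes "anticommutative \<mu>" "\<nu> \<in> orbit \<mu>"
  shows "anticommutative \<nu>"
proof -
  obtain g where "\<nu> = gl_act g \<mu>"
    using assms(2) by (auto simp: orbit_def)
  then show ?thesis
    using assms(1) unfolding anticommutative_def gl_act_def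
    by (metis (no_types) vec.linear_neg matrix_vector_mul_linear_gen)
qed

text \<open>A spanning family with as many members as the dimension is a basis, so the normal forms
  below never have to prove linear independence.\<close>

lemma spanning_family_bij:
  fixes b :: "'n::finite \<Rightarrow> complex ^ 'n"
  assumes "vec.span (range b) = UNIV"
  defines "f \<equiv> \<lambda>x. \<Sum>i\<in>UNIV. x $ i *s b i"
  shows "Vector_Spaces.linear (*s) (*s) f" "bij f"
proof -
  show lin: "Vector_Spaces.linear (*s) (*s) f"
    unfolding linear_cart_iff f_def
    by (auto simp: vec.scale_left_distrib sum.distrib vec.scale_sum_right)
  have fb: "f (axis i 1) = b i" for i
    unfolding f_def axis_def by (simp add: if_distrib[of "\<lambda>c. c *s _"] cong: if_cong)
  have sub: "vec.subspace (range f)"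
    using vec.linear_subspace_image[OF lin vec.subspace_UNIV] .
  have "range b \<subseteq> range f"
    using fb by (metis image_subsetI rangeI)
  then have "vec.span (range b) \<subseteq> range f"
    by (rule vec.span_minimal[OF _ sub])
  then have "surj f" using assms(1) by auto
  then show "bij f"
    using vec.linear_surj_imp_inj[OF lin] by (simp add: bij_def)
qed

lemma orbit_by_basis:
  fixes b :: "'n::finite \<Rightarrow> complex ^ 'n"
  assumes "\<mu> \<in> bilinear_maps" "\<nu> \<in> bilinear_maps"
    and "vec.span (range b) = UNIV"
    and "\<And>i j. \<mu> (b i) (b j) = (\<Sum>k\<in>UNIV. \<nu> (axis i 1) (axis j 1) $ k *s b k)"
  shows "\<mu> \<in> orbit \<nu>"
proof -
  define f where "f = (\<lambda>x. \<Sum>i\<in>UNIV. x $ i *s b i)"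
  note f = spanning_family_bij[OF assms(3), folded f_def]
  note flin = vec.linear_sum[OF f(1)] vec.linear_scale[OF f(1)]
  have "f (\<nu> x y) = \<mu> (f x) (f y)" for x y
  proof -
    have "f (\<nu> x y) = (\<Sum>i\<in>UNIV. \<Sum>j\<in>UNIV. (x $ i * y $ j) *s f (\<nu> (axis i 1) (axis j 1)))"
      by (subst bilinear_expand[OF assms(2)]) (simp add: flin)
    also have "\<dots> = (\<Sum>i\<in>UNIV. \<Sum>j\<in>UNIV. (x $ i * y $ j) *s \<mu> (b i) (b j))"
      by (simp only: assms(4) f_def)
    also have "\<dots> = \<mu> (f x) (f y)"
      unfolding f_def
      by (simp add: bilinear_sum_right[OF assms(1)] bilinear_sum_left[OF assms(1)]
          bilinear_mapsD[OF assms(1)] vec.scale_sum_right mult.commute) (rule sum.swap)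
    finally show ?thesis .
  qed
  with f show ?thesis unfolding orbit_iff by blast
qed

section \<open>Coordinates in dimension six\<close>

lemma UNIV_6: "(UNIV :: 6 set) = {1, 2, 3, 4, 5, 6}"
proof -
  have "card {1, 2, 3, 4, 5, 6 :: 6} = CARD(6)" by simp
  then show ?thesis by (metis card_subset_eq finite subset_UNIV)
qed

lemma sum_6: "(\<Sum>i\<in>UNIV. f (i::6)) = f 1 + f 2 + f 3 + f 4 + f 5 + f 6"
  unfolding UNIV_6 by (simp add: add.assoc)

lemma forall_6: "(\<forall>i::6. P i) \<longleftrightarrow> P 1 \<and> P 2 \<and> P 3 \<and> P 4 \<and> P 5 \<and> P 6"
proof -
  have "(\<forall>i::6. P i) \<longleftrightarrow> (\<forall>i\<in>UNIV. P i)" by simp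
  then show ?thesis unfolding UNIV_6 by simp
qed

definition vec6 :: "'a \<Rightarrow> 'a \<Rightarrow> 'a \<Rightarrow> 'a \<Rightarrow> 'a \<Rightarrow> 'a \<Rightarrow> 6 \<Rightarrow> 'a" where
  "vec6 a b c d u v i = (if i = 1 then a else if i = 2 then b else if i = 3 then c
    else if i = 4 then d else if i = 5 then u else v)"

lemma vec6_simps [simp]:
  "vec6 a b c d u v 1 = a" "vec6 a b c d u v 2 = b" "vec6 a b c d u v 3 = c"
  "vec6 a b c d u v 4 = d" "vec6 a b c d u v 5 = u" "vec6 a b c d u v 6 = v"
  by (simp_all add: vec6_def)

lemma range_vec6: "range (vec6 a b c d u v) = {a, b, c, d, u, v}"
  unfolding UNIV_6 by simp

text \<open>The common last step of the normal forms. \<open>L\<close> reads a vector of the model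
  algebra in the new basis, and anticommutativity reduces 36 products of basis vectors to the 15
  above the diagonal.\<close>

lemma orbit_by_basis_6:
  fixes \<mu> :: "6 multiplication"
  assumes "\<mu> \<in> bilinear_maps" "anticommutative \<mu>" "\<nu> \<in> bilinear_maps" "anticommutative \<nu>"
    and span: "vec.span {b1, b2, b3, b4, b5, b6} = UNIV"
  defines "L \<equiv> \<lambda>v. v $ 1 *s b1 + v $ 2 *s b2 + v $ 3 *s b3 + v $ 4 *s b4 + v $ 5 *s b5 + v $ 6 *s b6"
  assumes table:
    "\<mu> b1 b2 = L (\<nu> (e 1) (e 2))" "\<mu> b1 b3 = L (\<nu> (e 1) (e 3))" "\<mu> b1 b4 = L (\<nu> (e 1) (e 4))"
    "\<mu> b1 b5 = L (\<nu> (e 1) (e 5))" "\<mu> b1 b6 = L (\<nu> (e 1) (e 6))" "\<mu> b2 b3 = L (\<nu> (e 2) (e 3))"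
    "\<mu> b2 b4 = L (\<nu> (e 2) (e 4))" "\<mu> b2 b5 = L (\<nu> (e 2) (e 5))" "\<mu> b2 b6 = L (\<nu> (e 2) (e 6))"
    "\<mu> b3 b4 = L (\<nu> (e 3) (e 4))" "\<mu> b3 b5 = L (\<nu> (e 3) (e 5))" "\<mu> b3 b6 = L (\<nu> (e 3) (e 6))"
    "\<mu> b4 b5 = L (\<nu> (e 4) (e 5))" "\<mu> b4 b6 = L (\<nu> (e 4) (e 6))" "\<mu> b5 b6 = L (\<nu> (e 5) (e 6))"
  shows "\<mu> \<in> orbit \<nu>"
proof (rule orbit_by_basis[where b = "vec6 b1 b2 b3 b4 b5 b6"])
  have anti: "\<mu> x y = - \<mu> y x" "\<nu> x y = - \<nu> y x" for x y
    using assms(2,4) unfolding anticommutative_def by blast+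
  have diag: "\<mu> x x = 0" "\<nu> x x = 0" for x
    using anti(1)[of x x] anti(2)[of x x] by (simp_all add: vec_eq_iff eq_neg_iff_add_eq_0)
  have Lneg: "L (- v) = - L v" for v by (simp add: L_def)
  have L0: "L 0 = 0" by (simp add: L_def)
  have swap: "\<mu> y x = L (\<nu> (e j) (e i))" if "\<mu> x y = L (\<nu> (e i) (e j))" for x y i j
    using that anti[of y x] anti(2)[of "e j" "e i"] Lneg[of "\<nu> (e i) (e j)"] by simp
  let ?b = "vec6 b1 b2 b3 b4 b5 b6"
  have "\<forall>i j. \<mu> (?b i) (?b j) = L (\<nu> (e i) (e j))"
    unfolding forall_6
    by (simp add: table table[THEN swap] diag L0)
  then show "\<mu> (?b i) (?b j) = (\<Sum>k\<in>UNIV. \<nu> (e i) (e j) $ k *s ?b k)" for i j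
    by (simp add: sum_6 L_def)
qed (use assms in \<open>simp_all add: range_vec6\<close>)

section \<open>Zariski closed sets of structure constants\<close>

definition regular :: "('n::finite multiplication \<Rightarrow> complex) \<Rightarrow> bool" where
  "regular f \<longleftrightarrow> (\<exists>p. polyfun p \<and> (\<forall>\<mu>\<in>bilinear_maps. f \<mu> = p \<mu>))"

definition polymap :: "('n::finite multiplication \<Rightarrow> complex ^ 'm) \<Rightarrow> bool" where
  "polymap F \<longleftrightarrow> (\<forall>k. regular (\<lambda>\<mu>. F \<mu> $ k))"

lemma regular_const: "regular (\<lambda>\<mu>. c)"
  unfolding regular_def by (intro exI[of _ "\<lambda>\<mu>. c"]) (auto intro: polyfun.const)

lemma regular_add: "regular f \<Longrightarrow> regular g \<Longrightarrow> regular (\<lambda>\<mu>. f \<mu> + g \<mu>)"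
  unfolding regular_def by (metis (no_types, lifting) polyfun.add)

lemma regular_mult: "regular f \<Longrightarrow> regular g \<Longrightarrow> regular (\<lambda>\<mu>. f \<mu> * g \<mu>)"
  unfolding regular_def by (metis (no_types, lifting) polyfun.mult)

lemma regular_uminus: "regular f \<Longrightarrow> regular (\<lambda>\<mu>. - f \<mu>)"
  using regular_mult[OF regular_const[of "-1"]] by simp

lemma regular_diff: "regular f \<Longrightarrow> regular g \<Longrightarrow> regular (\<lambda>\<mu>. f \<mu> - g \<mu>)"
  using regular_add[OF _ regular_uminus] by fastforce

lemma regular_sum: "(\<And>i. i \<in> A \<Longrightarrow> regular (f i)) \<Longrightarrow> regular (\<lambda>\<mu>. \<Sum>i\<in>A. f i \<mu>)"
  by (induction A rule: infinite_finite_induct) (auto intro: regular_const regular_add)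

lemma regular_prod: "(\<And>i. i \<in> A \<Longrightarrow> regular (f i)) \<Longrightarrow> regular (\<lambda>\<mu>. \<Prod>i\<in>A. f i \<mu>)"
  by (induction A rule: infinite_finite_induct) (auto intro: regular_const regular_mult)

lemma regular_det:
  "(\<And>i j. regular (\<lambda>\<mu>. M \<mu> $ i $ j)) \<Longrightarrow> regular (\<lambda>\<mu>. det (M \<mu>))"
  unfolding det_def by (intro regular_sum regular_mult regular_const regular_prod)

lemma regular_nth: "polymap F \<Longrightarrow> regular (\<lambda>\<mu>. F \<mu> $ k)"
  by (simp add: polymap_def)

lemma polymap_const: "polymap (\<lambda>\<mu>. c)"
  by (simp add: polymap_def regular_const)

lemma polymap_add: "polymap F \<Longrightarrow> polymap G \<Longrightarrow> polymap (\<lambda>\<mu>. F \<mu> + G \<mu>)"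
  by (simp add: polymap_def regular_add)

lemma polymap_diff: "polymap F \<Longrightarrow> polymap G \<Longrightarrow> polymap (\<lambda>\<mu>. F \<mu> - G \<mu>)"
  by (simp add: polymap_def regular_diff)

lemma polymap_scale: "regular f \<Longrightarrow> polymap G \<Longrightarrow> polymap (\<lambda>\<mu>. f \<mu> *s G \<mu>)"
  by (simp add: polymap_def regular_mult)

lemma polymap_matrix: "polymap F \<Longrightarrow> polymap (\<lambda>\<mu>. A *v F \<mu>)"
  by (simp add: polymap_def matrix_vector_mult_def regular_sum regular_mult regular_const)

lemma polymap_mult:
  assumes "polymap F" "polymap G"
  shows "polymap (\<lambda>\<mu>. \<mu> (F \<mu>) (G \<mu>))"
  unfolding polymap_def
proof
  fix k
  have c: "regular (\<lambda>\<mu>. \<mu> (axis i 1) (axis j 1) $ k)" for i j :: 'a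
    unfolding regular_def by (rule exI) (auto intro: polyfun.coord)
  have "regular (\<lambda>\<mu>. \<Sum>i\<in>UNIV. \<Sum>j\<in>UNIV. (F \<mu> $ i * G \<mu> $ j) * \<mu> (axis i 1) (axis j 1) $ k)"
    by (intro regular_sum regular_mult c regular_nth assms)
  then obtain p where p: "polyfun p" "\<And>\<mu>. \<mu> \<in> bilinear_maps \<Longrightarrow>
      (\<Sum>i\<in>UNIV. \<Sum>j\<in>UNIV. (F \<mu> $ i * G \<mu> $ j) * \<mu> (axis i 1) (axis j 1) $ k) = p \<mu>"
    unfolding regular_def by blast
  have "\<mu> (F \<mu>) (G \<mu>) $ k = p \<mu>" if "\<mu> \<in> bilinear_maps" for \<mu>
    using p(2)[OF that] by (subst bilinear_expand[OF that]) simp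
  with p(1) show "regular (\<lambda>\<mu>. \<mu> (F \<mu>) (G \<mu>) $ k)"
    unfolding regular_def by blast
qed

lemmas polymap_intros = polymap_const polymap_add polymap_diff polymap_scale polymap_mult regular_nth

lemma closedin_regular:
  assumes "\<And>f. f \<in> A \<Longrightarrow> regular f"
  shows "closedin zariski {\<mu> \<in> bilinear_maps. \<forall>f\<in>A. f \<mu> = 0}"
proof -
  have "\<forall>f\<in>A. \<exists>p. polyfun p \<and> (\<forall>\<mu>\<in>bilinear_maps. f \<mu> = p \<mu>)"
    using assms unfolding regular_def by blast
  then obtain p where p: "\<forall>f\<in>A. polyfun (p f) \<and> (\<forall>\<mu>\<in>bilinear_maps. f \<mu> = p f \<mu>)"
    by (rule bchoice[THEN exE])
  then have "{\<mu> \<in> bilinear_maps. \<forall>f\<in>A. f \<mu> = 0} = zero_locus (p ` A)"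
    unfolding zero_locus_def by auto
  then show ?thesis
    unfolding closedin_zariski using p by blast
qed

lemma closedin_polymap:
  assumes "\<And>i. i \<in> I \<Longrightarrow> polymap (F i)"
  shows "closedin zariski {\<mu> \<in> bilinear_maps. \<forall>i\<in>I. F i \<mu> = 0}"
proof -
  have "{\<mu> \<in> bilinear_maps. \<forall>i\<in>I. F i \<mu> = 0} =
      {\<mu> \<in> bilinear_maps. \<forall>f\<in>{\<lambda>\<mu>. F i \<mu> $ k | i k. i \<in> I}. f \<mu> = 0}"
    by (auto simp: vec_eq_iff)
  then show ?thesis
    using closedin_regular[of "{\<lambda>\<mu>. F i \<mu> $ k | i k. i \<in> I}"] assms regular_nth by fastforce
qed

text \<open>A \<open>polyfun\<close> depends continuously on the structure constants, so an equation
  that holds for all small \<open>t \<noteq> 0\<close> survives in the limit.\<close>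

lemma closedin_zariski_limit:
  fixes F :: "complex \<Rightarrow> 'n::finite multiplication"
  assumes "closedin zariski S" "\<mu> \<in> bilinear_maps"
    and ev: "\<forall>\<^sub>F t in at 0. F t \<in> S"
    and lim: "\<And>i j k. ((\<lambda>t. F t (axis i 1) (axis j 1) $ k) \<longlongrightarrow> \<mu> (axis i 1) (axis j 1) $ k) (at 0)"
  shows "\<mu> \<in> S"
proof -
  obtain P where P: "Ball P polyfun" "S = zero_locus P"
    using assms(1) unfolding closedin_zariski by blast
  have tend: "((\<lambda>t. p (F t)) \<longlongrightarrow> p \<mu>) (at 0)" if "polyfun p" for p
    using that by induction (auto intro: tendsto_intros lim)
  have "p \<mu> = 0" if "p \<in> P" for p
  proof -
    have "\<forall>\<^sub>F t in at 0. p (F t) = 0"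
      using ev by eventually_elim (use that in \<open>simp add: P(2) zero_locus_def\<close>)
    then have "((\<lambda>t. p (F t)) \<longlongrightarrow> 0) (at 0)"
      by (rule tendsto_eventually)
    then show ?thesis
      using tend P(1) that tendsto_unique trivial_limit_at by blast
  qed
  then show ?thesis
    using assms(2) by (simp add: P(2) zero_locus_def)
qed

text \<open>For fixed \<open>g\<close> the structure constants of \<open>gl_act g \<mu>\<close> are
  polynomials in those of \<open>\<mu>\<close>. The equations of the closure, pulled back along
  \<open>g\<close>, hold on \<open>S\<close> and therefore on its closure.\<close>

lemma closure_of_orbit_invariant:
  fixes S :: "'n::finite multiplication set"
  assumes S: "S \<subseteq> bilinear_maps" "\<And>\<mu>. \<mu> \<in> S \<Longrightarrow> orbit \<mu> \<subseteq> S"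
    and "\<mu> \<in> zariski closure_of S" "\<nu> \<in> orbit \<mu>"
  shows "\<nu> \<in> zariski closure_of S"
proof -
  obtain g where g: "invertible g" "\<nu> = gl_act g \<mu>"
    using assms(4) by (auto simp: orbit_def)
  have \<mu>: "\<mu> \<in> bilinear_maps"
    using assms(3) closure_of_subset_topspace by fastforce
  obtain P where P: "Ball P polyfun" "zariski closure_of S = zero_locus P"
    using closedin_closure_of closedin_zariski by blast
  have reg: "regular (\<lambda>\<mu>. p (gl_act g \<mu>))" if "polyfun p" for p
    using that
  proof induction
    case (coord i j k)
    have "polymap (\<lambda>\<mu>. gl_act g \<mu> (axis i 1) (axis j 1))"
      unfolding gl_act_def by (intro polymap_matrix polymap_intros)
    then show ?case by (rule regular_nth)
  qed (auto intro: regular_const regular_add regular_mult)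
  let ?A = "{\<lambda>\<mu>. p (gl_act g \<mu>) | p. p \<in> P}"
  have "S \<subseteq> {\<mu> \<in> bilinear_maps. \<forall>f\<in>?A. f \<mu> = 0}"
  proof
    fix \<rho> assume \<rho>: "\<rho> \<in> S"
    then have "gl_act g \<rho> \<in> S" using S(2) g(1) by (auto simp: orbit_def)
    then have "gl_act g \<rho> \<in> zero_locus P"
      using closure_of_subset[of S zariski] S(1) P(2) by auto
    with \<rho> S(1) show "\<rho> \<in> {\<mu> \<in> bilinear_maps. \<forall>f\<in>?A. f \<mu> = 0}"
      by (auto simp: zero_locus_def)
  qed
  moreover have "closedin zariski {\<mu> \<in> bilinear_maps. \<forall>f\<in>?A. f \<mu> = 0}"
    by (rule closedin_regular) (use P(1) reg in auto)
  ultimately have "zariski closure_of S \<subseteq> {\<mu> \<in> bilinear_maps. \<forall>f\<in>?A. f \<mu> = 0}"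
    by (rule closure_of_minimal)
  then have "\<mu> \<in> {\<mu> \<in> bilinear_maps. \<forall>f\<in>?A. f \<mu> = 0}"
    using assms(3) by (rule subsetD)
  then have "\<nu> \<in> zero_locus P"
    using orbit_bilinear[OF \<mu> assms(4)] by (auto simp: zero_locus_def g(2))
  then show ?thesis using P(2) by simp
qed

section \<open>Irreducibility of families of orbits\<close>

definition polynomial_fun :: "(complex \<Rightarrow> complex) \<Rightarrow> bool" where
  "polynomial_fun h \<longleftrightarrow> (\<exists>P. \<forall>s. h s = poly P s)"

lemma polynomial_fun_const: "polynomial_fun (\<lambda>s. c)"
  unfolding polynomial_fun_def by (rule exI[of _ "[:c:]"]) simp

lemma polynomial_fun_id: "polynomial_fun (\<lambda>s. s)"
  unfolding polynomial_fun_def by (rule exI[of _ "[:0, 1:]"]) simp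

lemma polynomial_fun_add: "polynomial_fun f \<Longrightarrow> polynomial_fun g \<Longrightarrow> polynomial_fun (\<lambda>s. f s + g s)"
  unfolding polynomial_fun_def by (metis poly_add)

lemma polynomial_fun_mult: "polynomial_fun f \<Longrightarrow> polynomial_fun g \<Longrightarrow> polynomial_fun (\<lambda>s. f s * g s)"
  unfolding polynomial_fun_def by (metis poly_mult)

lemma polynomial_fun_diff: "polynomial_fun f \<Longrightarrow> polynomial_fun g \<Longrightarrow> polynomial_fun (\<lambda>s. f s - g s)"
  unfolding polynomial_fun_def by (metis poly_diff)

lemma polynomial_fun_sum: "(\<And>i. i \<in> A \<Longrightarrow> polynomial_fun (f i)) \<Longrightarrow> polynomial_fun (\<lambda>s. \<Sum>i\<in>A. f i s)"
  by (induction A rule: infinite_finite_induct) (auto intro: polynomial_fun_const polynomial_fun_add)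

lemma polynomial_fun_prod: "(\<And>i. i \<in> A \<Longrightarrow> polynomial_fun (f i)) \<Longrightarrow> polynomial_fun (\<lambda>s. \<Prod>i\<in>A. f i s)"
  by (induction A rule: infinite_finite_induct) (auto intro: polynomial_fun_const polynomial_fun_mult)

lemma polynomial_fun_power: "polynomial_fun f \<Longrightarrow> polynomial_fun (\<lambda>s. f s ^ k)"
  by (induction k) (auto intro: polynomial_fun_const polynomial_fun_mult)

lemma polynomial_fun_det:
  "(\<And>i j. polynomial_fun (\<lambda>s. M s $ i $ j)) \<Longrightarrow> polynomial_fun (\<lambda>s. det (M s))"
  unfolding det_def
  by (intro polynomial_fun_sum polynomial_fun_mult polynomial_fun_const polynomial_fun_prod)

lemma polynomial_fun_compose: "polynomial_fun f \<Longrightarrow> polynomial_fun g \<Longrightarrow> polynomial_fun (\<lambda>s. f (g s))"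
  unfolding polynomial_fun_def by (metis poly_pcompose)

lemmas polynomial_fun_intros = polynomial_fun_const polynomial_fun_id polynomial_fun_add
  polynomial_fun_mult polynomial_fun_diff polynomial_fun_power

text \<open>Functions in the localisation of the polynomials at \<open>d\<close>. Zeros of
  \<open>d\<close> are left unconstrained, since \<open>matrix_inv\<close> has no meaningful value
  at a singular matrix.\<close>

definition fraction_fun :: "(complex \<Rightarrow> complex) \<Rightarrow> (complex \<Rightarrow> complex) \<Rightarrow> bool" where
  "fraction_fun d h \<longleftrightarrow> (\<exists>k f. polynomial_fun f \<and> (\<forall>s. d s \<noteq> 0 \<longrightarrow> h s * d s ^ k = f s))"

lemma fraction_fun_polynomial: "polynomial_fun f \<Longrightarrow> fraction_fun d f"
  unfolding fraction_fun_def by (rule exI[of _ 0]) auto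

lemma fraction_fun_divide: "polynomial_fun f \<Longrightarrow> fraction_fun d (\<lambda>s. f s / d s)"
  unfolding fraction_fun_def by (rule exI[of _ 1]) auto

lemma fraction_fun_mult:
  assumes "fraction_fun d f" "fraction_fun d g"
  shows "fraction_fun d (\<lambda>s. f s * g s)"
proof -
  obtain k l p q where *: "polynomial_fun p" "\<And>s. d s \<noteq> 0 \<Longrightarrow> f s * d s ^ k = p s"
    "polynomial_fun q" "\<And>s. d s \<noteq> 0 \<Longrightarrow> g s * d s ^ l = q s"
    using assms unfolding fraction_fun_def by blast
  have "f s * g s * d s ^ (k + l) = p s * q s" if "d s \<noteq> 0" for s
    using *(2,4)[OF that] by (auto simp: power_add algebra_simps)
  then show ?thesis
    unfolding fraction_fun_def using polynomial_fun_mult[OF *(1,3)] by blast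
qed

lemma fraction_fun_add:
  assumes d: "polynomial_fun d" and "fraction_fun d f" "fraction_fun d g"
  shows "fraction_fun d (\<lambda>s. f s + g s)"
proof -
  obtain k l p q where *: "polynomial_fun p" "\<And>s. d s \<noteq> 0 \<Longrightarrow> f s * d s ^ k = p s"
    "polynomial_fun q" "\<And>s. d s \<noteq> 0 \<Longrightarrow> g s * d s ^ l = q s"
    using assms unfolding fraction_fun_def by blast
  have "(f s + g s) * d s ^ (k + l) = p s * d s ^ l + q s * d s ^ k" if "d s \<noteq> 0" for s
    by (simp add: power_add algebra_simps flip: *(2)[OF that] *(4)[OF that])
  moreover have "polynomial_fun (\<lambda>s. p s * d s ^ l + q s * d s ^ k)"
    by (intro polynomial_fun_intros * d)
  ultimately show ?thesis
    unfolding fraction_fun_def by blast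
qed

lemma fraction_fun_sum:
  assumes d: "polynomial_fun d" and "\<And>i. i \<in> A \<Longrightarrow> fraction_fun d (f i)"
  shows "fraction_fun d (\<lambda>s. \<Sum>i\<in>A. f i s)"
  using assms(2)
  by (induction A rule: infinite_finite_induct)
    (auto intro: fraction_fun_polynomial polynomial_fun_const fraction_fun_add[OF d])

lemma matrix_inv_right_vec: "invertible (g :: complex ^ 'n ^ 'n::finite) \<Longrightarrow> g *v (matrix_inv g *v x) = x"
  unfolding invertible_def matrix_inv_def matrix_vector_mul_assoc
  by (metis (mono_tags, lifting) matrix_vector_mul_lid someI_ex)

lemma fraction_fun_gl_act:
  fixes G :: "complex \<Rightarrow> complex ^ 'n ^ 'n::finite"
  assumes G: "\<And>i j. polynomial_fun (\<lambda>s. G s $ i $ j)"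
    and F: "\<And>i j k. polynomial_fun (\<lambda>s. F s (axis i 1) (axis j 1) $ k)"
    and bil: "\<And>s. F s \<in> bilinear_maps"
    and p: "polyfun p"
  shows "fraction_fun (\<lambda>s. det (G s)) (\<lambda>s. p (gl_act (G s) (F s)))"
  using p
proof induction
  case (const c)
  then show ?case by (intro fraction_fun_polynomial polynomial_fun_intros)
next
  case (coord i j k)
  have d: "polynomial_fun (\<lambda>s. det (G s))"
    by (rule polynomial_fun_det[OF G])
  \<comment> \<open>Cramer's rule gives column \<open>i\<close> of the inverse matrix, so that
    \<open>det (G s)\<close> is the only denominator in the transported structure constants.\<close>
  let ?w = "\<lambda>s i a. det (\<chi> r c. if c = a then axis i 1 $ r else G s $ r $ c) / det (G s)"
  have w: "fraction_fun (\<lambda>s. det (G s)) (\<lambda>s. ?w s i a)" for i a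
  proof (intro fraction_fun_divide polynomial_fun_det)
    show "polynomial_fun (\<lambda>s. (\<chi> r c. if c = a then axis i 1 $ r else G s $ r $ c) $ r $ c)" for r c
      by (cases "c = a") (simp_all add: G polynomial_fun_const)
  qed
  have inv: "matrix_inv (G s) *v axis i 1 = (\<chi> a. ?w s i a)" if "det (G s) \<noteq> 0" for s i
    using cramer[OF that, of "matrix_inv (G s) *v axis i 1" "axis i 1"] that
    by (simp add: matrix_inv_right_vec invertible_det_nz)
  define R where "R = (\<lambda>s. \<Sum>c\<in>UNIV. G s $ k $ c *
     (\<Sum>a\<in>UNIV. \<Sum>b\<in>UNIV. (?w s i a * ?w s j b) * F s (axis a 1) (axis b 1) $ c))"
  have R: "fraction_fun (\<lambda>s. det (G s)) R"
    unfolding R_def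
    by (intro fraction_fun_sum[OF d] fraction_fun_mult w fraction_fun_polynomial[OF F] fraction_fun_polynomial[OF G])
  have "gl_act (G s) (F s) (axis i 1) (axis j 1) $ k = R s" if "det (G s) \<noteq> 0" for s
    unfolding gl_act_def R_def inv[OF that] matrix_vector_mult_def[of "G s"]
    by (subst bilinear_expand[OF bil]) simp
  then show ?case
    using R unfolding fraction_fun_def by metis
next
  case (add p q)
  show ?case by (rule fraction_fun_add[OF polynomial_fun_det[OF G] add.IH])
next
  case (mult p q)
  show ?case by (rule fraction_fun_mult[OF mult.IH])
qed

text \<open>Two points of the family are joined by a rational curve in the family.\<close>

lemma irreducible_in_orbit_family:
  fixes F :: "complex \<Rightarrow> 'n::finite multiplication"
  assumes F: "\<And>i j k. polynomial_fun (\<lambda>s. F s (axis i 1) (axis j 1) $ k)"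
    and bil: "\<And>s. F s \<in> bilinear_maps"
  shows "irreducible_in zariski (\<Union>s. orbit (F s))"
  unfolding irreducible_in_def
proof (intro conjI allI impI)
  show sub: "(\<Union>s. orbit (F s)) \<subseteq> topspace zariski"
    using orbit_bilinear[OF bil] by auto
  show "(\<Union>s. orbit (F s)) \<noteq> {}"
    using orbit_refl by blast
  fix A B :: "'n multiplication set"
  assume AB: "closedin zariski A \<and> closedin zariski B \<and> (\<Union>s. orbit (F s)) \<subseteq> A \<union> B"
  then obtain P Q where P: "Ball P polyfun" "A = zero_locus P" and Q: "Ball Q polyfun" "B = zero_locus Q"
    unfolding closedin_zariski by blast
  show "(\<Union>s. orbit (F s)) \<subseteq> A \<or> (\<Union>s. orbit (F s)) \<subseteq> B"
  proof (rule ccontr)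
    assume "\<not> ?thesis"
    then obtain a b g h where g: "invertible g" "gl_act g (F a) \<notin> A" and h: "invertible h" "gl_act h (F b) \<notin> B"
      by (auto simp: orbit_def)
    have in_bil: "gl_act k (F s) \<in> bilinear_maps" if "invertible k" for k s
      using orbit_bilinear[OF bil] that by (auto simp: orbit_def)
    obtain p where p: "p \<in> P" "p (gl_act g (F a)) \<noteq> 0"
      using g in_bil[OF g(1)] by (auto simp: P(2) zero_locus_def)
    obtain q where q: "q \<in> Q" "q (gl_act h (F b)) \<noteq> 0"
      using h in_bil[OF h(1)] by (auto simp: Q(2) zero_locus_def)
    \<comment> \<open>Matrices and parameters are joined by straight segments. Singular matrices on
      the way are harmless: \<open>det (G s)\<close> is a nonzero polynomial, because
      \<open>g\<close> is invertible.\<close>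
    define G where "G = (\<lambda>s. \<chi> i j. (1 - s) * g $ i $ j + s * h $ i $ j)"
    define H where "H = (\<lambda>s. F ((1 - s) * a + s * b))"
    have Gp: "polynomial_fun (\<lambda>s. G s $ i $ j)" for i j
      unfolding G_def by (simp, intro polynomial_fun_intros)
    have Hp: "polynomial_fun (\<lambda>s. H s (axis i 1) (axis j 1) $ k)" for i j k
      unfolding H_def by (rule polynomial_fun_compose[OF F]) (intro polynomial_fun_intros)
    have G01: "G 0 = g" "G 1 = h" and H01: "H 0 = F a" "H 1 = F b"
      by (simp_all add: G_def H_def)
    have Hbil: "H s \<in> bilinear_maps" for s by (simp add: H_def bil)
    obtain k f where f: "polynomial_fun f"
      "\<And>s. det (G s) \<noteq> 0 \<Longrightarrow> p (gl_act (G s) (H s)) * det (G s) ^ k = f s"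
      using fraction_fun_gl_act[OF Gp Hp Hbil, of p] P(1) p(1) unfolding fraction_fun_def by blast
    obtain l f' where f': "polynomial_fun f'"
      "\<And>s. det (G s) \<noteq> 0 \<Longrightarrow> q (gl_act (G s) (H s)) * det (G s) ^ l = f' s"
      using fraction_fun_gl_act[OF Gp Hp Hbil, of q] Q(1) q(1) unfolding fraction_fun_def by blast
    obtain D where D: "\<And>s. det (G s) = poly D s"
      using polynomial_fun_det[OF Gp] unfolding polynomial_fun_def by blast
    obtain R S where R: "\<And>s. f s = poly R s" and S: "\<And>s. f' s = poly S s"
      using f(1) f'(1) unfolding polynomial_fun_def by blast
    \<comment> \<open>Each point of the curve with invertible matrix lies in \<open>A\<close> or in
      \<open>B\<close>, so the product vanishes identically; yet \<open>D\<close> and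
      \<open>R\<close> do not vanish at 0, and \<open>S\<close> does not vanish at 1.\<close>
    have "poly (D * R * S) s = 0" for s
    proof (cases "det (G s) = 0")
      case False
      then have "invertible (G s)" by (simp add: invertible_det_nz)
      then have "gl_act (G s) (H s) \<in> A \<union> B"
        using AB unfolding H_def orbit_def by blast
      then have "p (gl_act (G s) (H s)) * q (gl_act (G s) (H s)) = 0"
        using p(1) q(1) by (auto simp: P(2) Q(2) zero_locus_def)
      then show ?thesis
        using f(2)[OF False] f'(2)[OF False] by (auto simp flip: R S)
    qed (simp add: D)
    then have "D * R * S = 0"
      using poly_all_0_iff_0 by blast
    moreover have "poly D 0 \<noteq> 0" "poly R 0 \<noteq> 0"
      using g(1) p(2) f(2)[of 0] by (auto simp: G01 H01 invertible_det_nz simp flip: D R)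
    moreover have "poly S 1 \<noteq> 0"
      using h(1) q(2) f'(2)[of 1] by (auto simp: G01 H01 invertible_det_nz simp flip: S)
    ultimately show False by auto
  qed
qed

lemma irreducible_in_closure_of:
  assumes "irreducible_in X S"
  shows "irreducible_in X (X closure_of S)"
  unfolding irreducible_in_def
proof (intro conjI allI impI)
  have S: "S \<subseteq> topspace X" "S \<noteq> {}"
    and irr: "\<And>A B. closedin X A \<Longrightarrow> closedin X B \<Longrightarrow> S \<subseteq> A \<union> B \<Longrightarrow> S \<subseteq> A \<or> S \<subseteq> B"
    using assms unfolding irreducible_in_def by auto
  show "X closure_of S \<subseteq> topspace X" by (rule closure_of_subset_topspace)
  show "X closure_of S \<noteq> {}" using closure_of_subset[OF S(1)] S(2) by blast
  fix A B assume *: "closedin X A \<and> closedin X B \<and> X closure_of S \<subseteq> A \<union> B"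
  then have "S \<subseteq> A \<or> S \<subseteq> B"
    using irr[of A B] closure_of_subset[OF S(1)] by blast
  then show "X closure_of S \<subseteq> A \<or> X closure_of S \<subseteq> B"
    using * closure_of_minimal by metis
qed

section \<open>Nilpotency\<close>

text \<open>The lower central series with the index shift of \<open>alg_power\<close>, so
  \<open>lcs \<mu> 1\<close> is A^2. One factor is always the whole algebra, hence a series that is
  stationary once is stationary for ever, and dimensions can be counted.\<close>

fun lcs :: "'n::finite multiplication \<Rightarrow> nat \<Rightarrow> (complex ^ 'n) set" where
  "lcs \<mu> 0 = UNIV"
| "lcs \<mu> (Suc k) = vec.span {\<mu> x y | x y. y \<in> lcs \<mu> k}"

lemma subspace_lcs [simp]: "vec.subspace (lcs \<mu> k)"
  by (cases k) (auto simp: vec.subspace_UNIV)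

lemma span_lcs [simp]: "vec.span (lcs \<mu> k) = lcs \<mu> k"
  by (simp add: vec.span_eq_iff)

lemma lcs_mult: "y \<in> lcs \<mu> k \<Longrightarrow> \<mu> x y \<in> lcs \<mu> (Suc k)"
  by (auto intro: vec.span_base)

lemma lcs_mult_left:
  assumes "anticommutative \<mu>" "y \<in> lcs \<mu> k"
  shows "\<mu> y x \<in> lcs \<mu> (Suc k)"
proof -
  have "- \<mu> x y \<in> lcs \<mu> (Suc k)"
    by (intro vec.subspace_neg subspace_lcs lcs_mult assms(2))
  moreover have "\<mu> y x = - \<mu> x y"
    using assms(1) unfolding anticommutative_def by blast
  ultimately show ?thesis by (simp only:)
qed

lemma lcs_Suc_subset: "lcs \<mu> (Suc k) \<subseteq> lcs \<mu> k"
proof (induction k)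
  case (Suc k)
  show ?case
    unfolding lcs.simps(2)[of _ "Suc k"]
    by (rule vec.span_minimal[OF _ subspace_lcs]) (use Suc in \<open>auto intro: lcs_mult simp del: lcs.simps\<close>)
qed simp

lemma lcs_antimono: "i \<le> j \<Longrightarrow> lcs \<mu> j \<subseteq> lcs \<mu> i"
  using lcs_Suc_subset lift_Suc_antimono_le[of "lcs \<mu>"] by blast

lemma lcs_subset_alg_power: "lcs \<mu> k \<subseteq> alg_power \<mu> k"
proof (induction k)
  case (Suc k)
  have "{\<mu> x y | x y. y \<in> lcs \<mu> k} \<subseteq>
      (\<Union>i\<in>{..k}. {\<mu> x y | x y. x \<in> alg_power \<mu> i \<and> y \<in> alg_power \<mu> (k - i)})"
    using Suc by (force intro!: bexI[of _ 0])
  then show ?case by (simp add: vec.span_mono)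
qed simp

text \<open>One of two factors whose degrees add up to at least \<open>2 ^ (k + 1)\<close> has degree at least \<open>2 ^ k\<close>.\<close>

lemma alg_power_subset_lcs:
  assumes "anticommutative \<mu>" "2 ^ k \<le> Suc m"
  shows "alg_power \<mu> m \<subseteq> lcs \<mu> k"
  using assms(2)
proof (induction k arbitrary: m)
  case (Suc k)
  have "m \<noteq> 0"
  proof
    assume "m = 0"
    then have "2 * 2 ^ k \<le> (1::nat)" using Suc.prems by simp
    moreover have "(1::nat) \<le> 2 ^ k" by simp
    ultimately show False by linarith
  qed
  then obtain l where l: "m = Suc l" by (cases m) auto
  have "\<mu> x y \<in> lcs \<mu> (Suc k)"
    if "i \<le> l" "x \<in> alg_power \<mu> i" "y \<in> alg_power \<mu> (l - i)" for i x y
  proof (cases "2 ^ k \<le> Suc i")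
    case True
    then show ?thesis
      using Suc.IH that(2) lcs_mult_left[OF assms(1)] by blast
  next
    case False
    then have "2 ^ k \<le> Suc (l - i)"
      using Suc.prems that(1) by (auto simp: l)
    then show ?thesis
      using Suc.IH that(3) lcs_mult by blast
  qed
  then show ?case
    unfolding l alg_power.simps
    by (intro vec.span_minimal[OF _ subspace_lcs]) (auto simp del: lcs.simps)
qed simp

lemma nilpotent_iff_lcs:
  assumes "anticommutative \<mu>"
  shows "nilpotent \<mu> \<longleftrightarrow> (\<exists>k. lcs \<mu> k = {0})"
proof
  assume "nilpotent \<mu>"
  then obtain k where "alg_power \<mu> k = {0}" unfolding nilpotent_def by blast
  then have "lcs \<mu> k = {0}"
    using lcs_subset_alg_power[of \<mu> k] vec.subspace_0[OF subspace_lcs[of \<mu> k]] by blast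
  then show "\<exists>k. lcs \<mu> k = {0}" ..
next
  assume "\<exists>k. lcs \<mu> k = {0}"
  then obtain k where k: "lcs \<mu> k = {0}" ..
  have "alg_power \<mu> (2 ^ k) \<subseteq> {0}"
    using alg_power_subset_lcs[OF assms, of k "2 ^ k"] k by simp
  moreover have "0 \<in> alg_power \<mu> (2 ^ k)"
    by (cases "2 ^ k :: nat") (auto simp: vec.span_zero)
  ultimately show "nilpotent \<mu>"
    unfolding nilpotent_def by blast
qed

lemma lcs_stable:
  assumes "lcs \<mu> (Suc k) = lcs \<mu> k" "k \<le> m"
  shows "lcs \<mu> m = lcs \<mu> k"
  using assms(2) by (induction m rule: dec_induct) (use assms(1) in auto)

lemma lcs_psubset:
  assumes "anticommutative \<mu>" "nilpotent \<mu>" "lcs \<mu> k \<noteq> {0}"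
  shows "lcs \<mu> (Suc k) \<subset> lcs \<mu> k"
proof (rule ccontr)
  assume "\<not> ?thesis"
  then have eq: "lcs \<mu> (Suc k) = lcs \<mu> k"
    using lcs_Suc_subset[of \<mu> k] by blast
  obtain m where m: "lcs \<mu> m = {0}"
    using assms nilpotent_iff_lcs by blast
  have "lcs \<mu> (max k m) = lcs \<mu> k"
    by (rule lcs_stable[OF eq max.cobounded1])
  moreover have "lcs \<mu> (max k m) \<subseteq> {0}"
    using lcs_antimono[of m "max k m" \<mu>] m by simp
  ultimately show False
    using assms(3) vec.subspace_0[OF subspace_lcs] by blast
qed

text \<open>The subtraction truncates at 0, which covers a series that has already reached
  \<open>{0}\<close>.\<close>

lemma dim_lcs_Suc:
  assumes "anticommutative \<mu>" "nilpotent \<mu>"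
  shows "vec.dim (lcs \<mu> (Suc k)) \<le> vec.dim (lcs \<mu> k) - 1"
proof (cases "lcs \<mu> k = {0}")
  case True
  then show ?thesis
    using lcs_Suc_subset[of \<mu> k] vec.dim_eq_0 by (metis le0)
next
  case False
  have "vec.dim (lcs \<mu> (Suc k)) < vec.dim (lcs \<mu> k)"
    by (rule vec.dim_psubset) (simp only: span_lcs lcs_psubset[OF assms False])
  then show ?thesis by simp
qed

lemma dim_lcs:
  fixes \<mu> :: "'n::finite multiplication"
  assumes "anticommutative \<mu>" "nilpotent \<mu>"
  shows "vec.dim (lcs \<mu> k) \<le> CARD('n) - k"
proof (induction k)
  case 0
  then show ?case by (simp add: card_cart_basis)
next
  case (Suc k)
  then show ?case using dim_lcs_Suc[OF assms, of k] by linarith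
qed

lemma nilpotent_iff_lcs_card:
  fixes \<mu> :: "'n::finite multiplication"
  assumes "anticommutative \<mu>"
  shows "nilpotent \<mu> \<longleftrightarrow> lcs \<mu> CARD('n) = {0}"
proof
  assume "nilpotent \<mu>"
  then have "vec.dim (lcs \<mu> CARD('n)) = 0"
    using dim_lcs[OF assms] by (metis diff_self_eq_0 le_zero_eq)
  then show "lcs \<mu> CARD('n) = {0}"
    using vec.dim_eq_0 vec.subspace_0[OF subspace_lcs] by blast
qed (use nilpotent_iff_lcs[OF assms] in blast)

lemma foldr_in_lcs: "foldr \<mu> xs x \<in> lcs \<mu> (length xs)"
  by (induction xs) (auto intro: vec.span_base)

lemma lcs_subset_span_foldr:
  assumes "\<mu> \<in> bilinear_maps"
  shows "lcs \<mu> k \<subseteq> vec.span {foldr \<mu> xs x | xs x. length xs = k}"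
proof (induction k)
  case 0
  then show ?case by (auto intro: vec.span_base)
next
  case (Suc k)
  let ?S = "\<lambda>k. {foldr \<mu> xs x | xs x. length xs = k}"
  have "\<mu> x y \<in> vec.span (?S (Suc k))" if "y \<in> vec.span (?S k)" for x y
    using that
  proof (induction rule: vec.span_induct_alt)
    case base
    then show ?case by (simp add: bilinear_mapsD[OF assms] vec.span_zero)
  next
    case (step c z y)
    then obtain xs w where "z = foldr \<mu> xs w" "length xs = k" by blast
    then have "\<mu> x z \<in> ?S (Suc k)"
      by (auto intro!: exI[of _ "x # xs"] exI[of _ w])
    then show ?case
      using step by (simp add: bilinear_mapsD[OF assms] vec.span_add vec.span_scale vec.span_base)
  qed
  with Suc have "{\<mu> x y | x y. y \<in> lcs \<mu> k} \<subseteq> vec.span (?S (Suc k))"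
    by blast
  then show ?case
    by (simp add: vec.span_minimal)
qed

text \<open>The dimension drops at each step until the series vanishes, so the nilpotency class is
  bounded by the dimension. With this uniform bound nilpotency becomes a system of polynomial
  equations.\<close>

lemma nilpotent_iff_foldr:
  fixes \<mu> :: "'n::finite multiplication"
  assumes "\<mu> \<in> bilinear_maps" "anticommutative \<mu>"
  shows "nilpotent \<mu> \<longleftrightarrow> (\<forall>xs x. length xs = CARD('n) \<longrightarrow> foldr \<mu> xs x = 0)"
proof
  assume "nilpotent \<mu>"
  then show "\<forall>xs x. length xs = CARD('n) \<longrightarrow> foldr \<mu> xs x = 0"
    using foldr_in_lcs nilpotent_iff_lcs_card[OF assms(2)] by (metis singletonD)
next
  assume *: "\<forall>xs x. length xs = CARD('n) \<longrightarrow> foldr \<mu> xs x = 0"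
  have "lcs \<mu> CARD('n) \<subseteq> vec.span {0}"
    by (rule order_trans[OF lcs_subset_span_foldr[OF assms(1)] vec.span_mono]) (use * in blast)
  then have "lcs \<mu> CARD('n) = {0}"
    using vec.subspace_0[OF subspace_lcs] by auto
  then show "nilpotent \<mu>"
    using nilpotent_iff_lcs[OF assms(2)] by blast
qed

section \<open>Closedness of \<open>NMal\<close> and \<open>NLie\<close> and their invariance under
  isomorphism\<close>

lemma NMal_iff:
  "\<mu> \<in> NMal \<longleftrightarrow> \<mu> \<in> bilinear_maps \<and> malcev \<mu> \<and> nilpotent \<mu>"
  by (simp add: NMal_def)

lemma NLie_iff:
  "\<mu> \<in> NLie \<longleftrightarrow> \<mu> \<in> bilinear_maps \<and> lie \<mu> \<and> nilpotent \<mu>"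
  by (simp add: NLie_def)

lemma NLie_subset_NMal: "NLie \<subseteq> NMal"
proof
  fix \<mu> :: "'n::finite multiplication" assume "\<mu> \<in> NLie"
  then show "\<mu> \<in> NMal"
    by (auto simp: NLie_iff NMal_iff lie_def malcev_def bilinear_mapsD)
qed

lemma polymap_foldr: "polymap (\<lambda>\<mu>. foldr \<mu> xs x)"
  by (induction xs) (auto intro: polymap_intros)

lemma closedin_nilpotent_identities:
  fixes F :: "'i \<Rightarrow> 'n::finite multiplication \<Rightarrow> complex ^ 'n"
  assumes "\<And>i. polymap (F i)"
  shows "closedin zariski {\<mu> \<in> bilinear_maps. anticommutative \<mu> \<and> nilpotent \<mu> \<and> (\<forall>i. F i \<mu> = 0)}"
proof -
  let ?N = "{\<mu> \<in> bilinear_maps. \<forall>(xs, x)\<in>{xs. length xs = CARD('n)} \<times> UNIV. foldr \<mu> xs x = 0}"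
  let ?A = "{\<mu> \<in> bilinear_maps. \<forall>(x, y)\<in>UNIV. \<mu> x y + \<mu> y x = 0}"
  let ?F = "{\<mu> \<in> bilinear_maps. \<forall>i\<in>UNIV. F i \<mu> = 0}"
  have "closedin zariski (?A \<inter> ?N \<inter> ?F)"
    by (intro closedin_Int, unfold case_prod_unfold)
      (intro closedin_polymap polymap_intros polymap_foldr assms)+
  moreover have "?A \<inter> ?N = {\<mu> \<in> bilinear_maps. anticommutative \<mu> \<and> nilpotent (\<mu> :: 'n multiplication)}"
    using nilpotent_iff_foldr unfolding anticommutative_def eq_neg_iff_add_eq_0 by fastforce
  then have "?A \<inter> ?N \<inter> ?F = {\<mu> \<in> bilinear_maps. anticommutative \<mu> \<and> nilpotent \<mu> \<and> (\<forall>i. F i \<mu> = 0)}"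
    by blast
  ultimately show ?thesis by (simp only:)
qed

lemma closedin_NMal: "closedin zariski (NMal :: 'n::finite multiplication set)"
proof -
  have "NMal = {\<mu> \<in> bilinear_maps. anticommutative \<mu> \<and> nilpotent \<mu> \<and>
      (\<forall>i. (\<lambda>(x, y, z) \<mu>. jacobian \<mu> x y (\<mu> x z) - \<mu> (jacobian \<mu> x y z) x) i (\<mu> :: 'n multiplication) = 0)}"
    by (auto simp: NMal_iff malcev_def)
  also have "closedin zariski \<dots>"
    unfolding case_prod_unfold jacobian_def by (intro closedin_nilpotent_identities polymap_intros)
  finally show ?thesis .
qed

lemma closedin_NLie: "closedin zariski (NLie :: 'n::finite multiplication set)"
proof -
  have "NLie = {\<mu> \<in> bilinear_maps. anticommutative \<mu> \<and> nilpotent \<mu> \<and>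
      (\<forall>i. (\<lambda>(x, y, z) \<mu>. jacobian \<mu> x y z) i (\<mu> :: 'n multiplication) = 0)}"
    by (auto simp: NLie_iff lie_def)
  also have "closedin zariski \<dots>"
    unfolding case_prod_unfold jacobian_def by (intro closedin_nilpotent_identities polymap_intros)
  finally show ?thesis .
qed

context
  fixes \<mu> \<nu> :: "'n::finite multiplication" and f
  assumes lin: "Vector_Spaces.linear (*s) (*s) f" and bij: "bij f"
    and hom: "\<And>x y. f (\<mu> x y) = \<nu> (f x) (f y)"
begin

lemma iso_jacobian: "f (jacobian \<mu> x y z) = jacobian \<nu> (f x) (f y) (f z)"
  using lin by (simp add: jacobian_def hom linear_cart_iff)

lemma iso_foldr: "f (foldr \<mu> xs x) = foldr \<nu> (map f xs) (f x)"
  by (induction xs) (auto simp: hom)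

lemma iso_NMal_NLie:
  shows "\<mu> \<in> NMal \<Longrightarrow> \<nu> \<in> NMal" and "\<mu> \<in> NLie \<Longrightarrow> \<nu> \<in> NLie"
proof -
  have orb: "\<nu> \<in> orbit \<mu>" unfolding orbit_iff using lin bij hom by blast
  have surj: "(\<And>x. P (f x)) \<Longrightarrow> (\<And>x. P x)" for P
    using bij by (metis bij_pointE)
  have f0: "f x = 0 \<longleftrightarrow> x = 0" for x
    using bij vec.linear_0[OF lin] by (metis bij_pointE)
  have nil: "nilpotent \<nu>" if "\<mu> \<in> bilinear_maps" "anticommutative \<mu>" "nilpotent \<mu>"
  proof -
    have \<mu>: "\<forall>xs x. length xs = CARD('n) \<longrightarrow> foldr \<mu> xs x = 0"
      using that nilpotent_iff_foldr by blast
    have "foldr \<nu> xs x = 0" if "length xs = CARD('n)" for xs x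
    proof -
      have "xs = map f (map (inv f) xs)" "x = f (inv f x)"
        using bij by (simp_all add: bij_is_surj surj_f_inv_f o_def)
      then show ?thesis
        using \<mu> that iso_foldr[of "map (inv f) xs" "inv f x"] f0 by (metis length_map)
    qed
    then show ?thesis
      using nilpotent_iff_foldr orbit_bilinear[OF that(1) orb] orbit_anticommutative[OF that(2) orb]
      by blast
  qed
  show "\<nu> \<in> NMal" if "\<mu> \<in> NMal"
  proof -
    have "jacobian \<nu> (f x) (f y) (\<nu> (f x) (f z)) = \<nu> (jacobian \<nu> (f x) (f y) (f z)) (f x)" for x y z
      using that by (simp add: NMal_iff malcev_def flip: hom iso_jacobian)
    then have "jacobian \<nu> x y (\<nu> x z) = \<nu> (jacobian \<nu> x y z) x" for x y z
      using bij by (metis bij_pointE)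
    then show ?thesis
      using that nil orbit_bilinear orbit_anticommutative orb by (simp add: NMal_iff malcev_def) blast
  qed
  show "\<nu> \<in> NLie" if "\<mu> \<in> NLie"
  proof -
    have "jacobian \<nu> (f x) (f y) (f z) = 0" for x y z
      using that by (simp add: NLie_iff lie_def f0 flip: iso_jacobian)
    then have "jacobian \<nu> x y z = 0" for x y z
      using bij by (metis bij_pointE)
    then show ?thesis
      using that nil orbit_bilinear orbit_anticommutative orb by (simp add: NLie_iff lie_def) blast
  qed
qed

end

lemma NMal_orbit: "\<mu> \<in> NMal \<Longrightarrow> \<nu> \<in> orbit \<mu> \<Longrightarrow> \<nu> \<in> NMal"
  using iso_NMal_NLie(1) unfolding orbit_iff by blast

lemma NLie_orbit: "\<mu> \<in> NLie \<Longrightarrow> \<nu> \<in> orbit \<mu> \<Longrightarrow> \<nu> \<in> NLie"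
  using iso_NMal_NLie(2) unfolding orbit_iff by blast

section \<open>Normal forms of the algebras with three generators\<close>

lemma span_add_cancel_right: "x + y \<in> vec.span S \<Longrightarrow> y \<in> vec.span S \<Longrightarrow> x \<in> vec.span S"
  using vec.span_diff by fastforce

lemma span_UNIV_trans:
  assumes "vec.span B = UNIV" "B \<subseteq> vec.span S"
  shows "vec.span S = UNIV"
  using assms vec.span_minimal[OF assms(2) vec.subspace_span] by blast

lemma axis_nth: "axis i x $ j = (if i = j then x else 0)"
  by (simp add: axis_def)

locale anticomm_algebra =
  fixes \<mu> :: "'n::finite multiplication"
  assumes bil: "\<mu> \<in> bilinear_maps" and anti: "anticommutative \<mu>"
begin

lemmas bilin = bilinear_mapsD[OF bil]

lemma swap: "\<mu> x y = v \<Longrightarrow> \<mu> y x = - v"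
  using anti unfolding anticommutative_def by metis

lemma sq [simp]: "\<mu> x x = 0"
  using swap[of x x "\<mu> x x"] by (simp add: vec_eq_iff eq_neg_iff_add_eq_0)

end

locale anticomm_algebra_6 = anticomm_algebra \<mu> for \<mu> :: "6 multiplication"
begin

text \<open>The only deviation from \<open>M6 \<epsilon>\<close> is the term
  \<open>\<delta> *s b6\<close>, which is absorbed by adding a multiple of \<open>b3\<close> to
  \<open>b1\<close> and a multiple of \<open>b4\<close> to \<open>b2\<close>. The vectors
  \<open>b4\<close> and \<open>b3\<close> take the places of \<open>e 3\<close> and
  \<open>e 4\<close>.\<close>

lemma in_orbit_M6_special:
  assumes span: "vec.span {b1, b2, b3, b4, b5, b6} = UNIV"
    and table: "\<mu> b1 b2 = b4" "\<mu> b1 b3 = 0" "\<mu> b1 b4 = b5" "\<mu> b1 b5 = b6" "\<mu> b1 b6 = 0"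
      "\<mu> b2 b3 = \<epsilon> *s b5 + \<delta> *s b6" "\<mu> b2 b4 = 0" "\<mu> b2 b5 = 0" "\<mu> b2 b6 = 0"
      "\<mu> b3 b4 = - b6" "\<mu> b3 b5 = 0" "\<mu> b3 b6 = 0" "\<mu> b4 b5 = 0" "\<mu> b4 b6 = 0" "\<mu> b5 b6 = 0"
  shows "\<mu> \<in> orbit (M6 \<epsilon>)"
proof -
  \<comment> \<open>Solvable because \<open>1 - \<epsilon>\<close> and
    \<open>\<epsilon> * (\<epsilon> + 1)\<close> have no common zero: at
    \<open>\<epsilon> = 1\<close> the second equals 2.\<close>
  obtain k l where kl: "\<delta> + k * (1 - \<epsilon>) + l * \<epsilon> * (\<epsilon> + 1) = 0"
  proof (cases "\<epsilon> = 1")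
    case True
    show ?thesis by (rule that[of 0 "- \<delta> / 2"]) (simp add: True)
  next
    case False
    show ?thesis by (rule that[of "- \<delta> / (1 - \<epsilon>)" 0]) (use False in \<open>simp add: field_simps\<close>)
  qed
  define E1 where "E1 = b1 + l *s b3"
  define E2 where "E2 = b2 + k *s b4"
  \<comment> \<open>\<open>E3\<close> and \<open>E5\<close> are forced: they are the products
    \<open>E1 E2\<close> and \<open>E1 E3\<close>.\<close>
  define E5 where "E5 = b5 + (k - l * \<epsilon> - l) *s b6"
  define E3 where "E3 = b4 + ((k - l * \<epsilon>) *s b5 + (- l * \<delta> - l * k) *s b6)"
  let ?S = "vec.span {E1, E2, E3, b3, E5, b6}"
  have base: "E1 \<in> ?S" "E2 \<in> ?S" "E3 \<in> ?S" "b3 \<in> ?S" "E5 \<in> ?S" "b6 \<in> ?S"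
    by (auto intro: vec.span_base)
  have "b5 = E5 - (k - l * \<epsilon> - l) *s b6" by (simp add: E5_def)
  then have b5: "b5 \<in> ?S" using base by (metis vec.span_diff vec.span_scale)
  have "b4 = E3 - ((k - l * \<epsilon>) *s b5 + (- l * \<delta> - l * k) *s b6)" by (simp add: E3_def)
  then have b4: "b4 \<in> ?S" using base b5 by (metis vec.span_diff vec.span_scale vec.span_add)
  have "b1 = E1 - l *s b3" "b2 = E2 - k *s b4" by (simp_all add: E1_def E2_def)
  then have b12: "b1 \<in> ?S" "b2 \<in> ?S" using base b4 by (metis vec.span_diff vec.span_scale)+
  have "?S = UNIV"
    by (rule span_UNIV_trans[OF span]) (use base b12 b4 b5 in auto)
  note rules = bilin table table[THEN swap]
  show ?thesis
  proof (rule orbit_by_basis_6[OF bil anti _ _ \<open>?S = UNIV\<close>])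
    have kl': "\<delta> = \<epsilon> * (k - l * \<epsilon> - l) - k" using kl by (auto simp: algebra_simps eq_neg_iff_add_eq_0)
    show "\<mu> E2 b3 = M6 \<epsilon> (e 2) (e 4) $ 1 *s E1 + M6 \<epsilon> (e 2) (e 4) $ 2 *s E2 + M6 \<epsilon> (e 2) (e 4) $ 3 *s E3 +
         M6 \<epsilon> (e 2) (e 4) $ 4 *s b3 + M6 \<epsilon> (e 2) (e 4) $ 5 *s E5 + M6 \<epsilon> (e 2) (e 4) $ 6 *s b6"
      by (simp add: M6_def alg_def axis_nth E1_def E2_def E3_def E5_def rules kl')
       (simp add: vec_eq_iff algebra_simps)
  qed (simp_all add: M6_def alg_bilinear alg_anticommutative,
     simp_all add: alg_def axis_nth E1_def E2_def E3_def E5_def rules vec_eq_iff algebra_simps)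
qed

text \<open>Subtracting multiples of \<open>b4\<close> and \<open>b5\<close> from \<open>b3\<close>
  kills \<open>b1 b3\<close>, rescaling the result turns \<open>\<beta>c\<close> into -1, and adding
  a multiple of it to \<open>b2\<close> kills \<open>b2 b4\<close>.\<close>

lemma in_orbit_M6_monic:
  assumes span: "vec.span {b1, b2, b3, b4, b5, b6} = UNIV"
    and table: "\<mu> b1 b2 = b4" "\<mu> b1 b3 = gb *s b5 + hb *s b6" "\<mu> b1 b4 = b5" "\<mu> b1 b5 = b6" "\<mu> b1 b6 = 0"
      "\<mu> b2 b3 = ga *s b5 + ha *s b6" "\<mu> b2 b4 = \<beta>b *s b6" "\<mu> b2 b5 = 0" "\<mu> b2 b6 = 0"
      "\<mu> b3 b4 = \<beta>c *s b6" "\<mu> b3 b5 = 0" "\<mu> b3 b6 = 0" "\<mu> b4 b5 = 0" "\<mu> b4 b6 = 0" "\<mu> b5 b6 = 0"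
    and "\<beta>c \<noteq> 0"
  shows "\<mu> \<in> orbit (M6 (- ga / \<beta>c))"
proof -
  define c3 where "c3 = (- 1 / \<beta>c) *s (b3 - (gb *s b4 + hb *s b5))"
  define c2 where "c2 = b2 + \<beta>b *s c3"
  let ?S = "vec.span {b1, c2, c3, b4, b5, b6}"
  have base: "b1 \<in> ?S" "c2 \<in> ?S" "c3 \<in> ?S" "b4 \<in> ?S" "b5 \<in> ?S" "b6 \<in> ?S"
    by (auto intro: vec.span_base)
  have b3: "b3 = (- \<beta>c) *s c3 + (gb *s b4 + hb *s b5)"
    using assms(17) by (simp add: c3_def vec_eq_iff)
  then have "b3 \<in> ?S"
    using base by (metis vec.span_add vec.span_scale)
  moreover have "b2 = c2 - \<beta>b *s c3" by (simp add: c2_def)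
  then have "b2 \<in> ?S" using base by (metis vec.span_diff vec.span_scale)
  ultimately have S: "?S = UNIV"
    by (intro span_UNIV_trans[OF span]) (use base in auto)
  note rules = bilin table table[THEN swap] c2_def c3_def
  show ?thesis
    by (rule in_orbit_M6_special[OF S, where \<delta> = "- (ha - gb * \<beta>b) / \<beta>c"])
      (simp_all add: rules, simp_all add: vec_eq_iff field_simps \<open>\<beta>c \<noteq> 0\<close>)
qed

text \<open>The iterated products of \<open>b1\<close> with \<open>b2\<close> replace
  \<open>b4\<close>, \<open>b5\<close> and \<open>b6\<close>; this turns \<open>f\<close>,
  \<open>a\<close> and \<open>c\<close> into 1.\<close>

lemma in_orbit_M6:
  assumes span: "vec.span {b1, b2, b3, b4, b5, b6} = UNIV"
    and table: "\<mu> b1 b2 = f *s b4 + gc *s b5 + hc *s b6" "\<mu> b1 b3 = gb *s b5 + hb *s b6"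
      "\<mu> b1 b4 = a *s b5 + \<beta>a *s b6" "\<mu> b1 b5 = c *s b6" "\<mu> b1 b6 = 0"
      "\<mu> b2 b3 = ga *s b5 + ha *s b6" "\<mu> b2 b4 = \<beta>b *s b6" "\<mu> b2 b5 = 0" "\<mu> b2 b6 = 0"
      "\<mu> b3 b4 = \<beta>c *s b6" "\<mu> b3 b5 = 0" "\<mu> b3 b6 = 0" "\<mu> b4 b5 = 0" "\<mu> b4 b6 = 0" "\<mu> b5 b6 = 0"
    and nz: "f \<noteq> 0" "a \<noteq> 0" "c \<noteq> 0" "\<beta>c \<noteq> 0"
  shows "\<mu> \<in> orbit (M6 (- (c * ga) / (f * \<beta>c)))"
proof -
  define c4 where "c4 = f *s b4 + (gc *s b5 + hc *s b6)"
  define r where "r = f * \<beta>a + gc * c"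
  define c5 where "c5 = (f * a) *s b5 + r *s b6"
  define c6 where "c6 = (f * a * c) *s b6"
  let ?S = "vec.span {b1, b2, b3, c4, c5, c6}"
  have base: "b1 \<in> ?S" "b2 \<in> ?S" "b3 \<in> ?S" "c4 \<in> ?S" "c5 \<in> ?S" "c6 \<in> ?S"
    by (auto intro: vec.span_base)
  have e6: "b6 = (1 / (f * a * c)) *s c6"
    using nz by (simp add: c6_def vec_eq_iff)
  have b6: "b6 \<in> ?S" by (subst e6) (intro vec.span_scale base)
  have e5: "b5 = (1 / (f * a)) *s (c5 - r *s b6)"
    using nz by (simp add: c5_def vec_eq_iff)
  have b5: "b5 \<in> ?S" by (subst e5) (intro vec.span_scale vec.span_diff base b6)
  have e4: "b4 = (1 / f) *s (c4 - (gc *s b5 + hc *s b6))"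
    using nz by (simp add: c4_def vec_eq_iff)
  have b4: "b4 \<in> ?S" by (subst e4) (intro vec.span_scale vec.span_diff vec.span_add base b5 b6)
  have S: "?S = UNIV"
    by (rule span_UNIV_trans[OF span]) (use base b4 b5 b6 in auto)
  note rules = bilin table table[THEN swap] c4_def c5_def c6_def r_def
  have "\<mu> \<in> orbit (M6 (- (ga / (f * a)) / (\<beta>c / (a * c))))"
    by (rule in_orbit_M6_monic[OF S, where gb = "gb / (f * a)" and hb = "(hb - gb / (f * a) * r) / (f * a * c)"
         and ha = "(ha - ga / (f * a) * r) / (f * a * c)" and \<beta>b = "\<beta>b / (a * c)"])
      (use nz in \<open>simp_all add: rules\<close>, simp_all add: vec_eq_iff field_simps)
  moreover have "- (ga / (f * a)) / (\<beta>c / (a * c)) = - (c * ga) / (f * \<beta>c)"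
    using nz by (simp add: field_simps)
  ultimately show ?thesis by simp
qed

end

section \<open>The linear family of filtered tables and its limits\<close>

lemma basis_coefficients_6:
  fixes b1 b2 b3 b4 b5 b6 :: "complex ^ 6"
  assumes "vec.span {b1, b2, b3, b4, b5, b6} = UNIV"
    and "c1 *s b1 + c2 *s b2 + c3 *s b3 + c4 *s b4 + c5 *s b5 + c6 *s b6 = 0"
  shows "c1 = 0" "c2 = 0" "c3 = 0" "c4 = 0" "c5 = 0" "c6 = 0"
proof -
  let ?b = "vec6 b1 b2 b3 b4 b5 b6"
  let ?f = "\<lambda>x. \<Sum>i\<in>UNIV. x $ i *s ?b i"
  have sp: "vec.span (range ?b) = UNIV" using assms(1) by (simp add: range_vec6)
  note f = spanning_family_bij[OF sp]
  have "?f (\<chi> i. vec6 c1 c2 c3 c4 c5 c6 i) = ?f 0"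
    using assms(2) by (simp add: sum_6)
  then have "(\<chi> i. vec6 c1 c2 c3 c4 c5 c6 i) = 0"
    by (rule injD[OF bij_is_inj[OF f(2)]])
  then have "vec6 c1 c2 c3 c4 c5 c6 i = 0" for i by (simp add: vec_eq_iff)
  then show "c1 = 0" "c2 = 0" "c3 = 0" "c4 = 0" "c5 = 0" "c6 = 0"
    using vec6_simps by metis+
qed

lemma span_e: "vec.span {e 1, e 2, e 3, e 4, e 5, e 6} = UNIV"
proof -
  have "x \<in> vec.span {e 1, e 2, e 3, e 4, e 5, e 6}" for x
  proof -
    have "x = x $ 1 *s e 1 + x $ 2 *s e 2 + x $ 3 *s e 3 + x $ 4 *s e 4 + x $ 5 *s e 5 + x $ 6 *s e 6"
      by (simp add: vec_eq_iff axis_nth forall_6)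
    moreover have "x $ 1 *s e 1 + x $ 2 *s e 2 + x $ 3 *s e 3 + x $ 4 *s e 4 + x $ 5 *s e 5 + x $ 6 *s e 6
        \<in> vec.span {e 1, e 2, e 3, e 4, e 5, e 6}"
      by (intro vec.span_add vec.span_scale vec.span_base) auto
    ultimately show ?thesis by metis
  qed
  then show ?thesis by blast
qed

lemma alg_algebra_6: "anticomm_algebra_6 (alg T)"
  by (simp add: anticomm_algebra_6_def anticomm_algebra_def alg_bilinear alg_anticommutative)

lemma jacobian_cyclic: "jacobian \<mu> x y z = jacobian \<mu> y z x"
  by (simp add: jacobian_def)

text \<open>The general table in which \<open>e 1, ..., e 6\<close> have weights 1, 2, 2, 3, 4, 5
  and products have at least the sum of the weights. Only the \<open>e 4\<close>-component of
  \<open>e 1 e 3\<close> is missing; the choice of the third basis vector removes it.\<close>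

definition Yalg :: "complex \<Rightarrow> complex \<Rightarrow> complex \<Rightarrow> complex \<Rightarrow> complex \<Rightarrow> complex \<Rightarrow> complex \<Rightarrow> complex \<Rightarrow>
    complex \<Rightarrow> complex \<Rightarrow> complex \<Rightarrow> complex \<Rightarrow> 6 multiplication" where
  "Yalg f gc hc gb hb ga ha a \<beta>a \<beta>b \<beta>c c =
    alg [(1, 2, f *s e 4 + gc *s e 5 + hc *s e 6), (1, 3, gb *s e 5 + hb *s e 6),
      (2, 3, ga *s e 5 + ha *s e 6), (1, 4, a *s e 5 + \<beta>a *s e 6),
      (2, 4, \<beta>b *s e 6), (3, 4, \<beta>c *s e 6), (1, 5, c *s e 6)]"

lemma Yalg_generic:
  assumes "f \<noteq> 0" "a \<noteq> 0" "c \<noteq> 0" "\<beta>c \<noteq> 0"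
  shows "Yalg f gc hc gb hb ga ha a \<beta>a \<beta>b \<beta>c c \<in> orbit (M6 (- (c * ga) / (f * \<beta>c)))"
proof -
  interpret anticomm_algebra_6 "Yalg f gc hc gb hb ga ha a \<beta>a \<beta>b \<beta>c c"
    unfolding Yalg_def by (rule alg_algebra_6)
  show ?thesis
    by (rule in_orbit_M6[OF span_e _ _ _ _ _ _ _ _ _ _ _ _ _ _ _ assms])
      (simp_all add: Yalg_def alg_def axis_nth)
qed

lemma Yalg_tendsto:
  assumes "(f \<longlongrightarrow> f') F" "(ga \<longlongrightarrow> ga') F" "(a \<longlongrightarrow> a') F" "(\<beta>c \<longlongrightarrow> \<beta>c') F" "(c \<longlongrightarrow> c') F"
  shows "((\<lambda>t. Yalg (f t) gc hc gb hb (ga t) ha (a t) \<beta>a \<beta>b (\<beta>c t) (c t) x y $ k) \<longlongrightarrow>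
    Yalg f' gc hc gb hb ga' ha a' \<beta>a \<beta>b \<beta>c' c' x y $ k) F"
  unfolding Yalg_def alg_def by (simp, intro tendsto_intros assms)

lemma eventually_shift_neq_0: "\<forall>\<^sub>F t in at 0. x + t \<noteq> (0 :: complex)"
  using eventually_neq_at_within[of "-x" 0 UNIV] by eventually_elim (simp add: add_eq_0_iff)

abbreviation M6_orbits :: "6 multiplication set" where
  "M6_orbits \<equiv> \<Union>\<epsilon>. orbit (M6 \<epsilon>)"

lemma M6_bilinear: "M6 \<epsilon> \<in> bilinear_maps"
  by (simp add: M6_def alg_bilinear)

lemma M6_orbits_bilinear: "M6_orbits \<subseteq> bilinear_maps"
  using orbit_bilinear[OF M6_bilinear] by blast

lemma closure_M6_orbits_orbit:
  "\<mu> \<in> zariski closure_of M6_orbits \<Longrightarrow> \<nu> \<in> orbit \<mu> \<Longrightarrow> \<nu> \<in> zariski closure_of M6_orbits"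
  by (rule closure_of_orbit_invariant[OF M6_orbits_bilinear]) (use orbit_trans in auto)

lemma closure_orbit_orbit:
  "\<rho> \<in> bilinear_maps \<Longrightarrow> \<mu> \<in> zariski closure_of (orbit \<rho>) \<Longrightarrow> \<nu> \<in> orbit \<mu> \<Longrightarrow> \<nu> \<in> zariski closure_of (orbit \<rho>)"
  by (rule closure_of_orbit_invariant) (use orbit_trans orbit_bilinear in auto)

text \<open>The four constants that \<open>Yalg_generic\<close> wants nonzero are shifted by
  \<open>t\<close>. The parameter of \<open>M6\<close> then varies with \<open>t\<close> and may
  diverge, so the limit is only known to lie in the closure of the whole family.\<close>

lemma Yalg_in_closure:
  "Yalg f gc hc gb hb ga ha a \<beta>a \<beta>b \<beta>c c \<in> zariski closure_of M6_orbits"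
proof (rule closedin_zariski_limit[where F = "\<lambda>t. Yalg (f + t) gc hc gb hb ga ha (a + t) \<beta>a \<beta>b (\<beta>c + t) (c + t)"])
  show "Yalg f gc hc gb hb ga ha a \<beta>a \<beta>b \<beta>c c \<in> bilinear_maps"
    by (simp add: Yalg_def alg_bilinear)
  show "\<forall>\<^sub>F t in at 0. Yalg (f + t) gc hc gb hb ga ha (a + t) \<beta>a \<beta>b (\<beta>c + t) (c + t)
      \<in> zariski closure_of M6_orbits"
    using eventually_shift_neq_0[of f] eventually_shift_neq_0[of a] eventually_shift_neq_0[of \<beta>c]
      eventually_shift_neq_0[of c]
  proof eventually_elim
    case (elim t)
    then show ?case
      using closure_of_subset[of M6_orbits zariski] M6_orbits_bilinear Yalg_generic[of "f + t" "a + t" "c + t" "\<beta>c + t"]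
      by (simp add: subset_iff) blast
  qed
  fix i j k
  have "((\<lambda>t. x + t) \<longlongrightarrow> x) (at 0)" for x :: complex
    using tendsto_add[OF tendsto_const[of x] tendsto_ident_at[of 0 UNIV]] by simp
  then show "((\<lambda>t. Yalg (f + t) gc hc gb hb ga ha (a + t) \<beta>a \<beta>b (\<beta>c + t) (c + t) (e i) (e j) $ k) \<longlongrightarrow>
      Yalg f gc hc gb hb ga ha a \<beta>a \<beta>b \<beta>c c (e i) (e j) $ k) (at 0)"
    by (intro Yalg_tendsto tendsto_const)
qed simp

text \<open>The Jacobi identity says that the matrix with rows \<open>(f, - ga)\<close> and \<open>(c, \<beta>c)\<close> is singular,
  and singular matrices are limits of rank one matrices \<open>(u x, u y; v x, v y)\<close> without zero entries.\<close>

lemma singular_2x2_factorization: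
  fixes p q r s :: "'a::field"
  assumes "p * s = q * r"
  obtains u v x y where "p = u * x" "q = u * y" "r = v * x" "s = v * y"
proof (cases "p = 0")
  case True
  show ?thesis
  proof (cases "q = 0")
    case True
    show ?thesis by (rule that[of 0 r s 1]) (simp_all add: \<open>p = 0\<close> True)
  next
    case False
    then show ?thesis using assms \<open>p = 0\<close> by (intro that[of 1 0 q "s / q"]) (auto simp: field_simps)
  qed
next
  case False
  then show ?thesis using assms by (intro that[of 1 p q "r / p"]) (auto simp: field_simps)
qed

lemma Yalg_lie_in_closure:
  assumes "f * \<beta>c + c * ga = 0"
  shows "Yalg f gc hc gb hb ga ha a \<beta>a \<beta>b \<beta>c c \<in> zariski closure_of (orbit (M6 1))"
proof -
  have "f * \<beta>c = - ga * c" using assms by (simp add: add_eq_0_iff algebra_simps)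
  then obtain u v x y where uv: "f = u * x" "- ga = u * y" "c = v * x" "\<beta>c = v * y"
    using singular_2x2_factorization by metis
  \<comment> \<open>The factors are shifted instead of the entries: the matrix stays singular, so
    every perturbed table has parameter exactly 1.\<close>
  let ?F = "\<lambda>t. Yalg ((u + t) * (x + t)) gc hc gb hb (- ((u + t) * (y + t))) ha (a + t) \<beta>a \<beta>b
     ((v + t) * (y + t)) ((v + t) * (x + t))"
  show ?thesis
  proof (rule closedin_zariski_limit[where F = ?F])
    show "Yalg f gc hc gb hb ga ha a \<beta>a \<beta>b \<beta>c c \<in> bilinear_maps"
      by (simp add: Yalg_def alg_bilinear)
    show "\<forall>\<^sub>F t in at 0. ?F t \<in> zariski closure_of (orbit (M6 1))"
      using eventually_shift_neq_0[of u] eventually_shift_neq_0[of v] eventually_shift_neq_0[of x]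
        eventually_shift_neq_0[of y] eventually_shift_neq_0[of a]
    proof eventually_elim
      case (elim t)
      then have "- (((v + t) * (x + t)) * (- ((u + t) * (y + t)))) / (((u + t) * (x + t)) * ((v + t) * (y + t))) = 1"
        by simp
      then have "?F t \<in> orbit (M6 1)"
        using Yalg_generic[of "(u + t) * (x + t)" "a + t" "(v + t) * (x + t)" "(v + t) * (y + t)" gc hc gb hb
            "- ((u + t) * (y + t))" ha \<beta>a \<beta>b] elim by simp
      then show ?case
        using closure_of_subset[of "orbit (M6 1)" zariski] orbit_bilinear[OF M6_bilinear] by fastforce
    qed
    fix i j k
    have t: "((\<lambda>t. x + t) \<longlongrightarrow> x) (at 0)" for x :: complex
      using tendsto_add[OF tendsto_const[of x] tendsto_ident_at[of 0 UNIV]] by simp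
    have ga: "ga = - (u * y)" by (simp flip: uv(2))
    show "((\<lambda>t. ?F t (e i) (e j) $ k) \<longlongrightarrow>
        Yalg f gc hc gb hb ga ha a \<beta>a \<beta>b \<beta>c c (e i) (e j) $ k) (at 0)"
      unfolding uv(1,3,4) ga
      by (intro Yalg_tendsto tendsto_mult tendsto_minus t)
  qed simp
qed

lemma span1: "(x :: complex ^ 'n::finite) \<in> vec.span {u} \<longleftrightarrow> (\<exists>p. x = p *s u)"
  by (auto simp: vec.span_singleton)

lemma span2: "(x :: complex ^ 'n::finite) \<in> vec.span {u, v} \<longleftrightarrow> (\<exists>p q. x = p *s u + q *s v)"
  by (simp add: vec.span_insert algebra_simps eq_diff_eq)

lemma span3: "(x :: complex ^ 'n::finite) \<in> vec.span {u, v, w} \<longleftrightarrow> (\<exists>p q r. x = p *s u + q *s v + r *s w)"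
proof
  assume "x \<in> vec.span {u, v, w}"
  then obtain p where "x - p *s u \<in> vec.span {v, w}"
    by (subst (asm) vec.span_insert) blast
  then obtain q r where "x - p *s u = q *s v + r *s w"
    unfolding span2 by blast
  then have "x = p *s u + q *s v + r *s w" by (simp add: algebra_simps)
  then show "\<exists>p q r. x = p *s u + q *s v + r *s w" by blast
qed (elim exE, simp, intro vec.span_add vec.span_scale vec.span_base, auto)

context anticomm_algebra_6
begin

text \<open>A basis with this property is adapted to a filtration \<open>F\<^sub>1 \<supset> F\<^sub>2 \<supset> F\<^sub>3 \<supset> F\<^sub>4 \<supset> F\<^sub>5\<close> with
  dimensions 6, 5, 3, 2, 1 and \<open>F\<^sub>i F\<^sub>j \<subseteq> F\<^sub>i\<^sub>+\<^sub>j\<close>.\<close>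

definition filtered_basis where
  "filtered_basis b1 b2 b3 b4 b5 b6 \<longleftrightarrow> vec.span {b1, b2, b3, b4, b5, b6} = UNIV \<and>
    \<mu> b1 b2 \<in> vec.span {b4, b5, b6} \<and> \<mu> b1 b3 \<in> vec.span {b5, b6} \<and> \<mu> b2 b3 \<in> vec.span {b5, b6} \<and>
    \<mu> b1 b4 \<in> vec.span {b5, b6} \<and> \<mu> b2 b4 \<in> vec.span {b6} \<and> \<mu> b3 b4 \<in> vec.span {b6} \<and>
    \<mu> b1 b5 \<in> vec.span {b6} \<and> \<mu> b2 b5 = 0 \<and> \<mu> b3 b5 = 0 \<and> \<mu> b4 b5 = 0 \<and> (\<forall>x. \<mu> x b6 = 0)"

lemma filtered_basis_closure:
  assumes "filtered_basis b1 b2 b3 b4 b5 b6"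
  shows "\<mu> \<in> zariski closure_of M6_orbits"
    and "lie \<mu> \<Longrightarrow> \<mu> \<in> zariski closure_of (orbit (M6 1))"
proof -
  note fb = assms[unfolded filtered_basis_def span1 span2 span3]
  have span: "vec.span {b1, b2, b3, b4, b5, b6} = UNIV" using fb by (elim conjE)
  obtain f gc hc where 1: "\<mu> b1 b2 = f *s b4 + gc *s b5 + hc *s b6" using fb by blast
  obtain gb hb where 2: "\<mu> b1 b3 = gb *s b5 + hb *s b6" using fb by blast
  obtain ga ha where 3: "\<mu> b2 b3 = ga *s b5 + ha *s b6" using fb by blast
  obtain a \<beta>a where 4: "\<mu> b1 b4 = a *s b5 + \<beta>a *s b6" using fb by blast
  obtain \<beta>b where 5: "\<mu> b2 b4 = \<beta>b *s b6" using fb by blast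
  obtain \<beta>c where 6: "\<mu> b3 b4 = \<beta>c *s b6" using fb by blast
  obtain c where 7: "\<mu> b1 b5 = c *s b6" using fb by blast
  have 8: "\<mu> b2 b5 = 0" "\<mu> b3 b5 = 0" "\<mu> b4 b5 = 0" "\<And>x. \<mu> x b6 = 0" using fb by blast+
  note table = 1 2 3 4 5 6 7 8
  have orb: "\<mu> \<in> orbit (Yalg f gc hc gb hb ga ha a \<beta>a \<beta>b \<beta>c c)"
    by (rule orbit_by_basis_6[OF bil anti _ _ span])
      (simp_all add: Yalg_def alg_bilinear alg_anticommutative, simp_all add: alg_def axis_nth table)
  then show "\<mu> \<in> zariski closure_of M6_orbits"
    using closure_M6_orbits_orbit Yalg_in_closure by blast
  assume "lie \<mu>"
  \<comment> \<open>Up to sign this Jacobian is \<open>f * \<beta>c + c * ga\<close> times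
    \<open>b6\<close>, the equation of the quadric of Lie tables.\<close>
  then have "jacobian \<mu> b1 b2 b3 = 0" by (simp add: lie_def)
  then have "0 *s b1 + 0 *s b2 + 0 *s b3 + 0 *s b4 + 0 *s b5 + (f * \<beta>c + c * ga) *s b6 = 0"
    by (simp add: jacobian_def bilin table table[THEN swap]) (simp add: vec_eq_iff algebra_simps neg_eq_iff_add_eq_0)
  then have "f * \<beta>c + c * ga = 0"
    by (rule basis_coefficients_6(6)[OF span])
  then show "\<mu> \<in> zariski closure_of (orbit (M6 1))"
    using closure_orbit_orbit[OF M6_bilinear Yalg_lie_in_closure orb] by blast
qed

end

section \<open>Algebras whose square has dimension at most three\<close>

lemma dim_insert_le: "vec.dim (insert x S) \<le> vec.dim (S :: (complex ^ 'n::finite) set) + 1"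
  by (simp add: vec.dim_insert)

lemma span_UNIV_iff_dim: "vec.span (S :: (complex ^ 6) set) = UNIV \<longleftrightarrow> vec.dim S = 6"
  using vec.dim_eq_full[of S] by (auto simp: vec.dimension_def card_cart_basis)

lemma exists_not_in_span:
  assumes "vec.dim (S :: (complex ^ 6) set) < 6"
  shows "\<exists>x. x \<notin> vec.span S"
  using assms span_UNIV_iff_dim[of S] by auto

lemma subspace_between:
  fixes U W :: "(complex ^ 'n::finite) set"
  assumes "vec.subspace U" "vec.subspace W" "U \<subseteq> W" "vec.dim U \<le> k" "k \<le> vec.dim W"
  obtains X where "vec.subspace X" "U \<subseteq> X" "X \<subseteq> W" "vec.dim X = k"
proof -
  obtain B where B: "B \<subseteq> U" "vec.independent B" "U \<subseteq> vec.span B" "card B = vec.dim U"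
    using vec.basis_exists by blast
  then obtain C where C: "B \<subseteq> C" "C \<subseteq> W" "vec.independent C" "W \<subseteq> vec.span C"
    using vec.maximal_independent_subset_extend[of B W] assms(3) by blast
  have "finite C" using C(3) vec.finiteI_independent by blast
  moreover have "card C = vec.dim W"
    using C vec.basis_card_eq_dim by blast
  ultimately obtain D where D: "B \<subseteq> D" "D \<subseteq> C" "card D = k"
    using exists_subset_between[of B k C] B(4) C(1) assms(4,5) by metis
  show ?thesis
  proof (rule that[of "vec.span D"])
    show "vec.dim (vec.span D) = k"
      using vec.dim_span_eq_card_independent vec.independent_mono[OF C(3) D(2)] D(3) by blast
    show "U \<subseteq> vec.span D" using B(3) vec.span_mono[OF D(1)] by blast
    show "vec.span D \<subseteq> W" using vec.span_minimal[OF _ assms(2)] C(2) D(2) by blast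
  qed simp
qed

lemma span_insert_of_dim:
  fixes X W :: "(complex ^ 'n::finite) set"
  assumes "vec.subspace X" "vec.subspace W" "X \<subseteq> W" "vec.dim W = Suc (vec.dim X)"
  obtains b where "b \<notin> X" "W = vec.span (insert b X)"
proof -
  have "X \<noteq> W" using assms(4) by auto
  then obtain b where b: "b \<in> W" "b \<notin> X" using assms(3) by blast
  have "vec.dim (insert b X) = vec.dim W"
    using b(2) assms(1,4) by (simp add: vec.dim_insert vec.span_eq_iff[THEN iffD2])
  then have "vec.span (insert b X) = vec.span W"
    using b(1) assms(3) by (intro vec.dim_eq_span) auto
  then show ?thesis
    using that b(2) assms(2) by (simp add: vec.span_eq_iff[THEN iffD2])
qed

definition small_square :: "'n::finite multiplication \<Rightarrow> bool" where
  "small_square \<mu> \<longleftrightarrow> vec.dim (lcs \<mu> 1) \<le> 3"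

context anticomm_algebra
begin

text \<open>A nonzero ideal W with AW = W would lie in every term of the lower central series. So AW
  is proper, and any hyperplane of W that contains AW can serve as the next, smaller ideal.\<close>

lemma flag_step:
  assumes nil: "nilpotent \<mu>" and W: "vec.subspace W" "vec.dim W = Suc k"
    and ideal: "\<And>x w. w \<in> W \<Longrightarrow> \<mu> x w \<in> W"
  obtains b X where "vec.subspace X" "vec.dim X = k" "b \<notin> X" "W = vec.span (insert b X)"
    "\<And>x w. w \<in> W \<Longrightarrow> \<mu> x w \<in> X"
proof -
  define U where "U = vec.span {\<mu> x w | x w. w \<in> W}"
  have UW: "U \<subseteq> W"
    unfolding U_def by (rule vec.span_minimal[OF _ W(1)]) (use ideal in blast)
  have "U \<noteq> W"
  proof
    assume "U = W"
    have "W \<subseteq> lcs \<mu> m" for m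
    proof (induction m)
      case (Suc m)
      then have "U \<subseteq> lcs \<mu> (Suc m)"
        unfolding U_def lcs.simps by (intro vec.span_mono) blast
      then show ?case using \<open>U = W\<close> by blast
    qed simp
    then have "W \<subseteq> {0}" using nil nilpotent_iff_lcs[OF anti] by metis
    then have "vec.dim W = 0" by (simp add: vec.dim_eq_0)
    then show False using W(2) by simp
  qed
  then have "vec.dim U < vec.dim W"
    using UW W(1) by (intro vec.dim_psubset) (auto simp: U_def vec.span_eq_iff[THEN iffD2])
  then obtain X where X: "vec.subspace X" "U \<subseteq> X" "X \<subseteq> W" "vec.dim X = k"
    using subspace_between[of U W k] W UW by (auto simp: U_def)
  obtain b where "b \<notin> X" "W = vec.span (insert b X)"
    using span_insert_of_dim[OF X(1) W(1) X(3)] W(2) X(4) by auto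
  moreover have "\<mu> x w \<in> X" if "w \<in> W" for x w
    using that X(2) unfolding U_def by (auto intro: vec.span_base)
  ultimately show ?thesis using that X by blast
qed

lemma mult_in_span:
  assumes "\<And>b. b \<in> B \<Longrightarrow> \<mu> x b \<in> vec.span S" "y \<in> vec.span B"
  shows "\<mu> x y \<in> vec.span S"
  using assms(2)
  by (induction rule: vec.span_induct_alt)
    (simp_all add: bilin vec.span_zero vec.span_add vec.span_scale assms(1))

lemma mult_in_span_left:
  assumes "\<And>b. b \<in> B \<Longrightarrow> \<mu> b x \<in> vec.span S" "y \<in> vec.span B"
  shows "\<mu> y x \<in> vec.span S"
  using assms(2)
  by (induction rule: vec.span_induct_alt)
    (simp_all add: bilin vec.span_zero vec.span_add vec.span_scale assms(1))

lemma mult_swap_in_span: "\<mu> x y \<in> vec.span S \<Longrightarrow> \<mu> y x \<in> vec.span S"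
  using swap[of x y "\<mu> x y"] vec.span_neg by simp

text \<open>Multiplication into \<open>u\<close> has values in a line, so its kernel has codimension
  at most one and meets any plane complementary to \<open>vec.span S\<close>.\<close>

lemma kernel_step:
  assumes "vec.dim S + 2 \<le> CARD('n)" "\<And>x. \<mu> x u \<in> vec.span {z}"
  obtains m where "m \<notin> vec.span S" "\<mu> m u = 0"
proof -
  have ex: "\<exists>x. x \<notin> vec.span T" if "vec.dim T < CARD('n)" for T :: "(complex ^ 'n) set"
    using that vec.dim_eq_full[of T] by (auto simp: vec.dimension_def card_cart_basis)
  obtain x where x: "x \<notin> vec.span S" using ex[of S] assms(1) by auto
  obtain y where y: "y \<notin> vec.span (insert x S)"
    using ex[of "insert x S"] assms(1) dim_insert_le[of x S] by auto
  obtain p q where pq: "\<mu> x u = p *s z" "\<mu> y u = q *s z"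
    using assms(2) by (metis vec.span_singleton rangeE)
  show ?thesis
  proof (cases "p = 0")
    case True
    then show ?thesis using that[of x] x pq by simp
  next
    case False
    show ?thesis
    proof (rule that[of "y - (q / p) *s x"])
      show "y - (q / p) *s x \<notin> vec.span S"
        using y unfolding vec.span_insert by blast
      show "\<mu> (y - (q / p) *s x) u = 0"
        using False by (simp add: bilin pq)
    qed
  qed
qed

end

context anticomm_algebra_6
begin

text \<open>Restricted to the centraliser of \<open>b5\<close>, the \<open>b5\<close>-coordinate of the product is an
  alternating form on a three-dimensional space, which has a nonzero kernel.\<close>

lemma plane_square_aux:
  assumes span: "vec.span {b1, m1, m2, m3, b5, b6} = UNIV"
    and sq: "\<And>x y. \<mu> x y \<in> vec.span {b5, b6}"
    and b5: "\<And>x. \<mu> x b5 \<in> vec.span {b6}" and b6: "\<And>x. \<mu> x b6 = 0"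
    and m: "\<mu> m1 b5 = 0" "\<mu> m2 b5 = 0" "\<mu> m3 b5 = 0"
    and w: "\<mu> m1 m2 = w12 *s b5 + r12 *s b6" "\<mu> m1 m3 = w13 *s b5 + r13 *s b6"
      "\<mu> m2 m3 = w23 *s b5 + r23 *s b6"
    and nz: "w23 \<noteq> 0"
  shows "\<exists>b1 b2 b3 b4 b5 b6. filtered_basis b1 b2 b3 b4 b5 b6"
proof -
  \<comment> \<open>The kernel of an alternating form in three variables is given by its
    coefficients, as in a cross product.\<close>
  define b4 where "b4 = w23 *s m1 - w13 *s m2 + w12 *s m3"
  let ?S = "vec.span {b1, m2, m3, b4, b5, b6}"
  have base: "b1 \<in> ?S" "m2 \<in> ?S" "m3 \<in> ?S" "b4 \<in> ?S" "b5 \<in> ?S" "b6 \<in> ?S"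
    by (auto intro: vec.span_base)
  have "m1 = (1 / w23) *s (b4 + w13 *s m2 - w12 *s m3)"
    using nz by (simp add: b4_def vec_eq_iff)
  then have "m1 \<in> ?S" using base by (metis vec.span_scale vec.span_add vec.span_diff)
  then have S: "?S = UNIV" by (intro span_UNIV_trans[OF span]) (use base in auto)
  have "\<mu> m2 b4 = (w12 * r23 - w23 * r12) *s b6" "\<mu> m3 b4 = (w13 * r23 - w23 * r13) *s b6"
    by (simp_all add: b4_def bilin w w[THEN swap])
  then have 1: "\<mu> m2 b4 \<in> vec.span {b6}" "\<mu> m3 b4 \<in> vec.span {b6}"
    unfolding span1 by blast+
  have 2: "\<mu> b4 b5 = 0" by (simp add: b4_def bilin m)
  have 3: "\<mu> b1 m2 \<in> vec.span {b4, b5, b6}"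
    using sq vec.span_mono[of "{b5, b6}" "{b4, b5, b6}"] by blast
  have "filtered_basis b1 m2 m3 b4 b5 b6"
    unfolding filtered_basis_def by (intro conjI S 1 2 3 sq b5 m allI b6)
  then show ?thesis by blast
qed

text \<open>Three uses of \<open>kernel_step\<close> complete \<open>b5\<close>, \<open>b6\<close>
  by vectors that centralise \<open>b5\<close>. Permuting them brings a nonzero coefficient of the
  form into position \<open>w23\<close>; if the form is zero, any of them can be
  \<open>b4\<close>.\<close>

lemma plane_square:
  assumes dim: "vec.dim {b5, b6} = 2"
    and sq: "\<And>x y. \<mu> x y \<in> vec.span {b5, b6}"
    and b5: "\<And>x. \<mu> x b5 \<in> vec.span {b6}" and b6: "\<And>x. \<mu> x b6 = 0"
  shows "\<exists>b1 b2 b3 b4 b5 b6. filtered_basis b1 b2 b3 b4 b5 b6"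
proof -
  obtain m3 where m3: "m3 \<notin> vec.span {b5, b6}" "\<mu> m3 b5 = 0"
    using kernel_step[of "{b5, b6}" b5 b6] dim b5 by auto
  then have d3: "vec.dim {m3, b5, b6} = 3" by (simp add: vec.dim_insert[of m3] dim)
  obtain m2 where m2: "m2 \<notin> vec.span {m3, b5, b6}" "\<mu> m2 b5 = 0"
    using kernel_step[of "{m3, b5, b6}" b5 b6] d3 b5 by auto
  then have d4: "vec.dim {m2, m3, b5, b6} = 4" by (simp add: vec.dim_insert[of m2] d3)
  obtain m1 where m1: "m1 \<notin> vec.span {m2, m3, b5, b6}" "\<mu> m1 b5 = 0"
    using kernel_step[of "{m2, m3, b5, b6}" b5 b6] d4 b5 by auto
  then have d5: "vec.dim {m1, m2, m3, b5, b6} = 5" by (simp add: vec.dim_insert[of m1] d4)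
  obtain b1 where "b1 \<notin> vec.span {m1, m2, m3, b5, b6}"
    using exists_not_in_span[of "{m1, m2, m3, b5, b6}"] d5 by auto
  then have span: "vec.span {b1, m1, m2, m3, b5, b6} = UNIV"
    unfolding span_UNIV_iff_dim by (simp add: vec.dim_insert[of b1] d5)
  have m: "\<mu> m1 b5 = 0" "\<mu> m2 b5 = 0" "\<mu> m3 b5 = 0" by fact+
  obtain w12 r12 w13 r13 w23 r23 where
    w: "\<mu> m1 m2 = w12 *s b5 + r12 *s b6" "\<mu> m1 m3 = w13 *s b5 + r13 *s b6"
      "\<mu> m2 m3 = w23 *s b5 + r23 *s b6"
    using sq[unfolded span2] by metis
  have w': "\<mu> m2 m1 = (- w12) *s b5 + (- r12) *s b6" "\<mu> m3 m1 = (- w13) *s b5 + (- r13) *s b6"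
      "\<mu> m3 m2 = (- w23) *s b5 + (- r23) *s b6"
    using w[THEN swap] by (simp_all add: vec_eq_iff)
  consider "w23 \<noteq> 0" | "w13 \<noteq> 0" | "w12 \<noteq> 0" | "w12 = 0" "w13 = 0" "w23 = 0" by blast
  then show ?thesis
  proof cases
    case 1
    then show ?thesis by (rule plane_square_aux[OF span sq b5 b6 m w])
  next
    case 2
    have span': "vec.span {b1, m2, m1, m3, b5, b6} = UNIV"
      using span by (simp add: insert_commute)
    show ?thesis by (rule plane_square_aux[OF span' sq b5 b6 m(2,1,3) w'(1) w(3,2) 2])
  next
    case 3
    have span': "vec.span {b1, m3, m1, m2, b5, b6} = UNIV"
      using span by (simp add: insert_commute)
    show ?thesis by (rule plane_square_aux[OF span' sq b5 b6 m(3,1,2) w'(2,3) w(1) 3])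
  next
    case 4
    have 1: "\<mu> b1 m1 \<in> vec.span {m3, b5, b6}"
      using sq vec.span_mono[of "{b5, b6}" "{m3, b5, b6}"] by blast
    have 2: "\<mu> m1 m3 \<in> vec.span {b6}" "\<mu> m2 m3 \<in> vec.span {b6}"
      using w 4 unfolding span1 by auto
    have "filtered_basis b1 m1 m2 m3 b5 b6"
      unfolding filtered_basis_def by (intro conjI span 1 2 sq b5 m allI b6)
    then show ?thesis by blast
  qed
qed

text \<open>Multiplication carries \<open>b4\<close> as well as \<open>b5\<close> into the line of
  \<open>b6\<close>, so F_2 only has to centralise \<open>b5\<close>. A further vector of this
  centraliser and \<open>p\<close> become the second and third basis vectors.\<close>

lemma hyperplane_square:
  assumes dim: "vec.dim {p, b4, b5, b6} = 4"
    and sq: "\<And>x y. \<mu> x y \<in> vec.span {b4, b5, b6}"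
    and b4: "\<And>x. \<mu> x b4 \<in> vec.span {b6}" and b5: "\<And>x. \<mu> x b5 \<in> vec.span {b6}"
    and b6: "\<And>x. \<mu> x b6 = 0" and b45: "\<mu> b4 b5 = 0"
    and p: "\<And>x. \<mu> x p \<in> vec.span {b5, b6}" and pb5: "\<mu> p b5 = 0"
  shows "\<exists>b1 b2 b3 b4 b5 b6. filtered_basis b1 b2 b3 b4 b5 b6"
proof -
  obtain m where m: "m \<notin> vec.span {p, b4, b5, b6}" "\<mu> m b5 = 0"
    using kernel_step[of "{p, b4, b5, b6}" b5 b6] dim b5 by auto
  then have d5: "vec.dim {m, p, b4, b5, b6} = 5" by (simp add: vec.dim_insert[of m] dim)
  obtain b1 where "b1 \<notin> vec.span {m, p, b4, b5, b6}"
    using exists_not_in_span[of "{m, p, b4, b5, b6}"] d5 by auto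
  then have span: "vec.span {b1, m, p, b4, b5, b6} = UNIV"
    unfolding span_UNIV_iff_dim by (simp add: vec.dim_insert[of b1] d5)
  have "\<mu> b1 b4 \<in> vec.span {b5, b6}"
    using b4 vec.span_mono[of "{b6}" "{b5, b6}"] by blast
  then have "filtered_basis b1 m p b4 b5 b6"
    unfolding filtered_basis_def by (intro conjI span sq p b4 b5 m pb5 b45 allI b6)
  then show ?thesis by blast
qed

text \<open>The pairs \<open>(a1, a2)\<close> and \<open>(c1, c2)\<close> are the two linear forms
  on the span of \<open>b1\<close> and \<open>b2\<close>; they are proportional by
  \<open>prp\<close>, and a vector in their common kernel becomes the new \<open>b2\<close>.\<close>

lemma common_kernel:
  assumes span: "vec.span {b1, b2, b3, b4, b5, b6} = UNIV"
    and table: "\<mu> b1 b2 = b4" "\<mu> b1 b3 \<in> vec.span {b5, b6}" "\<mu> b2 b3 \<in> vec.span {b5, b6}"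
      "\<mu> b1 b4 = a1 *s b5 + r1 *s b6" "\<mu> b2 b4 = a2 *s b5 + r2 *s b6" "\<mu> b3 b4 \<in> vec.span {b6}"
      "\<mu> b1 b5 = c1 *s b6" "\<mu> b2 b5 = c2 *s b6" "\<mu> b3 b5 = 0" "\<mu> b4 b5 = 0" "\<And>x. \<mu> x b6 = 0"
    and prp: "a1 * c2 = a2 * c1"
  shows "\<exists>b1 b2 b3 b4 b5 b6. filtered_basis b1 b2 b3 b4 b5 b6"
proof (cases "a1 = 0 \<and> c1 = 0")
  case True
  have span': "vec.span {b2, b1, b3, b4, b5, b6} = UNIV"
    using span by (simp add: insert_commute)
  have "\<mu> b2 b1 \<in> vec.span {b4, b5, b6}"
    using swap[OF table(1)] by (simp add: vec.span_neg vec.span_base)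
  moreover have "\<mu> b2 b4 \<in> vec.span {b5, b6}" "\<mu> b1 b4 \<in> vec.span {b6}" "\<mu> b2 b5 \<in> vec.span {b6}" "\<mu> b1 b5 = 0"
    using True table unfolding span1 span2 by auto
  ultimately have "filtered_basis b2 b1 b3 b4 b5 b6"
    unfolding filtered_basis_def using span' table by blast
  then show ?thesis by blast
next
  case False
  obtain l where l: "a2 = l * a1" "c2 = l * c1"
  proof (cases "a1 = 0")
    case True
    then show ?thesis using that[of "c2 / c1"] False prp by simp
  next
    case False
    then show ?thesis using that[of "a2 / a1"] prp by (simp add: field_simps)
  qed
  define d where "d = b2 - l *s b1"
  let ?S = "vec.span {b1, d, b3, b4, b5, b6}"
  have base: "b1 \<in> ?S" "d \<in> ?S" "b3 \<in> ?S" "b4 \<in> ?S" "b5 \<in> ?S" "b6 \<in> ?S"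
    by (auto intro: vec.span_base)
  have "b2 = d + l *s b1" by (simp add: d_def)
  then have "b2 \<in> ?S" using base by (metis vec.span_scale vec.span_add)
  then have S: "?S = UNIV" by (intro span_UNIV_trans[OF span]) (use base in auto)
  have "\<mu> b1 d \<in> vec.span {b4, b5, b6}"
    by (simp add: d_def bilin table vec.span_base)
  moreover have "\<mu> d b3 \<in> vec.span {b5, b6}"
    unfolding d_def bilin by (intro vec.span_diff vec.span_scale table)
  moreover have "\<mu> d b4 = (r2 - l * r1) *s b6"
    by (simp add: d_def bilin table l)
  then have "\<mu> d b4 \<in> vec.span {b6}" unfolding span1 by blast
  moreover have "\<mu> d b5 = 0"
    by (simp add: d_def bilin table l)
  moreover have "\<mu> b1 b4 \<in> vec.span {b5, b6}" "\<mu> b1 b5 \<in> vec.span {b6}"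
    using table unfolding span1 span2 by auto
  ultimately have "filtered_basis b1 d b3 b4 b5 b6"
    unfolding filtered_basis_def using S table by blast
  then show ?thesis by blast
qed

lemma mult_in_subspace:
  assumes span: "vec.span {b1, b2, b3, b4, b5, b6} = UNIV"
    and table: "\<mu> b1 b2 \<in> vec.span S" "\<mu> b1 b3 \<in> vec.span S" "\<mu> b1 b4 \<in> vec.span S"
      "\<mu> b1 b5 \<in> vec.span S" "\<mu> b1 b6 \<in> vec.span S" "\<mu> b2 b3 \<in> vec.span S" "\<mu> b2 b4 \<in> vec.span S"
      "\<mu> b2 b5 \<in> vec.span S" "\<mu> b2 b6 \<in> vec.span S" "\<mu> b3 b4 \<in> vec.span S" "\<mu> b3 b5 \<in> vec.span S"
      "\<mu> b3 b6 \<in> vec.span S" "\<mu> b4 b5 \<in> vec.span S" "\<mu> b4 b6 \<in> vec.span S" "\<mu> b5 b6 \<in> vec.span S"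
  shows "\<mu> x y \<in> vec.span S"
proof (rule mult_in_span_left[where B = "{b1, b2, b3, b4, b5, b6}"])
  fix b assume b: "b \<in> {b1, b2, b3, b4, b5, b6}"
  show "\<mu> b y \<in> vec.span S"
    by (rule mult_in_span[where B = "{b1, b2, b3, b4, b5, b6}"])
      (use b table table[THEN mult_swap_in_span] span in \<open>auto simp: vec.span_zero\<close>)
qed (simp add: span)

end

lemma complex_quadratic_root:
  fixes a b c :: complex
  assumes "a \<noteq> 0"
  shows "\<exists>x. a * x^2 + b * x + c = 0"
proof -
  define s where "s = csqrt (b^2 - 4 * a * c)"
  have s: "s^2 = b^2 - 4 * a * c" unfolding s_def by (rule power2_csqrt)
  have "a * ((- b + s) / (2 * a))^2 + b * ((- b + s) / (2 * a)) + c = (s^2 - (b^2 - 4 * a * c)) / (4 * a)"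
    using assms by (simp add: field_simps power2_eq_square)
  then have "a * ((- b + s) / (2 * a))^2 + b * ((- b + s) / (2 * a)) + c = 0" using s by simp
  then show ?thesis by blast
qed

lemma span_insert_span:
  "vec.span (insert a (vec.span S)) = vec.span (insert a S :: (complex ^ 'n::finite) set)"
  by (simp add: vec.span_insert vec.span_span)

context anticomm_algebra
begin

lemma malcevD:
  assumes "malcev \<mu>"
  shows "\<mu> x (\<mu> y (\<mu> x y)) = \<mu> y (\<mu> x (\<mu> x y))"
    and "jacobian \<mu> x y (\<mu> x z) = \<mu> (jacobian \<mu> x y z) x"
proof -
  show *: "jacobian \<mu> x y (\<mu> x z) = \<mu> (jacobian \<mu> x y z) x" for x y z
    using assms unfolding malcev_def by blast
  define w where "w = \<mu> x y"
  have "\<mu> y x = - w" "\<mu> w x = - \<mu> x w" "\<mu> w y = - \<mu> y w" "\<mu> (\<mu> x w) y = - \<mu> y (\<mu> x w)"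
    "\<mu> (\<mu> y w) x = - \<mu> x (\<mu> y w)"
    by (rule swap, simp add: w_def)+
  then have "\<mu> x (\<mu> y w) = \<mu> y (\<mu> x w)"
    using *[of x y y] by (simp add: jacobian_def bilin flip: w_def)
  then show "\<mu> x (\<mu> y (\<mu> x y)) = \<mu> y (\<mu> x (\<mu> x y))"
    by (simp add: w_def)
qed

end

context anticomm_algebra_6
begin

section \<open>The Malcev identity on tables with A^2 inside the span of \<open>b4\<close>,
  \<open>b5\<close>, \<open>b6\<close>\<close>

context
  fixes b1 b2 b3 b4 b5 b6 :: "complex ^ 6" and a1 a2 a3 r1 r2 r3 c1 c2 c3 q ga gb ha hb
  assumes malcev: "malcev \<mu>"
    and span: "vec.span {b1, b2, b3, b4, b5, b6} = UNIV"
    and table: "\<mu> b1 b2 = b4" "\<mu> b1 b3 = gb *s b5 + hb *s b6" "\<mu> b2 b3 = ga *s b5 + ha *s b6"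
      "\<mu> b1 b4 = a1 *s b5 + r1 *s b6" "\<mu> b2 b4 = a2 *s b5 + r2 *s b6" "\<mu> b3 b4 = a3 *s b5 + r3 *s b6"
      "\<mu> b1 b5 = c1 *s b6" "\<mu> b2 b5 = c2 *s b6" "\<mu> b3 b5 = c3 *s b6" "\<mu> b4 b5 = q *s b6"
      "\<And>x. \<mu> x b6 = 0"
    and adjusted: "q \<noteq> 0 \<Longrightarrow> c1 = 0 \<and> c2 = 0 \<and> c3 = 0"
begin

lemma b6_left: "\<mu> b6 x = 0"
  using swap[OF table(11)] by simp

lemmas table_rules = bilin table table[THEN swap] b6_left

lemma b6_coefficient: "k *s b6 = 0 \<Longrightarrow> k = 0"
  using basis_coefficients_6(6)[OF span, of 0 0 0 0 0 k] by simp

text \<open>For a pair x, y whose product has \<open>b4\<close>-component 1 or -1, comparing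
  x(y(xy)) with y(x(xy)) gives exactly such a relation. The products of \<open>b3\<close> with
  \<open>b1\<close> and \<open>b2\<close> have no \<open>b4\<close>-component, so \<open>b3\<close>
  is tested through the sums \<open>b2 + b3\<close> and \<open>b1 + b3\<close>.\<close>

lemma weights_parallel:
  shows "a1 * c2 = a2 * c1" "a1 * c3 = a3 * c1" "a2 * c3 = a3 * c2"
proof -
  have "(a2 * c1 - a1 * c2) *s b6 = 0"
    using malcevD(1)[OF malcev, of b1 b2] by (simp add: table_rules vec_eq_iff algebra_simps)
  then show 12: "a1 * c2 = a2 * c1" using b6_coefficient by fastforce
  have "(a1 * (c2 + c3) - (a2 + a3) * c1) *s b6 = 0"
    using malcevD(1)[OF malcev, of b1 "b2 + b3"] by (simp add: table_rules vec_eq_iff algebra_simps)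
  then show "a1 * c3 = a3 * c1" using b6_coefficient 12 by (fastforce simp: algebra_simps)
  have "(a2 * (c1 + c3) - (a1 + a3) * c2) *s b6 = 0"
    using malcevD(1)[OF malcev, of b2 "b1 + b3"] by (simp add: table_rules vec_eq_iff algebra_simps)
  then show "a2 * c3 = a3 * c2" using b6_coefficient 12 by (fastforce simp: algebra_simps)
qed

text \<open>In J(b3,b1,b3 b2) = J(b3,b1,b2) b3 the left side vanishes, since \<open>b3 b2\<close>
  has no \<open>b4\<close>-component, and the right side is \<open>a3 * c3\<close> times
  \<open>b6\<close>.\<close>

lemma radical_weights: "a3 * c3 = 0"
proof -
  have "(a3 * c3) *s b6 = 0"
    using malcevD(2)[OF malcev, of b3 b1 b2] by (simp add: jacobian_def table_rules vec_eq_iff algebra_simps)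
  then show ?thesis using b6_coefficient by blast
qed

text \<open>Suitable instances of the Malcev identity each isolate one of these coefficients
  multiplied by \<open>q\<close>. With all of them zero, no product has a
  \<open>b5\<close>-component and A^2 shrinks to the plane of \<open>b4\<close> and
  \<open>b6\<close>.\<close>

lemma nonabelian_weights:
  assumes "q \<noteq> 0"
  shows "a1 = 0" "a2 = 0" "a3 = 0" "ga = 0" "gb = 0"
proof -
  have c: "c1 = 0" "c2 = 0" "c3 = 0" using adjusted assms by auto
  have "(a1 * q) *s b6 = 0"
    using malcevD(2)[OF malcev, of b1 b2 b4] by (simp add: jacobian_def table_rules c vec_eq_iff algebra_simps)
  then show a1: "a1 = 0" using b6_coefficient assms by fastforce
  have "(a2 * q) *s b6 = 0"
    using malcevD(2)[OF malcev, of b2 b1 b4] by (simp add: jacobian_def table_rules c vec_eq_iff algebra_simps)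
  then show a2: "a2 = 0" using b6_coefficient assms by fastforce
  have "(a3 * q) *s b6 = 0"
    using malcevD(2)[OF malcev, of "b1 + b3" b2 b4]
    by (simp add: jacobian_def table_rules c a1 a2 vec_eq_iff algebra_simps)
  then show a3: "a3 = 0" using b6_coefficient assms by fastforce
  have "(ga * q) *s b6 = 0"
    using malcevD(2)[OF malcev, of b2 b1 b3] by (simp add: jacobian_def table_rules c a1 a2 a3 vec_eq_iff algebra_simps)
  then show "ga = 0" using b6_coefficient assms by fastforce
  have "(gb * q) *s b6 = 0"
    using malcevD(2)[OF malcev, of b1 b2 b3] by (simp add: jacobian_def table_rules c a1 a2 a3 vec_eq_iff algebra_simps)
  then show "gb = 0" using b6_coefficient assms by fastforce
qed

lemma dim_46: "vec.dim {b4, b6} = 2"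
proof -
  have "vec.dim {b5, b1, b2, b3, b4, b6} = 6"
    using span by (simp add: span_UNIV_iff_dim insert_commute)
  then have "6 \<le> vec.dim {b4, b6} + 4"
    using dim_insert_le[of b5 "{b1, b2, b3, b4, b6}"] dim_insert_le[of b1 "{b2, b3, b4, b6}"]
      dim_insert_le[of b2 "{b3, b4, b6}"] dim_insert_le[of b3 "{b4, b6}"] by linarith
  moreover have "vec.dim {b4, b6} \<le> 2"
    using vec.dim_le_card'[of "{b4, b6}"] card_insert_le_m1[of 2 "{b6}" b4] by simp
  ultimately show ?thesis by simp
qed

text \<open>Here \<open>b4\<close> takes the place of \<open>b5\<close> in
  \<open>plane_square\<close>.\<close>

lemma plane_46:
  assumes "a1 = 0" "a2 = 0" "a3 = 0" "ga = 0" "gb = 0"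
  shows "\<exists>b1 b2 b3 b4 b5 b6. filtered_basis b1 b2 b3 b4 b5 b6"
proof (rule plane_square[OF dim_46])
  have b: "b4 \<in> vec.span {b4, b6}" "b6 \<in> vec.span {b4, b6}" "b6 \<in> vec.span {b6}"
    by (auto intro: vec.span_base)
  show "\<mu> x y \<in> vec.span {b4, b6}" for x y
    by (rule mult_in_subspace[OF span]) (simp_all add: table_rules assms b vec.span_scale vec.span_zero)
  show "\<mu> x b4 \<in> vec.span {b6}" for x
    by (rule mult_in_span_left[where B = "{b1, b2, b3, b4, b5, b6}"])
      (use span in \<open>auto simp: table_rules assms b vec.span_scale vec.span_zero vec.span_neg\<close>)
  show "\<mu> x b6 = 0" for x by (rule table)
qed

text \<open>Once \<open>q = 0\<close>, the pair \<open>(a3, c3)\<close> decides, and at most one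
  entry is nonzero. If both vanish, \<open>b3\<close> already lies in the kernels of both forms;
  otherwise the flag inside A^2 is replaced.\<close>

lemma small_square_table_filtered: "\<exists>b1 b2 b3 b4 b5 b6. filtered_basis b1 b2 b3 b4 b5 b6"
proof (cases "q = 0")
  case False
  then show ?thesis
    by (intro plane_46 nonabelian_weights) auto
next
  case q: True
  have b: "b4 \<in> vec.span {b4, b5, b6}" "b5 \<in> vec.span {b4, b5, b6}" "b6 \<in> vec.span {b4, b5, b6}"
    "b5 \<in> vec.span {b5, b6}" "b6 \<in> vec.span {b5, b6}" "b6 \<in> vec.span {b6}"
    by (auto intro: vec.span_base)
  have b45: "\<mu> b4 b5 = 0" by (simp add: table_rules q)
  consider "a3 = 0" "c3 = 0" | "c3 \<noteq> 0" | "a3 \<noteq> 0" by blast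
  then show ?thesis
  proof cases
    case 1
    show ?thesis
      by (rule common_kernel[OF span table(1) _ _ table(4,5) _ table(7,8) _ b45 table(11) weights_parallel(1)])
        (simp_all add: 1 table b vec.span_add vec.span_scale)
  next
    case 3
    \<comment> \<open>Now \<open>b5\<close> and \<open>b6\<close> both annihilate the algebra, so
      the order inside their plane is free: \<open>d6 = b3 b4\<close> becomes the last vector and
      \<open>b6\<close> moves up to the place of \<open>b5\<close>. The new forms are proportional
      because one of them is zero.\<close>
    then have c: "c1 = 0" "c2 = 0" "c3 = 0" using weights_parallel radical_weights by auto
    define d6 where "d6 = a3 *s b5 + r3 *s b6"
    have b5: "b5 = (1 / a3) *s (d6 - r3 *s b6)" using 3 by (simp add: d6_def vec_eq_iff)
    have d6: "\<mu> x d6 = 0" for x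
    proof -
      have "\<mu> x b5 \<in> vec.span {}"
        by (rule mult_in_span_left[where B = "{b1, b2, b3, b4, b5, b6}"])
          (use span in \<open>auto simp: table_rules c q\<close>)
      then show ?thesis by (simp add: d6_def table_rules)
    qed
    have S: "vec.span {b1, b2, b3, b4, b6, d6} = UNIV"
    proof (rule span_UNIV_trans[OF span])
      have base: "b1 \<in> vec.span {b1, b2, b3, b4, b6, d6}" "b2 \<in> vec.span {b1, b2, b3, b4, b6, d6}"
        "b3 \<in> vec.span {b1, b2, b3, b4, b6, d6}" "b4 \<in> vec.span {b1, b2, b3, b4, b6, d6}"
        "b6 \<in> vec.span {b1, b2, b3, b4, b6, d6}" "d6 \<in> vec.span {b1, b2, b3, b4, b6, d6}"
        by (auto intro: vec.span_base)
      then have "b5 \<in> vec.span {b1, b2, b3, b4, b6, d6}"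
        by (subst b5) (intro vec.span_scale vec.span_diff)
      with base show "{b1, b2, b3, b4, b5, b6} \<subseteq> vec.span {b1, b2, b3, b4, b6, d6}" by auto
    qed
    have sp: "b5 \<in> vec.span {b6, d6}" "b6 \<in> vec.span {b6, d6}" "d6 \<in> vec.span {d6}"
      by (subst b5, intro vec.span_scale vec.span_diff) (auto intro: vec.span_base)
    have t4: "\<mu> b1 b4 = (r1 - a1 / a3 * r3) *s b6 + (a1 / a3) *s d6"
      "\<mu> b2 b4 = (r2 - a2 / a3 * r3) *s b6 + (a2 / a3) *s d6"
      using 3 by (simp_all add: table d6_def vec_eq_iff field_simps)
    have t5: "\<mu> b1 b6 = 0 *s d6" "\<mu> b2 b6 = 0 *s d6" "\<mu> b3 b6 = 0" "\<mu> b4 b6 = 0"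
      by (simp_all add: table)
    have t3: "\<mu> b1 b3 \<in> vec.span {b6, d6}" "\<mu> b2 b3 \<in> vec.span {b6, d6}" "\<mu> b3 b4 \<in> vec.span {d6}"
      using sp by (simp_all add: table vec.span_add vec.span_scale flip: d6_def)
    show ?thesis
      by (rule common_kernel[OF S table(1) t3(1,2) t4 t3(3) t5 d6]) simp
  next
    case 2
    then have a: "a1 = 0" "a2 = 0" "a3 = 0" using weights_parallel radical_weights by auto
    \<comment> \<open>With \<open>p\<close> and \<open>d5\<close> as below, all products with
      \<open>p\<close> lie in the span of \<open>d5\<close> and \<open>b6\<close> for every
      \<open>n\<close>. What remains is \<open>p d5 = 0\<close>, a quadratic equation in
      \<open>n\<close> with leading coefficient \<open>- c3\<close>.\<close>
    obtain n where "c3 * n^2 + (- (ga * c1 - gb * c2 - r3)) * n + (- (ga * r1 - gb * r2)) = 0"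
      using complex_quadratic_root[OF 2] by blast
    then have "- (c3 * n^2 + (- (ga * c1 - gb * c2 - r3)) * n + (- (ga * r1 - gb * r2))) = 0"
      by (simp only: neg_equal_0_iff_equal)
    then have n: "ga * r1 - gb * r2 - n * r3 + n * (ga * c1 - gb * c2 - n * c3) = 0"
      by (simp add: power2_eq_square algebra_simps)
    define p where "p = ga *s b1 - gb *s b2 - n *s b3"
    define d5 where "d5 = b4 + n *s b5"
    show ?thesis
    proof (cases "ga = 0 \<and> gb = 0 \<and> n = 0")
      case True
      then show ?thesis by (intro plane_46 a) auto
    next
      case False
      have span_eq: "vec.span {b5, d5, b6} = vec.span {b4, b5, b6}"
      proof
        have "d5 \<in> vec.span {b4, b5, b6}"
          unfolding d5_def by (intro vec.span_add vec.span_scale b)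
        then show "vec.span {b5, d5, b6} \<subseteq> vec.span {b4, b5, b6}"
          by (intro vec.span_minimal) (auto simp: b)
        have "b4 = d5 - n *s b5" by (simp add: d5_def)
        also have "\<dots> \<in> vec.span {b5, d5, b6}"
          by (intro vec.span_diff vec.span_scale) (auto intro: vec.span_base)
        finally show "vec.span {b4, b5, b6} \<subseteq> vec.span {b5, d5, b6}"
          by (intro vec.span_minimal) (auto intro: vec.span_base)
      qed
      have dim: "vec.dim {p, b5, d5, b6} = 4"
      proof -
        have "vec.dim {b1, b2, b3, b4, b5, b6} = 6"
          using span by (simp add: span_UNIV_iff_dim)
        then have "vec.dim {b4, b5, b6} \<ge> 3"
          using dim_insert_le[of b1 "{b2, b3, b4, b5, b6}"] dim_insert_le[of b2 "{b3, b4, b5, b6}"]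
            dim_insert_le[of b3 "{b4, b5, b6}"] by linarith
        moreover have "vec.dim {b4, b5, b6} \<le> 3"
          using vec.dim_le_card'[of "{b4, b5, b6}"] card_length[of "[b4, b5, b6]"] by simp
        ultimately have 3: "vec.dim {b5, d5, b6} = 3"
          using span_eq vec.dim_span by (metis le_antisym)
        have "p \<notin> vec.span {b4, b5, b6}"
        proof
          assume "p \<in> vec.span {b4, b5, b6}"
          then obtain x y z where "p = x *s b4 + y *s b5 + z *s b6" unfolding span3 by blast
          then have "ga *s b1 + (- gb) *s b2 + (- n) *s b3 + (- x) *s b4 + (- y) *s b5 + (- z) *s b6 = 0"
            by (simp add: p_def vec_eq_iff algebra_simps)
          from basis_coefficients_6[OF span this] show False using False by simp
        qed
        then show ?thesis by (simp add: vec.dim_insert[of p] span_eq 3)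
      qed
      have d: "d5 \<in> vec.span {d5, b6}" "b6 \<in> vec.span {d5, b6}" by (auto intro: vec.span_base)
      show ?thesis
      \<comment> \<open>\<open>b5\<close> and \<open>d5\<close> take the places of \<open>b4\<close>
        and \<open>b5\<close>.\<close>
      proof (rule hyperplane_square[OF dim])
        show "\<mu> x y \<in> vec.span {b5, d5, b6}" for x y
          unfolding span_eq
          by (rule mult_in_subspace[OF span]) (simp_all add: table_rules b vec.span_add vec.span_scale vec.span_zero)
        show *: "\<mu> x b5 \<in> vec.span {b6}" for x
          by (rule mult_in_span_left[where B = "{b1, b2, b3, b4, b5, b6}"])
            (use span in \<open>auto simp: table_rules q b vec.span_scale vec.span_zero vec.span_neg\<close>)
        have "\<mu> x b4 \<in> vec.span {b6}" for x
          by (rule mult_in_span_left[where B = "{b1, b2, b3, b4, b5, b6}"])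
            (use span in \<open>auto simp: table_rules a q b vec.span_scale vec.span_zero vec.span_neg\<close>)
        then show "\<mu> x d5 \<in> vec.span {b6}" for x
          using * by (simp add: d5_def bilin vec.span_add vec.span_scale)
        show "\<mu> x b6 = 0" for x by (rule table)
        show "\<mu> b5 d5 = 0" by (simp add: d5_def table_rules q)
        have "(ga * r1 - gb * r2 - n * r3 + n * (ga * c1 - gb * c2 - n * c3)) *s b6 = \<mu> p d5"
          by (simp add: d5_def p_def table_rules a) (simp add: vec_eq_iff algebra_simps)
        then show "\<mu> p d5 = 0" using n by simp
        have "\<mu> b1 p = (- gb) *s d5 + (- n * hb) *s b6" "\<mu> b2 p = (- ga) *s d5 + (- n * ha) *s b6"
          "\<mu> b3 p = (gb * ha - ga * hb) *s b6" "\<mu> b4 p = (gb * r2 - ga * r1 + n * r3) *s b6"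
          "\<mu> b5 p = (gb * c2 - ga * c1 + n * c3) *s b6"
          by (simp_all add: d5_def p_def table_rules a vec_eq_iff algebra_simps)
        moreover have "x *s d5 + y *s b6 \<in> vec.span {d5, b6}" "y *s b6 \<in> vec.span {d5, b6}" for x y
          by (intro vec.span_add vec.span_scale d)+
        ultimately have mp: "\<mu> b1 p \<in> vec.span {d5, b6}" "\<mu> b2 p \<in> vec.span {d5, b6}"
          "\<mu> b3 p \<in> vec.span {d5, b6}" "\<mu> b4 p \<in> vec.span {d5, b6}" "\<mu> b5 p \<in> vec.span {d5, b6}"
          by (simp_all only:)
        show "\<mu> x p \<in> vec.span {d5, b6}" for x
          by (rule mult_in_span_left[where B = "{b1, b2, b3, b4, b5, b6}"])
            (use mp span b6_left in \<open>auto simp: vec.span_zero\<close>)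
      qed
    qed
  qed
qed

end

text \<open>A chain of ideals \<open>I\<close>, \<open>J\<close>, \<open>Z\<close> of dimensions 3,
  2, 1 is fixed first, each multiplied by the algebra into the next, with A^2 inside
  \<open>I\<close>. If A^2 lies in \<open>J\<close>, the plane case applies; otherwise the factors
  of a product outside \<open>J\<close> lead to \<open>b1\<close> and \<open>b2\<close>.\<close>

lemma small_square_filtered:
  assumes mal: "malcev \<mu>" and nil: "nilpotent \<mu>" and small: "small_square \<mu>"
  shows "\<exists>b1 b2 b3 b4 b5 b6. filtered_basis b1 b2 b3 b4 b5 b6"
proof -
  obtain I where I: "vec.subspace I" "lcs \<mu> 1 \<subseteq> I" "vec.dim I = 3"
    using subspace_between[of "lcs \<mu> 1" UNIV 3] small subspace_lcs[of \<mu> 1] vec.subspace_UNIV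
    by (auto simp: small_square_def card_cart_basis simp del: lcs.simps)
  have sqI: "\<mu> x y \<in> I" for x y
    using I(2) lcs_mult[of y \<mu> 0 x] by auto
  obtain i4 J where J: "vec.subspace J" "vec.dim J = 2" "i4 \<notin> J" "I = vec.span (insert i4 J)"
    "\<And>x w. w \<in> I \<Longrightarrow> \<mu> x w \<in> J"
    by (rule flag_step[OF nil I(1), of 2]) (use I(3) sqI in auto)
  have JI: "J \<subseteq> I" unfolding J(4) by (auto intro: vec.span_base)
  obtain b5 Z where Z: "vec.subspace Z" "vec.dim Z = 1" "b5 \<notin> Z" "J = vec.span (insert b5 Z)"
    "\<And>x w. w \<in> J \<Longrightarrow> \<mu> x w \<in> Z"
    by (rule flag_step[OF nil J(1), of 1]) (use J(2,5) JI in auto)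
  have ZJ: "Z \<subseteq> J" unfolding Z(4) by (auto intro: vec.span_base)
  obtain b6 N where N: "vec.subspace N" "vec.dim N = 0" "b6 \<notin> N" "Z = vec.span (insert b6 N)"
    "\<And>x w. w \<in> Z \<Longrightarrow> \<mu> x w \<in> N"
    by (rule flag_step[OF nil Z(1), of 0]) (use Z(2,5) ZJ in auto)
  have N0: "N = {0}" using N(1,2) vec.subspace_0 by (auto simp: vec.dim_eq_0)
  have Zeq: "Z = vec.span {b6}"
    using N(4) by (simp add: N0 insert_commute[of b6 0])
  have Jeq: "J = vec.span {b5, b6}"
    unfolding Z(4) Zeq by (rule span_insert_span)
  have b6: "\<mu> x b6 = 0" for x
    using N(5)[of b6 x] by (simp add: N0 Zeq vec.span_base)
  have b5: "\<mu> x b5 \<in> vec.span {b6}" for x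
    using Z(5)[of b5 x] by (simp add: Jeq Zeq vec.span_base)
  have dim2: "vec.dim {b5, b6} = 2"
    using J(2) by (simp add: Jeq)
  show ?thesis
  proof (cases "\<forall>x y. \<mu> x y \<in> J")
    case True
    show ?thesis
      by (rule plane_square[OF dim2 _ b5 b6]) (use True Jeq in simp)
  next
    case False
    then obtain x0 y0 where xy0: "\<mu> x0 y0 \<notin> J" by blast
    \<comment> \<open>If \<open>i4\<close> does not centralise \<open>b5\<close>, every vector can
      be corrected by a multiple of \<open>i4\<close> so that it does. This provides the hypothesis
      \<open>adjusted\<close> of the table.\<close>
    have adjust: "\<exists>i\<in>I. \<mu> i4 b5 \<noteq> 0 \<longrightarrow> \<mu> (x - i) b5 = 0" for x
    proof (cases "\<mu> i4 b5 = 0")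
      case True
      then show ?thesis using vec.subspace_0[OF I(1)] by blast
    next
      case False
      obtain p q where pq: "\<mu> x b5 = p *s b6" "\<mu> i4 b5 = q *s b6" using b5 unfolding span1 by metis
      then have "\<mu> (x - (p / q) *s i4) b5 = 0" using False by (simp add: bilin)
      moreover have "(p / q) *s i4 \<in> I" unfolding J(4) by (intro vec.span_scale vec.span_base) simp
      ultimately show ?thesis by blast
    qed
    have left: "\<mu> w x \<in> J" if "w \<in> I" for w x
      using J(5)[OF that, of x] swap[of x w "\<mu> x w"] vec.subspace_neg[OF J(1)] by simp
    have modI: "\<mu> (x - i) (y - j) \<in> J \<longleftrightarrow> \<mu> x y \<in> J" if "i \<in> I" "j \<in> I" for x y i j
    proof -
      have "\<mu> x y = \<mu> (x - i) (y - j) + (\<mu> x j + \<mu> i (y - j))" by (simp add: bilin)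
      moreover have "\<mu> x j + \<mu> i (y - j) \<in> J" using that by (intro vec.subspace_add J left)
      ultimately show ?thesis
        using vec.subspace_add[OF J(1)] vec.subspace_diff[OF J(1)] by (metis add_diff_cancel)
    qed
    obtain i j where ij: "i \<in> I" "j \<in> I" "\<mu> i4 b5 \<noteq> 0 \<longrightarrow> \<mu> (x0 - i) b5 = 0"
      "\<mu> i4 b5 \<noteq> 0 \<longrightarrow> \<mu> (y0 - j) b5 = 0"
      using adjust by metis
    define b1 where "b1 = x0 - i"
    define b2 where "b2 = y0 - j"
    define b4 where "b4 = \<mu> b1 b2"
    have b4: "b4 \<in> I" "b4 \<notin> J"
      using sqI xy0 modI[OF ij(1,2)] by (auto simp: b4_def b1_def b2_def)
    have "vec.dim (insert b4 J) = 3"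
      using b4(2) J(1,2) by (simp add: vec.dim_insert vec.span_eq_iff[THEN iffD2])
    then have Ieq: "I = vec.span {b4, b5, b6}"
      using vec.dim_eq_span[of "insert b4 J" I] b4(1) JI I(1,3)
      by (simp add: Jeq span_insert_span vec.span_eq_iff[THEN iffD2])
    have dim3: "vec.dim {b4, b5, b6} = 3" using I(3) by (simp add: Ieq)
    have "b2 \<notin> I" using J(5)[of b2 b1] b4(2) by (auto simp: b4_def)
    then have dim4: "vec.dim {b2, b4, b5, b6} = 4" by (simp add: vec.dim_insert[of b2] dim3 Ieq)
    have "b1 \<notin> vec.span {b2, b4, b5, b6}"
    proof
      assume "b1 \<in> vec.span {b2, b4, b5, b6}"
      then obtain k where "b1 - k *s b2 \<in> I" unfolding Ieq by (subst (asm) vec.span_insert) blast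
      then have "\<mu> (b1 - k *s b2) b2 \<in> J" by (rule left)
      then show False using b4(2) by (simp add: bilin b4_def)
    qed
    then have dim5: "vec.dim {b1, b2, b4, b5, b6} = 5" by (simp add: vec.dim_insert[of b1] dim4)
    obtain z where z: "z \<notin> vec.span {b1, b2, b4, b5, b6}"
      using exists_not_in_span[of "{b1, b2, b4, b5, b6}"] dim5 by auto
    have modJ: "\<exists>k. x - k *s b4 \<in> J" if "x \<in> I" for x
      using that unfolding Ieq Jeq by (simp add: vec.span_insert[of b4])
    obtain k l where kl: "\<mu> b1 z - k *s b4 \<in> J" "\<mu> b2 z - l *s b4 \<in> J"
      using modJ sqI by metis
    \<comment> \<open>The multiples of \<open>b2\<close> and \<open>b1\<close> cancel the
      \<open>b4\<close>-components of \<open>b1 z\<close> and \<open>b2 z\<close>, since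
      \<open>b1 b2 = b4\<close> and \<open>b2 b1 = - b4\<close>.\<close>
    define z' where "z' = z - k *s b2 + l *s b1"
    obtain h where h: "h \<in> I" "\<mu> i4 b5 \<noteq> 0 \<longrightarrow> \<mu> (z' - h) b5 = 0"
      using adjust by metis
    define b3 where "b3 = z' - h"
    have "\<mu> b2 b1 = - b4" using swap[of b1 b2 b4] by (simp add: b4_def)
    then have "\<mu> b1 b3 = \<mu> b1 z - k *s b4 - \<mu> b1 h" "\<mu> b2 b3 = \<mu> b2 z - l *s b4 - \<mu> b2 h"
      by (simp_all add: b3_def z'_def bilin b4_def[symmetric] vec_eq_iff)
    then have b13: "\<mu> b1 b3 \<in> J" "\<mu> b2 b3 \<in> J"
      using kl J(5)[OF h(1)] vec.subspace_diff[OF J(1)] by metis+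
    have "b3 \<notin> vec.span {b1, b2, b4, b5, b6}"
    proof
      let ?S = "vec.span {b1, b2, b4, b5, b6}"
      assume "b3 \<in> ?S"
      moreover have "h \<in> ?S" using h(1) vec.span_mono[of "{b4, b5, b6}" "{b1, b2, b4, b5, b6}"] by (auto simp: Ieq)
      moreover have "b1 \<in> ?S" "b2 \<in> ?S" by (auto intro: vec.span_base)
      ultimately have "b3 + h + k *s b2 - l *s b1 \<in> ?S"
        by (intro vec.span_add vec.span_diff vec.span_scale)
      then show False using z by (simp add: b3_def z'_def)
    qed
    then have "vec.dim {b3, b1, b2, b4, b5, b6} = 6" by (simp add: vec.dim_insert[of b3] dim5)
    then have span: "vec.span {b1, b2, b3, b4, b5, b6} = UNIV"
      unfolding span_UNIV_iff_dim by (simp add: insert_commute)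
    obtain gb hb where t13: "\<mu> b1 b3 = gb *s b5 + hb *s b6" using b13(1) unfolding Jeq span2 by blast
    obtain ga ha where t23: "\<mu> b2 b3 = ga *s b5 + ha *s b6" using b13(2) unfolding Jeq span2 by blast
    have t4: "\<exists>p q. \<mu> x b4 = p *s b5 + q *s b6" for x
      using J(5)[OF b4(1), of x] unfolding Jeq span2 .
    obtain a1 r1 where t14: "\<mu> b1 b4 = a1 *s b5 + r1 *s b6" using t4 by blast
    obtain a2 r2 where t24: "\<mu> b2 b4 = a2 *s b5 + r2 *s b6" using t4 by blast
    obtain a3 r3 where t34: "\<mu> b3 b4 = a3 *s b5 + r3 *s b6" using t4 by blast
    obtain c where t5: "\<And>x. \<mu> x b5 = c x *s b6" using b5 unfolding span1 by metis
    have b6nz: "b6 \<noteq> 0" using N(3) N0 by auto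
    \<comment> \<open>\<open>b4\<close> is a multiple of \<open>i4\<close> modulo \<open>J\<close>,
      and \<open>J\<close> centralises \<open>b5\<close>; so \<open>b4 b5 \<noteq> 0\<close> implies
      \<open>i4 b5 \<noteq> 0\<close>, the condition under which the corrections were made.\<close>
    obtain m where m: "b4 - m *s i4 \<in> J"
      using b4(1) unfolding J(4) by (auto simp: vec.span_insert vec.span_eq_iff[THEN iffD2, OF J(1)])
    have JJ: "\<mu> w b5 = 0" if "w \<in> J" for w
      using that swap[OF b6[of b5]] unfolding Jeq span2 by (auto simp: bilin)
    have "\<mu> (b4 - m *s i4) b5 = 0" by (rule JJ[OF m])
    then have "\<mu> i4 b5 \<noteq> 0" if "c b4 \<noteq> 0"
      using that b6nz t5[of b4] by (auto simp: bilin)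
    then have adj: "c b1 = 0 \<and> c b2 = 0 \<and> c b3 = 0" if "c b4 \<noteq> 0"
      using that ij(3,4) h(2) b6nz t5[of b1] t5[of b2] t5[of b3] by (auto simp: b1_def b2_def b3_def)
    show ?thesis
      by (rule small_square_table_filtered[OF mal span b4_def[symmetric] t13 t23 t14 t24 t34 t5 t5 t5 t5 b6 adj])
  qed
qed

end

section \<open>Normal forms of the algebras with two generators\<close>

context anticomm_algebra_6
begin

text \<open>Two generators \<open>x\<close>, \<open>y\<close> and their iterated products. The free
  constants are \<alpha>, \<beta>, \<kappa>, \<rho>; the entries \<open>\<alpha> * \<kappa>\<close>
  and \<open>- \<rho>\<close> are forced by the Malcev identity.\<close>

definition class5_basis where
  "class5_basis x y w u s r \<alpha> \<beta> \<kappa> \<rho> \<longleftrightarrow> vec.span {x, y, w, u, s, r} = UNIV \<and>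
    \<mu> x y = w \<and> \<mu> x w = u \<and> \<mu> x u = s \<and> \<mu> x s = \<kappa> *s r \<and> \<mu> x r = 0 \<and>
    \<mu> y w = \<alpha> *s s + \<beta> *s r \<and> \<mu> y u = (\<alpha> * \<kappa>) *s r \<and> \<mu> y s = \<rho> *s r \<and> \<mu> y r = 0 \<and>
    \<mu> w u = (- \<rho>) *s r \<and> \<mu> w s = 0 \<and> \<mu> w r = 0 \<and> \<mu> u s = 0 \<and> \<mu> u r = 0 \<and> \<mu> s r = 0"

text \<open>At \<open>p = 0\<close> the class is at most 4, with \<open>u\<close> and
  \<open>v\<close> side by side. A nonzero \<open>p\<close> deforms such a table into one of class 5
  type, which is how these algebras are reached from \<open>g6\<close>.\<close>

definition class4_basis where
  "class4_basis x y w u v r p q m n \<longleftrightarrow> vec.span {x, y, w, u, v, r} = UNIV \<and>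
    \<mu> x y = w \<and> \<mu> x w = u \<and> \<mu> y w = v \<and> \<mu> x u = p *s v + q *s r \<and> \<mu> x v = m *s r \<and>
    \<mu> y u = m *s r \<and> \<mu> y v = n *s r \<and> \<mu> w u = (- (p * n)) *s r \<and> \<mu> w v = 0 \<and> \<mu> u v = 0 \<and>
    \<mu> x r = 0 \<and> \<mu> y r = 0 \<and> \<mu> w r = 0 \<and> \<mu> u r = 0 \<and> \<mu> v r = 0"

lemma class5_span:
  assumes "class5_basis x y w u s r \<alpha> \<beta> \<kappa> \<rho>"
  shows "vec.span {x, y, w, u, s, r} = UNIV"
  using assms unfolding class5_basis_def by blast

lemma class5_table:
  assumes "class5_basis x y w u s r \<alpha> \<beta> \<kappa> \<rho>"
  shows "\<mu> x y = w" "\<mu> x w = u" "\<mu> x u = s" "\<mu> x s = \<kappa> *s r" "\<mu> x r = 0"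
    "\<mu> y w = \<alpha> *s s + \<beta> *s r" "\<mu> y u = (\<alpha> * \<kappa>) *s r" "\<mu> y s = \<rho> *s r" "\<mu> y r = 0"
    "\<mu> w u = (- \<rho>) *s r" "\<mu> w s = 0" "\<mu> w r = 0" "\<mu> u s = 0" "\<mu> u r = 0" "\<mu> s r = 0"
  using assms unfolding class5_basis_def by blast+

lemma class4_span:
  assumes "class4_basis x y w u v r p q m n"
  shows "vec.span {x, y, w, u, v, r} = UNIV"
  using assms unfolding class4_basis_def by blast

lemma class4_table:
  assumes "class4_basis x y w u v r p q m n"
  shows "\<mu> x y = w" "\<mu> x w = u" "\<mu> y w = v" "\<mu> x u = p *s v + q *s r" "\<mu> x v = m *s r"
    "\<mu> y u = m *s r" "\<mu> y v = n *s r" "\<mu> w u = (- (p * n)) *s r" "\<mu> w v = 0" "\<mu> u v = 0"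
    "\<mu> x r = 0" "\<mu> y r = 0" "\<mu> w r = 0" "\<mu> u r = 0" "\<mu> v r = 0"
  using assms unfolding class4_basis_def by blast+

text \<open>Since \<open>y s = \<rho> *s r\<close> with \<open>\<rho> \<noteq> 0\<close>,
  subtracting a multiple of \<open>y\<close> from \<open>x\<close> makes \<open>x\<close> annihilate
  \<open>s\<close>; \<open>u\<close> and \<open>s\<close> are then recomputed as iterated
  products.\<close>

lemma class5_shear:
  assumes "class5_basis x y w u s r \<alpha> \<beta> \<kappa> \<rho>" "\<rho> \<noteq> 0"
  obtains x' u' s' \<beta>' where "class5_basis x' y w u' s' r \<alpha> \<beta>' 0 \<rho>"
proof -
  note table = class5_table[OF assms(1)] and span = class5_span[OF assms(1)]
  note rules = bilin table table[THEN swap]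
  define k where "k = \<kappa> / \<rho>"
  have k: "\<kappa> = k * \<rho>" using assms(2) by (simp add: k_def)
  define x' where "x' = x - k *s y"
  define u' where "u' = u - k *s (\<alpha> *s s + \<beta> *s r)"
  define s' where "s' = s - (k * \<alpha> * \<kappa>) *s r"
  let ?S = "vec.span {x', y, w, u', s', r}"
  have base: "x' \<in> ?S" "y \<in> ?S" "w \<in> ?S" "u' \<in> ?S" "s' \<in> ?S" "r \<in> ?S"
    by (auto intro: vec.span_base)
  have "s = s' + (k * \<alpha> * \<kappa>) *s r" by (simp add: s'_def)
  then have s: "s \<in> ?S" using base by (metis vec.span_add vec.span_scale)
  have "u = u' + k *s (\<alpha> *s s + \<beta> *s r)" by (simp add: u'_def)
  then have u: "u \<in> ?S" using base s by (metis vec.span_add vec.span_scale)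
  have "x = x' + k *s y" by (simp add: x'_def)
  then have "x \<in> ?S" using base by (metis vec.span_add vec.span_scale)
  then have S: "?S = UNIV" by (intro span_UNIV_trans[OF span]) (use base s u in auto)
  have "class5_basis x' y w u' s' r \<alpha> (\<beta> + k * \<alpha>\<^sup>2 * \<kappa>) 0 \<rho>"
    unfolding class5_basis_def
    by (intro conjI S)
      (simp_all add: x'_def u'_def s'_def rules vec_eq_iff algebra_simps power2_eq_square k)
  then show ?thesis by (rule that)
qed

lemma class5_g6:
  assumes "class5_basis x y w u s r \<alpha> \<beta> \<kappa> \<rho>" "\<rho> \<noteq> 0" "\<alpha> \<noteq> 0"
  shows "\<mu> \<in> orbit g6"
proof -
  obtain x' u' s' \<beta>' where c: "class5_basis x' y w u' s' r \<alpha> \<beta>' 0 \<rho>"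
    using class5_shear[OF assms(1,2)] by blast
  note table = class5_table[OF c] and span = class5_span[OF c]
  note rules = bilin table table[THEN swap]
  \<comment> \<open>Replacing \<open>y\<close> by \<open>y + l *s u'\<close> and \<open>w\<close> by
    \<open>w + l *s s'\<close> adds \<open>l * \<rho>\<close> twice to the
    \<open>r\<close>-component of \<open>y w\<close>, once from \<open>y s'\<close> and once from
    \<open>u' w\<close>. Hence the 2.\<close>
  define l where "l = - \<beta>' / (2 * \<rho>)"
  have l: "\<beta>' = - 2 * \<rho> * l" using assms(2) by (simp add: l_def)
  define E2 where "E2 = (1 / \<alpha>) *s (y + l *s u')"
  define E3 where "E3 = (1 / \<alpha>) *s (w + l *s s')"
  define E4 where "E4 = (1 / \<alpha>) *s u'"
  define E5 where "E5 = (1 / \<alpha>) *s s'"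
  define E6 where "E6 = (\<rho> / \<alpha>\<^sup>2) *s r"
  let ?S = "vec.span {x', E2, E3, E4, E5, E6}"
  have base: "x' \<in> ?S" "E2 \<in> ?S" "E3 \<in> ?S" "E4 \<in> ?S" "E5 \<in> ?S" "E6 \<in> ?S"
    by (auto intro: vec.span_base)
  have "r = (\<alpha>\<^sup>2 / \<rho>) *s E6" "s' = \<alpha> *s E5" "u' = \<alpha> *s E4"
    using assms by (simp_all add: E4_def E5_def E6_def)
  then have rsu: "r \<in> ?S" "s' \<in> ?S" "u' \<in> ?S" using base by (metis vec.span_scale)+
  have "w = \<alpha> *s E3 - l *s s'" "y = \<alpha> *s E2 - l *s u'"
    using assms by (simp_all add: E2_def E3_def)
  then have "w \<in> ?S" "y \<in> ?S" using base rsu by (metis vec.span_scale vec.span_diff)+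
  then have S: "?S = UNIV" by (intro span_UNIV_trans[OF span]) (use base rsu in auto)
  show ?thesis
    by (rule orbit_by_basis_6[OF bil anti _ _ S])
      (simp_all add: g6_def alg_bilinear alg_anticommutative,
       simp_all add: alg_def axis_nth E2_def E3_def E4_def E5_def E6_def rules assms l vec_eq_iff field_simps power2_eq_square)
qed

lemma class5_g8:
  assumes "class5_basis x y w u s r 0 \<beta> \<kappa> \<rho>" "\<rho> \<noteq> 0"
  shows "\<mu> \<in> orbit g8"
proof -
  obtain x' u' s' \<beta>' where c: "class5_basis x' y w u' s' r 0 \<beta>' 0 \<rho>"
    using class5_shear[OF assms] by blast
  note table = class5_table[OF c] and span = class5_span[OF c]
  note rules = bilin table table[THEN swap]
  define l where "l = - \<beta>' / (2 * \<rho>)"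
  have l: "\<beta>' = - 2 * \<rho> * l" using assms(2) by (simp add: l_def)
  define E2 where "E2 = y + l *s u'"
  define E3 where "E3 = w + l *s s'"
  define E6 where "E6 = \<rho> *s r"
  let ?S = "vec.span {x', E2, E3, u', s', E6}"
  have base: "x' \<in> ?S" "E2 \<in> ?S" "E3 \<in> ?S" "u' \<in> ?S" "s' \<in> ?S" "E6 \<in> ?S"
    by (auto intro: vec.span_base)
  have "r = (1 / \<rho>) *s E6" using assms by (simp add: E6_def)
  then have r: "r \<in> ?S" using base by (metis vec.span_scale)
  have "w = E3 - l *s s'" "y = E2 - l *s u'" by (simp_all add: E2_def E3_def)
  then have "w \<in> ?S" "y \<in> ?S" using base by (metis vec.span_scale vec.span_diff)+
  then have S: "?S = UNIV" by (intro span_UNIV_trans[OF span]) (use base r in auto)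
  show ?thesis
    by (rule orbit_by_basis_6[OF bil anti _ _ S])
      (simp_all add: g8_def alg_bilinear alg_anticommutative,
       simp_all add: alg_def axis_nth E2_def E3_def E6_def rules l vec_eq_iff algebra_simps)
qed

context
  fixes x y w u s r :: "complex ^ 6" and \<alpha> \<beta> \<kappa> :: complex
  assumes c5: "class5_basis x y w u s r \<alpha> \<beta> \<kappa> 0" and \<kappa>: "\<kappa> \<noteq> 0"
begin

lemmas c5_span = class5_span[OF c5]
lemmas c5_table = class5_table[OF c5]
lemmas c5_rules = bilin c5_table c5_table[THEN swap]

lemma c5_scaled_span:
  assumes "k \<noteq> 0"
  shows "vec.span {x, k *s y, k *s w, k *s u, k *s s, (k * \<kappa>) *s r} = UNIV"
proof (rule span_UNIV_trans[OF c5_span])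
  let ?S = "vec.span {x, k *s y, k *s w, k *s u, k *s s, (k * \<kappa>) *s r}"
  have "y = (1 / k) *s (k *s y)" "w = (1 / k) *s (k *s w)" "u = (1 / k) *s (k *s u)"
    "s = (1 / k) *s (k *s s)" "r = (1 / (k * \<kappa>)) *s ((k * \<kappa>) *s r)"
    using assms \<kappa> by simp_all
  moreover have "x \<in> ?S" "k *s y \<in> ?S" "k *s w \<in> ?S" "k *s u \<in> ?S"
    "k *s s \<in> ?S" "(k * \<kappa>) *s r \<in> ?S"
    by (auto intro: vec.span_base)
  ultimately have "x \<in> ?S" "y \<in> ?S" "w \<in> ?S" "u \<in> ?S" "s \<in> ?S" "r \<in> ?S"
    by (metis vec.span_scale)+
  then show "{x, y, w, u, s, r} \<subseteq> ?S" by blast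
qed

lemma class5_g9:
  assumes "\<alpha> = 0" "\<beta> = 0"
  shows "\<mu> \<in> orbit g9"
  by (rule orbit_by_basis_6[OF bil anti _ _ c5_scaled_span[of 1]])
    (simp_all add: g9_def alg_bilinear alg_anticommutative,
     simp_all add: alg_def axis_nth c5_rules assms)

lemma class5_g7:
  assumes "\<alpha> = 0" "\<beta> \<noteq> 0"
  shows "\<mu> \<in> orbit g7"
  by (rule orbit_by_basis_6[OF bil anti _ _ c5_scaled_span[of "\<kappa> / \<beta>"]])
    (use assms \<kappa> in \<open>simp_all add: g7_def alg_bilinear alg_anticommutative\<close>,
     simp_all add: alg_def axis_nth c5_rules vec_eq_iff field_simps)

lemma class5_g5:
  assumes "\<alpha> \<noteq> 0"
  shows "\<mu> \<in> orbit g5"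
proof -
  \<comment> \<open>The shear \<open>x + l *s y\<close> changes \<open>s\<close> by
    \<open>2 * l * \<alpha> * \<kappa>\<close> times \<open>r\<close>; \<open>l\<close> is chosen to
    make the rescaled \<open>y w\<close> equal to the resulting \<open>E5\<close>.\<close>
  define l where "l = \<beta> / (2 * \<alpha>\<^sup>2 * \<kappa>)"
  have l: "\<beta> = 2 * \<alpha> * \<alpha> * \<kappa> * l" using assms \<kappa> by (simp add: l_def power2_eq_square)
  define k where "k = 1 / \<alpha>"
  have k: "\<alpha> * k = 1" "k \<noteq> 0" using assms by (simp_all add: k_def)
  define E1 where "E1 = x + l *s y"
  define E4 where "E4 = k *s (u + l *s (\<alpha> *s s + \<beta> *s r))"
  define E5 where "E5 = k *s (s + (2 * l * \<alpha> * \<kappa>) *s r)"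
  let ?S = "vec.span {E1, k *s y, k *s w, E4, E5, (k * \<kappa>) *s r}"
  have base: "E1 \<in> ?S" "k *s y \<in> ?S" "k *s w \<in> ?S" "E4 \<in> ?S" "E5 \<in> ?S" "(k * \<kappa>) *s r \<in> ?S"
    by (auto intro: vec.span_base)
  have "y = \<alpha> *s (k *s y)" "w = \<alpha> *s (k *s w)" "r = (\<alpha> / \<kappa>) *s ((k * \<kappa>) *s r)"
    using k \<kappa> assms by (simp_all add: k_def)
  then have ywr: "y \<in> ?S" "w \<in> ?S" "r \<in> ?S" using base by (metis vec.span_scale)+
  have "s = \<alpha> *s E5 - (2 * l * \<alpha> * \<kappa>) *s r"
    using assms by (simp add: E5_def k_def)
  then have s: "s \<in> ?S" using base ywr by (metis vec.span_scale vec.span_diff)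
  have "u = \<alpha> *s E4 - l *s (\<alpha> *s s + \<beta> *s r)"
    using assms by (simp add: E4_def k_def)
  then have u: "u \<in> ?S" using base ywr s by (metis vec.span_scale vec.span_diff vec.span_add)
  have "x = E1 - l *s y" by (simp add: E1_def)
  then have "x \<in> ?S" using base ywr by (metis vec.span_scale vec.span_diff)
  then have S: "?S = UNIV" by (intro span_UNIV_trans[OF c5_span]) (use ywr s u in auto)
  show ?thesis
    by (rule orbit_by_basis_6[OF bil anti _ _ S])
      (simp_all add: g5_def alg_bilinear alg_anticommutative,
       use assms in \<open>simp_all add: alg_def axis_nth E1_def E4_def E5_def c5_rules l vec_eq_iff k_def field_simps\<close>)
qed

end

lemma class4_g14_g23:
  assumes c4: "class4_basis x y w u v r 0 q m 0" and "q \<noteq> 0 \<or> m \<noteq> 0"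
  shows "m \<noteq> 0 \<Longrightarrow> \<mu> \<in> orbit g14" and "m = 0 \<Longrightarrow> \<mu> \<in> orbit g23"
proof -
  note table = class4_table[OF c4] and span = class4_span[OF c4]
  note rules = bilin table table[THEN swap]
  show "\<mu> \<in> orbit g14" if m: "m \<noteq> 0"
  proof -
    \<comment> \<open>\<open>E1 E4\<close> is \<open>q - 2 * k * m\<close> times \<open>r\<close>,
      which this choice annuls.\<close>
    define k where "k = q / (2 * m)"
    have k: "q = 2 * m * k" using m by (simp add: k_def)
    define E1 where "E1 = x - k *s y"
    define E4 where "E4 = u - k *s v"
    let ?S = "vec.span {E1, y, w, E4, v, m *s r}"
    have base: "E1 \<in> ?S" "y \<in> ?S" "w \<in> ?S" "E4 \<in> ?S" "v \<in> ?S" "m *s r \<in> ?S"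
      by (auto intro: vec.span_base)
    have "x = E1 + k *s y" "u = E4 + k *s v" by (simp_all add: E1_def E4_def)
    then have xu: "x \<in> ?S" "u \<in> ?S" using base by (metis vec.span_add vec.span_scale)+
    have "r = (1 / m) *s (m *s r)" using m by simp
    then have "r \<in> ?S" using base by (metis vec.span_scale)
    then have S: "?S = UNIV" by (intro span_UNIV_trans[OF span]) (use base xu in auto)
    show ?thesis
      by (rule orbit_by_basis_6[OF bil anti _ _ S])
        (simp_all add: g14_def alg_bilinear alg_anticommutative,
         simp_all add: alg_def axis_nth E1_def E4_def rules k vec_eq_iff algebra_simps)
  qed
  show "\<mu> \<in> orbit g23" if m: "m = 0"
  proof -
    have q: "q \<noteq> 0" using assms(2) m by simp
    let ?S = "vec.span {x, y, w, u, q *s r, v}"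
    have base: "x \<in> ?S" "y \<in> ?S" "w \<in> ?S" "u \<in> ?S" "v \<in> ?S" "q *s r \<in> ?S"
      by (auto intro: vec.span_base)
    have "r = (1 / q) *s (q *s r)" using q by simp
    then have "r \<in> ?S" using base by (metis vec.span_scale)
    then have S: "?S = UNIV" by (intro span_UNIV_trans[OF span]) (use base in auto)
    show ?thesis
      by (rule orbit_by_basis_6[OF bil anti _ _ S])
        (simp_all add: g23_def alg_bilinear alg_anticommutative,
         simp_all add: alg_def axis_nth rules m)
  qed
qed

text \<open>For t = ax + by the product t(tw) is q a^2 + 2mab + n b^2 times \<open>r\<close>. This
  binary quadratic form has an isotropic vector over the complex numbers; used as second generator,
  it makes the last coefficient zero.\<close>

lemma class4_isotropic:
  assumes c4: "class4_basis x y w u v r 0 q m n" and "q \<noteq> 0 \<or> m \<noteq> 0 \<or> n \<noteq> 0"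
  shows "\<mu> \<in> orbit g14 \<union> orbit g23"
proof -
  note table = class4_table[OF c4] and span = class4_span[OF c4]
  note rules = bilin table table[THEN swap]
  show ?thesis
  proof (cases "q = 0")
    case True
    have "vec.span {y, x, - w, - v, - u, - r} = UNIV"
    proof (rule span_UNIV_trans[OF span])
      let ?S = "vec.span {y, x, - w, - v, - u, - r}"
      have "x \<in> ?S" "y \<in> ?S" "- w \<in> ?S" "- v \<in> ?S" "- u \<in> ?S" "- r \<in> ?S"
        by (auto intro: vec.span_base)
      then show "{x, y, w, u, v, r} \<subseteq> ?S" using vec.span_neg by fastforce
    qed
    then have c: "class4_basis y x (- w) (- v) (- u) (- r) 0 n m 0"
      unfolding class4_basis_def using True by (simp add: rules)
    have "n \<noteq> 0 \<or> m \<noteq> 0" using assms(2) True by blast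
    then show ?thesis using class4_g14_g23[OF c] by blast
  next
    case False
    obtain z where z: "q * z^2 + 2 * m * z + n = 0"
      using complex_quadratic_root[OF False, of "2 * m" n] by blast
    define y' where "y' = y + z *s x"
    define v' where "v' = v + z *s u"
    have "vec.span {x, y', w, u, v', r} = UNIV"
    proof (rule span_UNIV_trans[OF span])
      let ?S = "vec.span {x, y', w, u, v', r}"
      have base: "x \<in> ?S" "y' \<in> ?S" "w \<in> ?S" "u \<in> ?S" "v' \<in> ?S" "r \<in> ?S"
        by (auto intro: vec.span_base)
      have "y = y' - z *s x" "v = v' - z *s u" by (simp_all add: y'_def v'_def)
      then have "y \<in> ?S" "v \<in> ?S" using base by (metis vec.span_diff vec.span_scale)+
      then show "{x, y, w, u, v, r} \<subseteq> ?S" using base by auto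
    qed
    moreover have "\<mu> y' v' = (q * z^2 + 2 * m * z + n) *s r"
      by (simp add: y'_def v'_def rules vec_eq_iff algebra_simps power2_eq_square)
    moreover have "\<mu> x v' = (m + z * q) *s r" "\<mu> y' u = (m + z * q) *s r"
      by (simp_all add: y'_def v'_def rules vec_eq_iff algebra_simps)
    ultimately have c: "class4_basis x y' w u v' r 0 q (m + z * q) 0"
      unfolding class4_basis_def by (simp add: z, simp add: y'_def v'_def rules)
    then show ?thesis using class4_g14_g23[OF c] False by blast
  qed
qed

text \<open>For \<open>p \<noteq> 0\<close> the product \<open>x u\<close> can replace
  \<open>v\<close> in the basis.\<close>

lemma class4_class5:
  assumes c4: "class4_basis x y w u v r p q m n" and "p \<noteq> 0"
  shows "class5_basis x y w u (p *s v + q *s r) r (1 / p) (- q / p) (p * m) (p * n)"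
proof -
  note table = class4_table[OF c4] and span = class4_span[OF c4]
  have "vec.span {x, y, w, u, p *s v + q *s r, r} = UNIV"
  proof (rule span_UNIV_trans[OF span])
    let ?S = "vec.span {x, y, w, u, p *s v + q *s r, r}"
    have base: "x \<in> ?S" "y \<in> ?S" "w \<in> ?S" "u \<in> ?S" "p *s v + q *s r \<in> ?S" "r \<in> ?S"
      by (auto intro: vec.span_base)
    have "v = (1 / p) *s ((p *s v + q *s r) - q *s r)" using assms(2) by simp
    then have "v \<in> ?S" using base by (metis vec.span_diff vec.span_scale)
    then show "{x, y, w, u, v, r} \<subseteq> ?S" using base by auto
  qed
  then show ?thesis
    unfolding class5_basis_def using assms(2)
    by (intro conjI) (simp_all add: bilin table table[THEN swap] vec_eq_iff field_simps)
qed

end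

section \<open>The structure of algebras with two generators\<close>

lemma span_union_trans:
  assumes "vec.span (A \<union> L :: (complex ^ 'n::finite) set) = UNIV" "L \<subseteq> vec.span (B \<union> M)"
  shows "vec.span (A \<union> B \<union> M) = UNIV"
proof (rule span_UNIV_trans[OF assms(1)])
  have "vec.span (B \<union> M) \<subseteq> vec.span (A \<union> B \<union> M)" by (rule vec.span_mono) blast
  then show "A \<union> L \<subseteq> vec.span (A \<union> B \<union> M)"
    using assms(2) vec.span_superset[of "A \<union> B \<union> M"] by blast
qed

lemma span_subset_trans:
  assumes "X \<subseteq> vec.span (A \<union> L :: (complex ^ 'n::finite) set)" "L \<subseteq> vec.span (B \<union> M)"
  shows "X \<subseteq> vec.span (A \<union> B \<union> M)"
proof -
  have "vec.span (B \<union> M) \<subseteq> vec.span (A \<union> B \<union> M)" by (rule vec.span_mono) blast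
  then have "vec.span (A \<union> L) \<subseteq> vec.span (A \<union> B \<union> M)"
    by (intro vec.span_minimal) (use assms(2) vec.span_superset[of "A \<union> B \<union> M"] in blast)+
  then show ?thesis using assms(1) by blast
qed

context anticomm_algebra
begin

lemma mult_in_span_gen:
  assumes "\<And>a b. a \<in> A \<Longrightarrow> b \<in> B \<Longrightarrow> \<mu> a b \<in> vec.span S" "x \<in> vec.span A" "y \<in> vec.span B"
  shows "\<mu> x y \<in> vec.span S"
  by (rule mult_in_span_left[OF mult_in_span[OF assms(1) assms(3)] assms(2)])

lemma lcs_Suc_in_span:
  assumes "\<And>a b. a \<in> A \<Longrightarrow> b \<in> B \<Longrightarrow> \<mu> a b \<in> vec.span S" "vec.span A = UNIV" "lcs \<mu> k \<subseteq> vec.span B"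
  shows "lcs \<mu> (Suc k) \<subseteq> vec.span S"
  unfolding lcs.simps
  by (rule vec.span_minimal[OF _ vec.subspace_span]) (use mult_in_span_gen[OF assms(1)] assms(2,3) in blast)

end

context anticomm_algebra_6
begin

context
  fixes x y w u v :: "complex ^ 6"
  assumes mal: "malcev \<mu>" and nil: "nilpotent \<mu>"
    and gen: "vec.span ({x, y} \<union> lcs \<mu> 1) = UNIV"
    and w: "\<mu> x y = w" and u: "\<mu> x w = u" and v: "\<mu> y w = v"
begin

lemma in_lcs: "w \<in> lcs \<mu> 1" "u \<in> lcs \<mu> 2" "v \<in> lcs \<mu> 2"
proof -
  show w1: "w \<in> lcs \<mu> 1" using lcs_mult[of y \<mu> 0 x] by (simp add: w del: lcs.simps(2))
  show "u \<in> lcs \<mu> 2" "v \<in> lcs \<mu> 2"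
    using lcs_mult[OF w1, of x] lcs_mult[OF w1, of y] by (simp_all add: u v numeral_2_eq_2 del: lcs.simps)
qed

lemma xv_yu: "\<mu> x v = \<mu> y u"
  using malcevD(1)[OF mal, of x y] by (simp add: w u v)

text \<open>The relation \<open>xv_yu\<close> read as a Jacobian. Malcev's identity and its variants
  with permuted letters spread this zero to Jacobians that contain \<open>u\<close> or
  \<open>v\<close>; expanding them expresses \<open>w u\<close>, \<open>w v\<close> and
  \<open>u v\<close> through longer words.\<close>

lemma jac_xyw: "jacobian \<mu> x y w = 0"
  using swap[OF v] swap[OF u] swap[of x v "\<mu> x v"] swap[of y u "\<mu> y u"]
  by (simp add: jacobian_def w v bilin xv_yu)

lemma wu: "\<mu> w u = \<mu> x (\<mu> y u) - \<mu> y (\<mu> x u)"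
proof -
  have "jacobian \<mu> x y u = 0"
    using malcevD(2)[OF mal, of x y w] by (simp add: u jac_xyw bilin)
  then show ?thesis
    using swap[of y u "\<mu> y u"] swap[of x u "\<mu> x u"] swap[of x "\<mu> y u" "\<mu> x (\<mu> y u)"]
      swap[of y "\<mu> x u" "\<mu> y (\<mu> x u)"]
    by (simp add: jacobian_def w bilin algebra_simps)
qed

lemma wv: "\<mu> w v = \<mu> x (\<mu> y v) - \<mu> y (\<mu> x v)"
proof -
  have "jacobian \<mu> y x w = 0"
    using swap[OF v] swap[OF u] swap[of x v "\<mu> x v"] swap[of y u "\<mu> y u"] swap[OF w]
    by (simp add: jacobian_def w v u bilin xv_yu)
  then have "jacobian \<mu> y x v = 0"
    using malcevD(2)[OF mal, of y x w] by (simp add: v bilin)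
  then show ?thesis
    using swap[of y v "\<mu> y v"] swap[of x v "\<mu> x v"] swap[of x "\<mu> y v" "\<mu> x (\<mu> y v)"]
      swap[of y "\<mu> x v" "\<mu> y (\<mu> x v)"] swap[OF w]
    by (simp add: jacobian_def bilin algebra_simps)
qed

lemma uv: "\<mu> u v = \<mu> x (\<mu> w v) - \<mu> w (\<mu> x v)"
proof -
  have "jacobian \<mu> w x y = 0" using jac_xyw jacobian_cyclic by metis
  then have "jacobian \<mu> w x (- v) = 0"
    using malcevD(2)[OF mal, of w x y] swap[OF v] by (simp add: bilin)
  then show ?thesis
    using swap[OF u] swap[of w v "\<mu> w v"] swap[of x "\<mu> w v" "\<mu> x (\<mu> w v)"]
      swap[of w "\<mu> x v" "\<mu> w (\<mu> x v)"]
    by (simp add: jacobian_def bilin algebra_simps)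
qed

lemmas lcs_left = lcs_mult_left[OF anti]

lemma lcs_1: "lcs \<mu> 1 \<subseteq> vec.span ({w} \<union> lcs \<mu> 2)"
proof -
  have "\<mu> a b \<in> vec.span ({w} \<union> lcs \<mu> 2)" if "a \<in> {x, y} \<union> lcs \<mu> 1" "b \<in> {x, y} \<union> lcs \<mu> 1" for a b
  proof -
    have "\<mu> a b \<in> {w, - w, 0} \<union> lcs \<mu> 2"
      using that lcs_mult[of b \<mu> 1 a] lcs_left[of a 1 b] swap[OF w]
      by (auto simp: w numeral_2_eq_2 simp del: lcs.simps)
    then show ?thesis
      using vec.span_base[of w "{w} \<union> lcs \<mu> 2"] vec.span_base[of "\<mu> a b" "{w} \<union> lcs \<mu> 2"]
      by (auto intro: vec.span_neg vec.span_zero)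
  qed
  then show ?thesis
    using lcs_Suc_in_span[OF _ gen, of "{x, y} \<union> lcs \<mu> 1" _ 0] gen by simp
qed

lemma gen2: "vec.span ({x, y, w} \<union> lcs \<mu> 2) = UNIV"
  using span_union_trans[OF gen lcs_1] by (simp add: insert_commute Un_commute)

lemma lcs_2: "lcs \<mu> 2 \<subseteq> vec.span ({u, v} \<union> lcs \<mu> 3)"
proof -
  have "\<mu> a b \<in> vec.span ({u, v} \<union> lcs \<mu> 3)" if "a \<in> {x, y, w} \<union> lcs \<mu> 2" "b \<in> {w} \<union> lcs \<mu> 2" for a b
  proof -
    have "\<mu> a b \<in> {u, v, 0} \<union> lcs \<mu> 3"
      using that lcs_mult[of b \<mu> 2 a] lcs_left[of a 2 b]
      by (auto simp: u v numeral_3_eq_3 numeral_2_eq_2 simp del: lcs.simps)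
    then show ?thesis
      using vec.span_base[of "\<mu> a b" "{u, v} \<union> lcs \<mu> 3"] by (auto intro: vec.span_zero)
  qed
  then show ?thesis
    using lcs_Suc_in_span[OF _ gen2 lcs_1] by (simp add: numeral_3_eq_3 numeral_2_eq_2 del: lcs.simps)
qed

lemma gen3: "vec.span ({x, y, w, u, v} \<union> lcs \<mu> 3) = UNIV"
  using span_union_trans[OF gen2 lcs_2] by (simp add: insert_commute Un_commute)

text \<open>\<open>lcs_mult\<close> alone places these products in \<open>lcs \<mu> 3\<close>; the
  formulas \<open>wu\<close>, \<open>wv\<close>, \<open>uv\<close> gain one step. Modulo
  \<open>lcs \<mu> 4\<close> only products of \<open>x\<close>, \<open>y\<close> with
  \<open>u\<close>, \<open>v\<close> then remain.\<close>

lemma deg4: "\<mu> w u \<in> lcs \<mu> 4" "\<mu> w v \<in> lcs \<mu> 4" "\<mu> u v \<in> lcs \<mu> 4"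
proof -
  have L3: "\<mu> a u \<in> lcs \<mu> 3" "\<mu> a v \<in> lcs \<mu> 3" for a
    using lcs_mult[OF in_lcs(2)] lcs_mult[OF in_lcs(3)] by (simp_all add: numeral_3_eq_3 numeral_2_eq_2 del: lcs.simps)
  have L4: "\<mu> a b \<in> lcs \<mu> 4" if "b \<in> lcs \<mu> 3" for a b
    using lcs_mult[OF that] by (simp del: lcs.simps)
  show "\<mu> w u \<in> lcs \<mu> 4" "\<mu> w v \<in> lcs \<mu> 4"
    unfolding wu wv by (intro vec.subspace_diff subspace_lcs L4 L3)+
  then have "\<mu> x (\<mu> w v) \<in> lcs \<mu> 4"
    using lcs_antimono[of 3 4 \<mu>] by (intro L4 L3)
  then show "\<mu> u v \<in> lcs \<mu> 4"
    unfolding uv by (intro vec.subspace_diff subspace_lcs L4 L3)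
qed

lemma lcs_3: "lcs \<mu> 3 \<subseteq> vec.span ({\<mu> x u, \<mu> x v, \<mu> y v} \<union> lcs \<mu> 4)"
proof -
  let ?S = "{\<mu> x u, \<mu> x v, \<mu> y v} \<union> lcs \<mu> 4"
  have "\<mu> a b \<in> vec.span ?S" if "a \<in> {x, y, w, u, v} \<union> lcs \<mu> 3" "b \<in> {u, v} \<union> lcs \<mu> 3" for a b
  proof -
    have "- \<mu> u v \<in> lcs \<mu> 4" by (intro vec.subspace_neg subspace_lcs deg4)
    then have "\<mu> v u \<in> lcs \<mu> 4" using swap[of u v "\<mu> u v"] by simp
    then have "\<mu> a b \<in> ?S \<union> {0}"
      using that lcs_mult[of b \<mu> 3 a] lcs_left[of a 3 b] deg4 xv_yu
      by (auto simp del: lcs.simps)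
    then show ?thesis
      using vec.span_base[of "\<mu> a b" ?S] vec.span_zero[of ?S] by (cases "\<mu> a b = 0") auto
  qed
  then show ?thesis
    using lcs_Suc_in_span[OF _ gen3 lcs_2] by (simp del: lcs.simps)
qed

lemma gen_span_line:
  assumes "lcs \<mu> k = vec.span {r}" "vec.span (A \<union> lcs \<mu> k) = UNIV"
  shows "vec.span (insert r A) = UNIV"
proof (rule span_UNIV_trans[OF assms(2)])
  have "vec.span {r} \<subseteq> vec.span (insert r A)" by (rule vec.span_mono) blast
  then show "A \<union> lcs \<mu> k \<subseteq> vec.span (insert r A)"
    using assms(1) vec.span_superset[of "insert r A"] by blast
qed

lemma line_of_dim_1:
  assumes "vec.dim (lcs \<mu> k) = 1"
  obtains r where "lcs \<mu> k = vec.span {r}"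
proof -
  have "{0} \<subseteq> lcs \<mu> k" using vec.subspace_0[OF subspace_lcs] by blast
  then obtain r where "lcs \<mu> k = vec.span (insert r {0})"
    using span_insert_of_dim[of "{0}" "lcs \<mu> k"] assms subspace_lcs by (auto simp: vec.subspace_single_0)
  then show ?thesis using that by (simp add: insert_commute[of r 0])
qed

text \<open>Independence of \<open>u\<close> and \<open>v\<close> modulo \<open>lcs \<mu> 3\<close>
  leaves at most one dimension for \<open>lcs \<mu> 3\<close>. It is not zero, since otherwise A^2
  would be spanned by \<open>w\<close>, \<open>u\<close>, \<open>v\<close>.\<close>

lemma class4_case:
  assumes dims: "vec.dim (lcs \<mu> 1) \<ge> 4" "vec.dim (lcs \<mu> 2) \<le> 3"
    and indep: "u \<notin> vec.span (insert v (lcs \<mu> 3))" "v \<notin> lcs \<mu> 3"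
  shows "\<exists>r q m n. class4_basis x y w u v r 0 q m n \<and> (q \<noteq> 0 \<or> m \<noteq> 0 \<or> n \<noteq> 0)"
proof -
  have "vec.dim (insert u (insert v (lcs \<mu> 3))) = vec.dim (lcs \<mu> 3) + 2"
    using indep by (simp add: vec.dim_insert del: lcs.simps)
  moreover have "insert u (insert v (lcs \<mu> 3)) \<subseteq> lcs \<mu> 2"
    using in_lcs lcs_antimono[of 2 3 \<mu>] by auto
  ultimately have "vec.dim (lcs \<mu> 3) \<le> 1"
    using vec.dim_subset[of "insert u (insert v (lcs \<mu> 3))" "lcs \<mu> 2"] dims(2) by linarith
  moreover have "vec.dim (lcs \<mu> 3) \<noteq> 0"
  proof
    assume "vec.dim (lcs \<mu> 3) = 0"
    then have "lcs \<mu> 3 \<subseteq> {0}" by (simp only: vec.dim_eq_0)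
    moreover have "lcs \<mu> 1 \<subseteq> vec.span ({w} \<union> {u, v} \<union> lcs \<mu> 3)"
      by (rule span_subset_trans[OF lcs_1 lcs_2])
    ultimately have "lcs \<mu> 1 \<subseteq> vec.span ({w} \<union> {u, v} \<union> {0})"
      using vec.span_mono[of "{w} \<union> {u, v} \<union> lcs \<mu> 3" "{w} \<union> {u, v} \<union> {0}"] by blast
    moreover have "{w} \<union> {u, v} \<union> {0} = insert 0 {w, u, v}" by auto
    ultimately have "lcs \<mu> 1 \<subseteq> vec.span {w, u, v}" by (simp only: vec.span_insert_0)
    then have "vec.dim (lcs \<mu> 1) \<le> card {w, u, v}" by (rule vec.dim_le_card) simp
    then show False using dims(1) card_length[of "[w, u, v]"] by simp
  qed
  ultimately have d3: "vec.dim (lcs \<mu> 3) = 1" by linarith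
  then obtain r where r: "lcs \<mu> 3 = vec.span {r}" by (rule line_of_dim_1)
  have "vec.dim (lcs \<mu> (Suc 3)) = 0"
    using dim_lcs_Suc[OF anti nil, of 3] d3 by simp
  then have "lcs \<mu> (Suc 3) \<subseteq> {0}" by (simp only: vec.dim_eq_0)
  then have z4: "lcs \<mu> 4 \<subseteq> {0}" by (simp del: lcs.simps)
  have r3: "r \<in> lcs \<mu> 3" unfolding r by (rule vec.span_base) simp
  have ar: "\<mu> a r = 0" for a
    using lcs_mult[OF r3, of a] z4 by (auto simp del: lcs.simps)
  have L3: "\<mu> a u \<in> lcs \<mu> 3" "\<mu> a v \<in> lcs \<mu> 3" for a
    using lcs_mult[OF in_lcs(2)] lcs_mult[OF in_lcs(3)] by (simp_all add: numeral_3_eq_3 numeral_2_eq_2 del: lcs.simps)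
  obtain q m n where qmn: "\<mu> x u = q *s r" "\<mu> x v = m *s r" "\<mu> y v = n *s r"
    using L3 unfolding r span1 by metis
  have "vec.span (insert r {x, y, w, u, v}) = UNIV" by (rule gen_span_line[OF r gen3])
  then have "class4_basis x y w u v r 0 q m n"
    unfolding class4_basis_def using w u v qmn ar deg4 z4 xv_yu by (auto simp: insert_commute)
  moreover have "q \<noteq> 0 \<or> m \<noteq> 0 \<or> n \<noteq> 0"
  proof (rule ccontr)
    assume "\<not> ?thesis"
    then have "lcs \<mu> 3 \<subseteq> vec.span ({0} \<union> lcs \<mu> 4)" using lcs_3 by (simp add: qmn)
    then have "lcs \<mu> 3 \<subseteq> vec.span {0}"
      using z4 vec.span_mono[of "{0} \<union> lcs \<mu> 4" "{0}"] by blast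
    then show False using d3 vec.dim_eq_0[of "lcs \<mu> 3"] by simp
  qed
  ultimately show ?thesis by blast
qed

text \<open>With \<open>v\<close> one step deeper, the successive quotients of the series are
  spanned by \<open>w\<close>, \<open>u\<close> and \<open>s\<close> alone, so the dimension of A^2
  forces a fourth step, the line of \<open>r\<close>. Its generation by \<open>x s\<close> and
  \<open>y s\<close> excludes \<open>\<kappa> = \<rho> = 0\<close>.\<close>

lemma class5_case:
  assumes dims: "vec.dim (lcs \<mu> 1) \<ge> 4" "vec.dim (lcs \<mu> 4) \<le> 1" and v3: "v \<in> lcs \<mu> 3"
  shows "\<exists>s r \<alpha> \<beta> \<kappa> \<rho>. class5_basis x y w u s r \<alpha> \<beta> \<kappa> \<rho> \<and> (\<kappa> \<noteq> 0 \<or> \<rho> \<noteq> 0)"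
proof -
  define s where "s = \<mu> x u"
  have L4: "\<mu> a b \<in> lcs \<mu> 4" if "b \<in> lcs \<mu> 3" for a b
    using lcs_mult[OF that] by (simp del: lcs.simps)
  have "lcs \<mu> (Suc 4) \<subseteq> {0}"
    using dim_lcs_Suc[OF anti nil, of 4] dims(2) vec.dim_eq_0[of "lcs \<mu> (Suc 4)"] by linarith
  then have L5: "\<mu> a b = 0" "\<mu> b a = 0" if "b \<in> lcs \<mu> 4" for a b
    using lcs_mult[OF that, of a] lcs_left[OF that, of a] by (auto simp del: lcs.simps)
  have s3: "s \<in> lcs \<mu> 3"
    using lcs_mult[OF in_lcs(2)] by (simp add: s_def numeral_3_eq_3 numeral_2_eq_2 del: lcs.simps)
  have L2: "lcs \<mu> 2 \<subseteq> vec.span ({u} \<union> lcs \<mu> 3)"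
    using lcs_2 v3 by (simp add: insert_absorb)
  have L3: "lcs \<mu> 3 \<subseteq> vec.span ({s} \<union> lcs \<mu> 4)"
    using lcs_3 L4[OF v3] by (simp add: insert_absorb insert_commute s_def)
  have L1: "lcs \<mu> 1 \<subseteq> vec.span ({w} \<union> {u} \<union> {s} \<union> lcs \<mu> 4)"
    by (rule span_subset_trans[OF span_subset_trans[OF lcs_1 L2] L3])
  have "vec.dim (lcs \<mu> 4) \<noteq> 0"
  proof
    assume "vec.dim (lcs \<mu> 4) = 0"
    then have "lcs \<mu> 4 \<subseteq> {0}" by (simp only: vec.dim_eq_0)
    then have "lcs \<mu> 1 \<subseteq> vec.span ({w} \<union> {u} \<union> {s} \<union> {0})"
      using L1 vec.span_mono[of "{w} \<union> {u} \<union> {s} \<union> lcs \<mu> 4" "{w} \<union> {u} \<union> {s} \<union> {0}"] by blast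
    moreover have "{w} \<union> {u} \<union> {s} \<union> {0} = insert 0 {w, u, s}" by auto
    ultimately have "lcs \<mu> 1 \<subseteq> vec.span {w, u, s}" by (simp only: vec.span_insert_0)
    then have "vec.dim (lcs \<mu> 1) \<le> card {w, u, s}" by (rule vec.dim_le_card) simp
    then show False using dims(1) card_length[of "[w, u, s]"] by simp
  qed
  then have d4: "vec.dim (lcs \<mu> 4) = 1" using dims(2) by linarith
  then obtain r where r: "lcs \<mu> 4 = vec.span {r}" by (rule line_of_dim_1)
  have r4: "r \<in> lcs \<mu> 4" unfolding r by (rule vec.span_base) simp
  obtain \<kappa> \<rho> where kr: "\<mu> x s = \<kappa> *s r" "\<mu> y s = \<rho> *s r"
    using L4[OF s3] unfolding r span1 by metis
  have "v \<in> vec.span ({s} \<union> lcs \<mu> 4)" using L3 v3 by blast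
  then have "v \<in> vec.span (insert s (vec.span {r}))" by (simp only: r Un_insert_left Un_empty_left)
  then have "v \<in> vec.span {s, r}" by (simp only: span_insert_span)
  then obtain \<alpha> \<beta> where ab: "v = \<alpha> *s s + \<beta> *s r" unfolding span2 by blast
  have yu: "\<mu> y u = (\<alpha> * \<kappa>) *s r"
    unfolding xv_yu[symmetric] by (simp add: ab bilin kr L5 r4)
  have wu': "\<mu> w u = (- \<rho>) *s r"
    unfolding wu yu by (simp add: bilin L5 r4 kr flip: s_def)
  have jac_xyu: "jacobian \<mu> x y u = 0"
    using malcevD(2)[OF mal, of x y w] by (simp add: u jac_xyw bilin)
  have ws: "\<mu> w s = 0"
  proof -
    have "jacobian \<mu> x y s = 0"
      using malcevD(2)[OF mal, of x y u] by (simp add: jac_xyu bilin flip: s_def)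
    then show ?thesis
      using L5(2)[OF L4[OF s3]] swap[of y s] swap[of x s] by (simp add: jacobian_def w kr bilin L5 r4)
  qed
  have us: "\<mu> u s = 0"
  proof -
    have "\<mu> u x = - s" by (rule swap) (simp add: s_def)
    then have "jacobian \<mu> x w u = 0"
      by (simp add: jacobian_def u wu' bilin L5 r4 swap[OF ws])
    then have "jacobian \<mu> x w s = 0"
      using malcevD(2)[OF mal, of x w u] by (simp add: bilin flip: s_def)
    then show ?thesis
      using swap[OF kr(1)] by (simp add: jacobian_def u ws bilin L5 r4)
  qed
  have S: "vec.span (insert r {x, y, w, u, s}) = UNIV"
  proof (rule gen_span_line[OF r])
    have "vec.span ({x, y, w} \<union> {u} \<union> {s} \<union> lcs \<mu> 4) = UNIV"
      by (rule span_union_trans[OF span_union_trans[OF gen2 L2] L3])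
    then show "vec.span ({x, y, w, u, s} \<union> lcs \<mu> 4) = UNIV" by (simp add: insert_commute)
  qed
  have "class5_basis x y w u s r \<alpha> \<beta> \<kappa> \<rho>"
    unfolding class5_basis_def
    using S w u v kr yu wu' ws us L5(1)[OF r4] ab by (auto simp: insert_commute s_def)
  moreover have "\<kappa> \<noteq> 0 \<or> \<rho> \<noteq> 0"
  proof (rule ccontr)
    assume "\<not> ?thesis"
    then have xs: "\<mu> x s = 0" "\<mu> y s = 0" by (simp_all add: kr)
    have "lcs \<mu> (Suc 3) \<subseteq> vec.span {0}"
    proof (rule lcs_Suc_in_span[OF _ _ L3])
      show "vec.span ({x, y, w, u, s} \<union> lcs \<mu> 4) = UNIV"
        using span_union_trans[OF span_union_trans[OF gen2 L2] L3] by (simp add: insert_commute)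
      show "\<mu> a b \<in> vec.span {0}" if "a \<in> {x, y, w, u, s} \<union> lcs \<mu> 4" "b \<in> {s} \<union> lcs \<mu> 4" for a b
        using that xs ws us L5 by auto
    qed
    then show False using d4 vec.dim_eq_0[of "lcs \<mu> (Suc 3)"] by (simp del: lcs.simps)
  qed
  ultimately show ?thesis by blast
qed

end

text \<open>If A^2 had codimension one, A would be generated by one element x modulo A^2, and xx = 0
  would give A^2 = A^3, against nilpotency.\<close>

lemma dim_lcs_1:
  assumes nil: "nilpotent \<mu>"
  shows "vec.dim (lcs \<mu> 1) \<le> 4"
proof (rule ccontr)
  assume "\<not> ?thesis"
  moreover have "vec.dim (lcs \<mu> 1) \<le> 5" using dim_lcs[OF anti nil, of 1] by simp
  ultimately have d: "vec.dim (lcs \<mu> 1) = 5" by linarith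
  then obtain x where "x \<notin> vec.span (lcs \<mu> 1)" using exists_not_in_span[of "lcs \<mu> 1"] by auto
  then have gen: "vec.span (insert x (lcs \<mu> 1)) = UNIV"
    unfolding span_UNIV_iff_dim using d by (simp add: vec.dim_insert del: lcs.simps)
  have "lcs \<mu> (Suc 0) \<subseteq> vec.span (lcs \<mu> 2)"
  proof (rule lcs_Suc_in_span[OF _ gen])
    show "\<mu> a b \<in> vec.span (lcs \<mu> 2)" if "a \<in> insert x (lcs \<mu> 1)" "b \<in> insert x (lcs \<mu> 1)" for a b
      using that lcs_mult[of b \<mu> 1 a] lcs_mult_left[OF anti, of a 1 b] vec.subspace_0[OF subspace_lcs[of \<mu> 2]]
      by (auto simp: numeral_2_eq_2 simp del: lcs.simps)
  qed (use gen in simp)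
  then have "lcs \<mu> 1 \<subseteq> lcs \<mu> (Suc 1)" by (simp add: numeral_2_eq_2 del: lcs.simps)
  moreover have "lcs \<mu> 1 \<noteq> {0}"
  proof
    assume "lcs \<mu> 1 = {0}"
    then have "vec.dim {0 :: complex ^ 6} = 5" using d by (simp only:)
    then show False by (simp add: vec.dim_singleton)
  qed
  ultimately show False using lcs_psubset[OF anti nil, of 1] by blast
qed

theorem two_generated_cases:
  assumes mal: "malcev \<mu>" and nil: "nilpotent \<mu>" and "\<not> small_square \<mu>"
  shows "(\<exists>x y w u s r \<alpha> \<beta> \<kappa> \<rho>. class5_basis x y w u s r \<alpha> \<beta> \<kappa> \<rho> \<and> (\<kappa> \<noteq> 0 \<or> \<rho> \<noteq> 0)) \<or>
    (\<exists>x y w u v r q m n. class4_basis x y w u v r 0 q m n \<and> (q \<noteq> 0 \<or> m \<noteq> 0 \<or> n \<noteq> 0))"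
proof -
  have d1: "vec.dim (lcs \<mu> 1) = 4"
    using assms(3) dim_lcs_1[OF nil] by (simp add: small_square_def del: lcs.simps)
  have "vec.dim (lcs \<mu> (Suc 1)) \<le> 3" "vec.dim (lcs \<mu> (Suc (Suc (Suc 1)))) \<le> 1"
    using dim_lcs_Suc[OF anti nil, of 1] dim_lcs_Suc[OF anti nil, of "Suc 1"]
      dim_lcs_Suc[OF anti nil, of "Suc (Suc 1)"] d1 by linarith+
  then have d24: "vec.dim (lcs \<mu> 2) \<le> 3" "vec.dim (lcs \<mu> 4) \<le> 1"
    by (simp_all add: numeral_eq_Suc del: lcs.simps)
  obtain x where "x \<notin> vec.span (lcs \<mu> 1)" using exists_not_in_span[of "lcs \<mu> 1"] d1 by auto
  then have d5: "vec.dim (insert x (lcs \<mu> 1)) = 5" using d1 by (simp add: vec.dim_insert del: lcs.simps)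
  then obtain y where "y \<notin> vec.span (insert x (lcs \<mu> 1))"
    using exists_not_in_span[of "insert x (lcs \<mu> 1)"] by auto
  then have "vec.dim (insert y (insert x (lcs \<mu> 1))) = 6"
    using d5 by (simp add: vec.dim_insert[of y] del: lcs.simps)
  then have gen: "vec.span ({x, y} \<union> lcs \<mu> 1) = UNIV"
    by (simp add: span_UNIV_iff_dim insert_commute del: lcs.simps)
  have five: ?thesis if "vec.span ({a, b} \<union> lcs \<mu> 1) = UNIV" "\<mu> b (\<mu> a b) \<in> lcs \<mu> 3" for a b
    using class5_case[OF mal nil that(1) refl refl refl _ d24(2) that(2)] d1 by simp metis
  define w where "w = \<mu> x y"
  have swp: "\<mu> y x = - w" by (rule swap) (simp add: w_def)
  show ?thesis
  proof (cases "\<mu> y w \<in> lcs \<mu> 3")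
    case True
    then show ?thesis using five[OF gen] by (simp add: w_def)
  next
    case v: False
    show ?thesis
    proof (cases "\<mu> x w \<in> vec.span (insert (\<mu> y w) (lcs \<mu> 3))")
      case False
      show ?thesis
        using class4_case[OF mal nil gen refl refl refl _ d24(1)] False v d1 by (simp add: w_def) metis
    next
      case True
      then obtain k where k: "\<mu> x w - k *s \<mu> y w \<in> lcs \<mu> 3"
        by (auto simp: vec.span_insert simp del: lcs.simps)
      \<comment> \<open>The remaining case is reduced to class 5 by new generators \<open>y\<close>,
        \<open>b\<close>: since \<open>y b = - w\<close>, the word \<open>b (y b)\<close> is minus
        the element that \<open>k\<close> moved into \<open>lcs \<mu> 3\<close>.\<close>
      define b where "b = x - k *s y"
      have "vec.span ({y, b} \<union> lcs \<mu> 1) = UNIV"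
      proof (rule span_UNIV_trans[OF gen])
        let ?S = "vec.span ({y, b} \<union> lcs \<mu> 1)"
        have "y \<in> ?S" "b \<in> ?S" by (auto intro: vec.span_base)
        moreover have "x = b + k *s y" by (simp add: b_def)
        ultimately have "x \<in> ?S" by (metis vec.span_add vec.span_scale)
        then show "{x, y} \<union> lcs \<mu> 1 \<subseteq> ?S" using \<open>y \<in> ?S\<close> vec.span_superset[of "{y, b} \<union> lcs \<mu> 1"] by blast
      qed
      moreover have "\<mu> b (\<mu> y b) = - (\<mu> x w - k *s \<mu> y w)"
        by (simp add: b_def bilin swp)
      then have "\<mu> b (\<mu> y b) \<in> lcs \<mu> 3"
        using vec.subspace_neg[OF subspace_lcs k] by simp
      ultimately show ?thesis by (rule five)
    qed
  qed
qed

end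

section \<open>Degenerations of \<open>g6\<close>\<close>

lemma g6_bilinear: "g6 \<in> bilinear_maps"
  by (simp add: g6_def alg_bilinear)

lemma orbit_subset_closure: "\<rho> \<in> bilinear_maps \<Longrightarrow> orbit \<rho> \<subseteq> zariski closure_of (orbit \<rho>)"
  by (rule closure_of_subset) (use orbit_bilinear in auto)

definition class5_alg :: "complex \<Rightarrow> complex \<Rightarrow> complex \<Rightarrow> complex \<Rightarrow> 6 multiplication" where
  "class5_alg \<alpha> \<beta> \<kappa> \<rho> =
    alg [(1, 2, e 3), (1, 3, e 4), (1, 4, e 5), (1, 5, \<kappa> *s e 6), (2, 3, \<alpha> *s e 5 + \<beta> *s e 6),
      (2, 4, (\<alpha> * \<kappa>) *s e 6), (2, 5, \<rho> *s e 6), (3, 4, (- \<rho>) *s e 6)]"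

definition class4_alg :: "complex \<Rightarrow> complex \<Rightarrow> complex \<Rightarrow> complex \<Rightarrow> 6 multiplication" where
  "class4_alg p q m n =
    alg [(1, 2, e 3), (1, 3, e 4), (2, 3, e 5), (1, 4, p *s e 5 + q *s e 6), (1, 5, m *s e 6),
      (2, 4, m *s e 6), (2, 5, n *s e 6), (3, 4, (- (p * n)) *s e 6)]"

lemma tendsto_shift: "((\<lambda>t. c + t) \<longlongrightarrow> c) (at (0 :: complex))"
  using tendsto_add[OF tendsto_const[of c] tendsto_ident_at[of 0 UNIV]] by simp

lemma class5_alg_tendsto:
  assumes "(\<alpha> \<longlongrightarrow> \<alpha>') F" "(\<rho> \<longlongrightarrow> \<rho>') F"
  shows "((\<lambda>t. class5_alg (\<alpha> t) \<beta> \<kappa> (\<rho> t) x y $ k) \<longlongrightarrow> class5_alg \<alpha>' \<beta> \<kappa> \<rho>' x y $ k) F"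
  unfolding class5_alg_def alg_def by (simp, intro tendsto_intros assms)

lemma class4_alg_tendsto:
  assumes "(p \<longlongrightarrow> p') F" "(n \<longlongrightarrow> n') F"
  shows "((\<lambda>t. class4_alg (p t) q m (n t) x y $ k) \<longlongrightarrow> class4_alg p' q m n' x y $ k) F"
  unfolding class4_alg_def alg_def by (simp, intro tendsto_intros assms)

text \<open>Shifting \<alpha> and \<rho> off zero satisfies the two conditions of
  \<open>class5_g6\<close>.\<close>

lemma class5_alg_in_closure: "class5_alg \<alpha> \<beta> \<kappa> \<rho> \<in> zariski closure_of (orbit g6)"
proof (rule closedin_zariski_limit[where F = "\<lambda>t. class5_alg (\<alpha> + t) \<beta> \<kappa> (\<rho> + t)"])
  show "class5_alg \<alpha> \<beta> \<kappa> \<rho> \<in> bilinear_maps" by (simp add: class5_alg_def alg_bilinear)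
  show "\<forall>\<^sub>F t in at 0. class5_alg (\<alpha> + t) \<beta> \<kappa> (\<rho> + t) \<in> zariski closure_of (orbit g6)"
    using eventually_shift_neq_0[of \<alpha>] eventually_shift_neq_0[of \<rho>]
  proof eventually_elim
    case (elim t)
    interpret anticomm_algebra_6 "class5_alg (\<alpha> + t) \<beta> \<kappa> (\<rho> + t)"
      unfolding class5_alg_def by (rule alg_algebra_6)
    have "class5_basis (e 1) (e 2) (e 3) (e 4) (e 5) (e 6) (\<alpha> + t) \<beta> \<kappa> (\<rho> + t)"
      unfolding class5_basis_def by (simp add: span_e) (simp add: class5_alg_def alg_def axis_nth)
    then show ?case
      using class5_g6 elim orbit_subset_closure[OF g6_bilinear] by blast
  qed
  show "((\<lambda>t. class5_alg (\<alpha> + t) \<beta> \<kappa> (\<rho> + t) (e i) (e j) $ k) \<longlongrightarrow> class5_alg \<alpha> \<beta> \<kappa> \<rho> (e i) (e j) $ k) (at 0)"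
    for i j k
    by (intro class5_alg_tendsto tendsto_shift)
qed simp

text \<open>Switching on \<open>p = t\<close> and shifting \<open>n\<close> gives a class 5 table
  with \<alpha> = 1/t and \<rho> = t(n + t), both nonzero for small t. As \<alpha> diverges, the
  limit is taken in the class 4 basis.\<close>

lemma class4_alg_in_closure: "class4_alg 0 q m n \<in> zariski closure_of (orbit g6)"
proof (rule closedin_zariski_limit[where F = "\<lambda>t. class4_alg (0 + t) q m (n + t)"])
  show "class4_alg 0 q m n \<in> bilinear_maps" by (simp add: class4_alg_def alg_bilinear)
  show "\<forall>\<^sub>F t in at 0. class4_alg (0 + t) q m (n + t) \<in> zariski closure_of (orbit g6)"
    using eventually_shift_neq_0[of 0] eventually_shift_neq_0[of n]
  proof eventually_elim
    case (elim t)
    interpret anticomm_algebra_6 "class4_alg (0 + t) q m (n + t)"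
      unfolding class4_alg_def by (rule alg_algebra_6)
    have "class4_basis (e 1) (e 2) (e 3) (e 4) (e 5) (e 6) (0 + t) q m (n + t)"
      unfolding class4_basis_def by (simp add: span_e) (simp add: class4_alg_def alg_def axis_nth)
    from class5_g6[OF class4_class5[OF this]] show ?case
      using elim orbit_subset_closure[OF g6_bilinear] by auto
  qed
  show "((\<lambda>t. class4_alg (0 + t) q m (n + t) (e i) (e j) $ k) \<longlongrightarrow> class4_alg 0 q m n (e i) (e j) $ k) (at 0)"
    for i j k
    by (intro class4_alg_tendsto tendsto_shift)
qed simp

context anticomm_algebra_6
begin

lemma class5_in_closure:
  assumes "class5_basis x y w u s r \<alpha> \<beta> \<kappa> \<rho>"
  shows "\<mu> \<in> zariski closure_of (orbit g6)"
proof -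
  have span: "vec.span {x, y, w, u, s, r} = UNIV" using assms by (simp add: class5_basis_def)
  have "\<mu> \<in> orbit (class5_alg \<alpha> \<beta> \<kappa> \<rho>)"
    by (rule orbit_by_basis_6[OF bil anti _ _ span])
      (use assms in \<open>simp_all add: class5_alg_def alg_bilinear alg_anticommutative class5_basis_def\<close>,
       simp_all add: alg_def axis_nth)
  then show ?thesis
    using closure_orbit_orbit[OF g6_bilinear class5_alg_in_closure] by blast
qed

lemma class4_in_closure:
  assumes "class4_basis x y w u v r 0 q m n"
  shows "\<mu> \<in> zariski closure_of (orbit g6)"
proof -
  have span: "vec.span {x, y, w, u, v, r} = UNIV" using assms by (simp add: class4_basis_def)
  have "\<mu> \<in> orbit (class4_alg 0 q m n)"
    by (rule orbit_by_basis_6[OF bil anti _ _ span])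
      (use assms in \<open>simp_all add: class4_alg_def alg_bilinear alg_anticommutative class4_basis_def\<close>,
       simp_all add: alg_def axis_nth)
  then show ?thesis
    using closure_orbit_orbit[OF g6_bilinear class4_alg_in_closure] by blast
qed

lemma class5_classification:
  assumes "class5_basis x y w u s r \<alpha> \<beta> \<kappa> \<rho>" "\<kappa> \<noteq> 0 \<or> \<rho> \<noteq> 0"
  shows "\<mu> \<in> orbit g6 \<union> orbit g5 \<union> orbit g8 \<union> orbit g7 \<union> orbit g9"
proof (cases "\<rho> = 0")
  case True
  then have "\<mu> \<in> orbit g5 \<union> orbit g7 \<union> orbit g9"
    using class5_g5[of x y w u s r \<alpha> \<beta> \<kappa>] class5_g7[of x y w u s r \<alpha> \<beta> \<kappa>] class5_g9[of x y w u s r \<alpha> \<beta> \<kappa>]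
      assms by blast
  then show ?thesis by blast
next
  case False
  then have "\<mu> \<in> orbit g6 \<union> orbit g8"
    using class5_g6[OF assms(1)] class5_g8[of x y w u s r \<beta> \<kappa> \<rho>] assms(1) by blast
  then show ?thesis by blast
qed

end

text \<open>Adding the product \<open>e1 e4 = t e2\<close> to \<open>M6 1\<close> gives an algebra generated by \<open>e1\<close> and \<open>e4\<close>.\<close>

lemma M6_1_in_closure: "M6 1 \<in> zariski closure_of (orbit g6)"
proof -
  let ?F = "\<lambda>t. alg [(1, 2, e 3), (1, 3, e 5), (1, 5, e 6), (2, 4, e 5), (3, 4, e 6), (1, 4, t *s e 2)]"
  show ?thesis
  proof (rule closedin_zariski_limit[where F = "\<lambda>t. ?F (0 + t)"])
    show "M6 1 \<in> bilinear_maps" by (rule M6_bilinear)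
    show "\<forall>\<^sub>F t in at 0. ?F (0 + t) \<in> zariski closure_of (orbit g6)"
      using eventually_shift_neq_0[of 0]
    proof eventually_elim
      case (elim t)
      then have t: "t \<noteq> 0" by simp
      interpret anticomm_algebra_6 "?F (0 + t)" by (rule alg_algebra_6)
      let ?S = "vec.span {e 1, e 4, t *s e 2, t *s e 3, t *s e 5, e 6}"
      have base: "e 1 \<in> ?S" "e 4 \<in> ?S" "t *s e 2 \<in> ?S" "t *s e 3 \<in> ?S" "t *s e 5 \<in> ?S" "e 6 \<in> ?S"
        by (auto intro: vec.span_base)
      have "e i = (1 / t) *s (t *s e i)" for i using t by simp
      then have "e 2 \<in> ?S" "e 3 \<in> ?S" "e 5 \<in> ?S" using base by (metis vec.span_scale)+
      then have S: "?S = UNIV" by (intro span_UNIV_trans[OF span_e]) (use base in auto)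
      \<comment> \<open>The constants are \<alpha> = -1, \<kappa> = t and \<rho> = 0, so the
        approximating algebras are copies of \<open>g5\<close>, themselves limits of copies of
        \<open>g6\<close>.\<close>
      have "class5_basis (e 1) (e 4) (t *s e 2) (t *s e 3) (t *s e 5) (e 6) (- 1) 0 t 0"
        unfolding class5_basis_def
        by (intro conjI S) (simp_all add: bilin, simp_all add: alg_def axis_nth)
      then show ?case by (rule class5_in_closure)
    qed
    show "((\<lambda>t. ?F (0 + t) (e i) (e j) $ k) \<longlongrightarrow> M6 1 (e i) (e j) $ k) (at 0)" for i j k
    proof -
      have "((\<lambda>t. ?F (p t) (e i) (e j) $ k) \<longlongrightarrow> ?F q (e i) (e j) $ k) (at 0)" if "(p \<longlongrightarrow> q) (at 0)" for p q
        unfolding alg_def using that by (simp, intro tendsto_intros)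
      moreover have "M6 1 a b = ?F 0 a b" for a b by (simp add: M6_def alg_def)
      ultimately show ?thesis using tendsto_shift[of 0] by (simp only:)
    qed
  qed simp
qed

section \<open>The algebras of the table\<close>

lemma nilpotent_triangular:
  fixes \<mu> :: "6 multiplication"
  assumes "\<mu> \<in> bilinear_maps" "anticommutative \<mu>"
    and "\<And>x y. \<mu> x y $ 1 = 0" "\<And>x y. \<mu> x y $ 2 = 0"
    and "\<And>x y. y $ 1 = 0 \<Longrightarrow> y $ 2 = 0 \<Longrightarrow> \<mu> x y $ 3 = 0"
    and "\<And>x y. y $ 1 = 0 \<Longrightarrow> y $ 2 = 0 \<Longrightarrow> y $ 3 = 0 \<Longrightarrow> \<mu> x y $ 4 = 0"
    and "\<And>x y. y $ 1 = 0 \<Longrightarrow> y $ 2 = 0 \<Longrightarrow> y $ 3 = 0 \<Longrightarrow> y $ 4 = 0 \<Longrightarrow> \<mu> x y $ 5 = 0"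
    and "\<And>x y. y $ 1 = 0 \<Longrightarrow> y $ 2 = 0 \<Longrightarrow> y $ 3 = 0 \<Longrightarrow> y $ 4 = 0 \<Longrightarrow> y $ 5 = 0 \<Longrightarrow> \<mu> x y $ 6 = 0"
  shows "nilpotent \<mu>"
  unfolding nilpotent_iff_foldr[OF assms(1,2)]
proof (intro allI impI)
  fix xs :: "(complex ^ 6) list" and x :: "complex ^ 6"
  assume "length xs = CARD(6)"
  then obtain a b c d f g where "xs = [a, b, c, d, f, g]"
    by (auto simp: numeral_eq_Suc length_Suc_conv)
  then show "foldr \<mu> xs x = 0"
    by (simp add: vec_eq_iff forall_6 assms(3-8))
qed

lemma NLie_g6: "g6 \<in> NLie"
proof -
  have "jacobian g6 x y z = 0" for x y z
    unfolding vec_eq_iff forall_6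
    by (simp add: jacobian_def g6_def alg_def axis_nth algebra_simps)
  moreover have "nilpotent g6"
    unfolding g6_def by (rule nilpotent_triangular)
      (simp_all add: alg_bilinear alg_anticommutative, simp_all add: alg_def axis_nth)
  ultimately show ?thesis
    by (simp add: NLie_iff lie_def g6_def alg_bilinear alg_anticommutative)
qed

lemma M6_nth:
  "M6 \<epsilon> x y $ 1 = 0" "M6 \<epsilon> x y $ 2 = 0" "M6 \<epsilon> x y $ 3 = x $ 1 * y $ 2 - x $ 2 * y $ 1" "M6 \<epsilon> x y $ 4 = 0"
  "M6 \<epsilon> x y $ 5 = x $ 1 * y $ 3 - x $ 3 * y $ 1 + \<epsilon> * (x $ 2 * y $ 4 - x $ 4 * y $ 2)"
  "M6 \<epsilon> x y $ 6 = x $ 1 * y $ 5 - x $ 5 * y $ 1 + (x $ 3 * y $ 4 - x $ 4 * y $ 3)"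
  by (simp_all add: M6_def alg_def axis_nth algebra_simps)

lemma NMal_M6: "M6 \<epsilon> \<in> NMal"
proof -
  have "jacobian (M6 \<epsilon>) x y (M6 \<epsilon> x z) = M6 \<epsilon> (jacobian (M6 \<epsilon>) x y z) x" for x y z
    unfolding vec_eq_iff forall_6 by (simp add: jacobian_def M6_nth algebra_simps)
  moreover have "nilpotent (M6 \<epsilon>)"
    by (rule nilpotent_triangular) (simp_all add: M6_nth, simp_all add: M6_def alg_bilinear alg_anticommutative)
  ultimately show ?thesis
    by (simp add: NMal_iff malcev_def M6_def alg_bilinear alg_anticommutative)
qed

lemma not_lie_M6_0: "M6 0 \<notin> NLie"
proof
  assume "M6 0 \<in> NLie"
  then have "jacobian (M6 0) (e 1) (e 2) (e 4) $ 6 = 0" by (simp add: NLie_iff lie_def)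
  then show False by (simp add: jacobian_def M6_nth axis_nth)
qed

text \<open>The parameter \<open>\<epsilon>\<close> is determined by the identity \<open>(1 - \<epsilon>) x(yz) = \<epsilon> J(x,y,z)\<close> for
  \<open>y\<close> and \<open>z\<close> annihilating the third power of the algebra.\<close>

lemma M6_orbit_inj:
  assumes "M6 \<delta> \<in> orbit (M6 \<epsilon>)"
  shows "\<delta> = \<epsilon>"
proof -
  obtain f where f: "Vector_Spaces.linear (*s) (*s) f" "bij f"
    "\<And>x y. f (M6 \<delta> x y) = M6 \<epsilon> (f x) (f y)"
    using orbit_sym[OF assms] unfolding orbit_iff by blast
  \<comment> \<open>The \<open>e 6\<close>-component of \<open>y e 5\<close> is
    \<open>y $ 1\<close>; thus this coordinate vanishes on the annihilator of the third power, a
    subspace that isomorphisms respect.\<close>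
  have M: "y $ 1 = 0" if "\<And>a b c. M6 \<epsilon> y (M6 \<epsilon> a (M6 \<epsilon> b c)) = 0" for y
  proof -
    have "M6 \<epsilon> y (M6 \<epsilon> (e 1) (M6 \<epsilon> (e 1) (e 2))) $ 6 = 0" using that by simp
    then show ?thesis by (simp add: M6_nth axis_nth)
  qed
  have fM: "f y $ 1 = 0" if "\<And>a b c. M6 \<delta> y (M6 \<delta> a (M6 \<delta> b c)) = 0" for y
  proof (rule M)
    fix a b c
    obtain a' b' c' where "a = f a'" "b = f b'" "c = f c'" using f(2) by (metis bij_pointE)
    then show "M6 \<epsilon> (f y) (M6 \<epsilon> a (M6 \<epsilon> b c)) = 0"
      using that[of a' b' c'] vec.linear_0[OF f(1)] by (simp flip: f(3))
  qed
  have 2: "f (e 2) $ 1 = 0" and 4: "f (e 4) $ 1 = 0"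
    by (rule fM, simp add: vec_eq_iff forall_6 M6_nth axis_nth)+
  have id: "(1 - \<epsilon>) *s M6 \<epsilon> x (M6 \<epsilon> y z) = \<epsilon> *s jacobian (M6 \<epsilon>) x y z" if "y $ 1 = 0" "z $ 1 = 0" for x y z
    unfolding vec_eq_iff forall_6 using that by (simp add: jacobian_def M6_nth algebra_simps)
  have "f ((1 - \<epsilon>) *s M6 \<delta> (e 1) (M6 \<delta> (e 2) (e 4))) = f (\<epsilon> *s jacobian (M6 \<delta>) (e 1) (e 2) (e 4))"
    using id[OF 2 4, of "f (e 1)"]
    by (simp only: vec.linear_scale[OF f(1)] iso_jacobian[where \<mu> = "M6 \<delta>" and \<nu> = "M6 \<epsilon>", OF f] f(3))
  then have "(1 - \<epsilon>) *s M6 \<delta> (e 1) (M6 \<delta> (e 2) (e 4)) = \<epsilon> *s jacobian (M6 \<delta>) (e 1) (e 2) (e 4)"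
    by (rule injD[OF bij_is_inj[OF f(2)]])
  \<comment> \<open>The \<open>e 6\<close>-components are \<delta> for \<open>e 1 (e 2 e 4)\<close>
    and 1 - \<delta> for the Jacobian, whence (1 - \<epsilon>)\<delta> = \<epsilon>(1 -
    \<delta>).\<close>
  then have "((1 - \<epsilon>) *s M6 \<delta> (e 1) (M6 \<delta> (e 2) (e 4))) $ 6 = (\<epsilon> *s jacobian (M6 \<delta>) (e 1) (e 2) (e 4)) $ 6"
    by simp
  then show ?thesis by (simp add: jacobian_def M6_nth axis_nth algebra_simps)
qed

lemma det_vec6:
  fixes a b c d f g :: "complex ^ 6"
  shows "det (\<chi> i. vec6 a b c d f g i) \<noteq> 0 \<longleftrightarrow> vec.span {a, b, c, d, f, g} = UNIV"
proof -
  have "rows (\<chi> i. vec6 a b c d f g i) = range (vec6 a b c d f g)"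
    unfolding rows_def row_def by (auto simp: vec_lambda_eta)
  then show ?thesis
    using matrix_left_invertible_span_rows_gen[of "\<chi> i. vec6 a b c d f g i"]
    by (simp add: range_vec6 invertible_left_inverse flip: invertible_det_nz)
qed

lemma regular_det_vec6:
  assumes "polymap a" "polymap b" "polymap c" "polymap d" "polymap f" "polymap g"
  shows "regular (\<lambda>\<mu>. det (\<chi> i. vec6 (a \<mu>) (b \<mu>) (c \<mu>) (d \<mu>) (f \<mu>) (g \<mu>) i))"
proof (rule regular_det)
  show "regular (\<lambda>\<mu>. (\<chi> i. vec6 (a \<mu>) (b \<mu>) (c \<mu>) (d \<mu>) (f \<mu>) (g \<mu>) i) $ i $ j)" for i j
    by (cases "i = 1"; cases "i = 2"; cases "i = 3"; cases "i = 4"; cases "i = 5")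
      (simp_all add: vec6_def assms[THEN regular_nth])
qed

text \<open>The first determinants use the words that span an algebra of class 5 for suitable
  \<open>x\<close>, \<open>y\<close>, the second those that do so in class 4. Four of the six rows
  lie in A^2.\<close>

definition not_two_generated :: "6 multiplication set" where
  "not_two_generated = {\<mu> \<in> bilinear_maps. \<forall>h\<in>
     {\<lambda>\<mu>. det (\<chi> i. vec6 x y (\<mu> x y) (\<mu> x (\<mu> x y)) (\<mu> x (\<mu> x (\<mu> x y))) (\<mu> x (\<mu> x (\<mu> x (\<mu> x y)))) i) | x y. True} \<union>
     {\<lambda>\<mu>. det (\<chi> i. vec6 x y (\<mu> x y) (\<mu> x (\<mu> x y)) (\<mu> y (\<mu> x y)) (\<mu> x (\<mu> x (\<mu> x y))) i) | x y. True}. h \<mu> = 0}"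

lemma closedin_not_two_generated: "closedin zariski not_two_generated"
  unfolding not_two_generated_def
  by (rule closedin_regular) (auto intro!: regular_det_vec6 polymap_intros)

lemma not_two_generated_iff:
  "\<mu> \<in> not_two_generated \<longleftrightarrow> \<mu> \<in> bilinear_maps \<and>
    (\<forall>x y. vec.span {x, y, \<mu> x y, \<mu> x (\<mu> x y), \<mu> x (\<mu> x (\<mu> x y)), \<mu> x (\<mu> x (\<mu> x (\<mu> x y)))} \<noteq> UNIV \<and>
      vec.span {x, y, \<mu> x y, \<mu> x (\<mu> x y), \<mu> y (\<mu> x y), \<mu> x (\<mu> x (\<mu> x y))} \<noteq> UNIV)"
proof -
  have ball: "(\<forall>h\<in>{\<lambda>\<mu>. F x y \<mu> | x y. True}. h \<mu> = 0) \<longleftrightarrow> (\<forall>x y. F x y \<mu> = 0)"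
    for F :: "complex ^ 6 \<Rightarrow> complex ^ 6 \<Rightarrow> 6 multiplication \<Rightarrow> complex"
    by blast
  have det: "vec.span {a, b, c, d, f, g} \<noteq> UNIV \<longleftrightarrow> det (\<chi> i. vec6 a b c d f g i) = 0"
    for a b c d f g :: "complex ^ 6"
    using det_vec6 by blast
  show ?thesis
    unfolding not_two_generated_def mem_Collect_eq ball_Un ball det by blast
qed

lemma M6_orbit_products:
  assumes "\<mu> \<in> orbit (M6 \<epsilon>)"
  obtains a b c where "\<And>x y. \<mu> x y \<in> vec.span {a, b, c}"
proof -
  obtain f where f: "Vector_Spaces.linear (*s) (*s) f" "bij f" "\<And>x y. f (M6 \<epsilon> x y) = \<mu> (f x) (f y)"
    using assms unfolding orbit_iff by blast
  have "\<mu> x y \<in> vec.span {f (e 3), f (e 5), f (e 6)}" for x y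
  proof -
    obtain x' y' where xy: "x = f x'" "y = f y'" using f(2) by (metis bij_pointE)
    have "M6 \<epsilon> x' y' = M6 \<epsilon> x' y' $ 3 *s e 3 + M6 \<epsilon> x' y' $ 5 *s e 5 + M6 \<epsilon> x' y' $ 6 *s e 6"
      by (simp add: vec_eq_iff forall_6 M6_nth axis_nth)
    then have "\<mu> x y = M6 \<epsilon> x' y' $ 3 *s f (e 3) + M6 \<epsilon> x' y' $ 5 *s f (e 5) + M6 \<epsilon> x' y' $ 6 *s f (e 6)"
      using f(1) unfolding xy f(3)[symmetric] linear_cart_iff by metis
    then show ?thesis unfolding span3 by blast
  qed
  then show ?thesis by (rule that)
qed

lemma M6_orbits_not_two_generated: "M6_orbits \<subseteq> not_two_generated"
proof
  fix \<mu> assume \<mu>: "\<mu> \<in> M6_orbits"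
  then obtain \<epsilon> where "\<mu> \<in> orbit (M6 \<epsilon>)" by blast
  then obtain a b c where p: "\<And>x y. \<mu> x y \<in> vec.span {a, b, c}" using M6_orbit_products by metis
  have "vec.span {x, y, p, q, r, s} \<noteq> UNIV" if "{p, q, r, s} \<subseteq> vec.span {a, b, c}" for x y p q r s
  proof -
    have "vec.span {a, b, c} \<subseteq> vec.span {x, y, a, b, c}" by (rule vec.span_mono) auto
    then have "{x, y, p, q, r, s} \<subseteq> vec.span {x, y, a, b, c}"
      using that vec.span_superset[of "{x, y, a, b, c}"] by auto
    then have "vec.dim {x, y, p, q, r, s} \<le> card {x, y, a, b, c}"
      by (rule vec.dim_le_card) simp
    then have "vec.dim {x, y, p, q, r, s} \<le> 5"
      using card_length[of "[x, y, a, b, c]"] by simp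
    then show ?thesis by (simp add: span_UNIV_iff_dim)
  qed
  moreover have "\<mu> \<in> bilinear_maps" using \<mu> M6_orbits_bilinear by blast
  ultimately show "\<mu> \<in> not_two_generated"
    using p unfolding not_two_generated_iff by auto
qed

lemma closure_not_two_generated: "zariski closure_of M6_orbits \<subseteq> not_two_generated"
  by (rule closure_of_minimal[OF M6_orbits_not_two_generated closedin_not_two_generated])

lemma span_e_intro:
  assumes "e 1 \<in> vec.span S" "e 2 \<in> vec.span S" "e 3 \<in> vec.span S" "e 4 \<in> vec.span S" "e 5 \<in> vec.span S" "e 6 \<in> vec.span S"
  shows "vec.span S = UNIV"
  by (rule span_UNIV_trans[OF span_e]) (use assms in auto)

lemma g_two_generated:
  assumes "\<mu> \<in> {g5, g6, g7, g8, g9, g14, g23}"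
  shows "\<mu> \<notin> not_two_generated"
proof
  assume "\<mu> \<in> not_two_generated"
  then have class5: "vec.span {x, y, \<mu> x y, \<mu> x (\<mu> x y), \<mu> x (\<mu> x (\<mu> x y)), \<mu> x (\<mu> x (\<mu> x (\<mu> x y)))} \<noteq> UNIV"
    and class4: "vec.span {x, y, \<mu> x y, \<mu> x (\<mu> x y), \<mu> y (\<mu> x y), \<mu> x (\<mu> x (\<mu> x y))} \<noteq> UNIV" for x y
    unfolding not_two_generated_iff by auto
  \<comment> \<open>In \<open>g6\<close> and \<open>g8\<close> the vector \<open>e 1\<close>
    annihilates \<open>e 5\<close>, and in \<open>g14\<close> it annihilates \<open>e 4\<close>;
    adding \<open>e 2\<close> keeps the chain of products alive.\<close>
  let ?x = "e 1 + e 2"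
  consider "\<mu> \<in> {g5, g7, g9}" | "\<mu> = g6" | "\<mu> = g8" | "\<mu> = g14" | "\<mu> = g23" using assms by blast
  then show False
  proof cases
    case 1
    then have "\<mu> (e 1) (e 2) = e 3" "\<mu> (e 1) (e 3) = e 4" "\<mu> (e 1) (e 4) = e 5" "\<mu> (e 1) (e 5) = e 6"
      by (auto simp: g5_def g7_def g9_def alg_def axis_nth)
    then show False using class5[of "e 1" "e 2"] span_e by simp
  next
    case 2
    have t: "\<mu> ?x (e 2) = e 3" "\<mu> ?x (e 3) = e 4 + e 5" "\<mu> ?x (e 4 + e 5) = e 5 + e 6" "\<mu> ?x (e 5 + e 6) = e 6"
      unfolding vec_eq_iff forall_6 by (simp_all add: 2 g6_def alg_def axis_nth)
    let ?S = "vec.span {?x, e 2, e 3, e 4 + e 5, e 5 + e 6, e 6}"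
    have b: "?x \<in> ?S" "e 2 \<in> ?S" "e 3 \<in> ?S" "e 4 + e 5 \<in> ?S" "e 5 + e 6 \<in> ?S" "e 6 \<in> ?S"
      by (auto intro: vec.span_base)
    have "e 1 \<in> ?S" "e 5 \<in> ?S" using b span_add_cancel_right by blast+
    moreover from this have "e 4 \<in> ?S" using b span_add_cancel_right by blast
    ultimately have "?S = UNIV" using b by (intro span_e_intro)
    then show False using class5[of ?x "e 2"] by (simp add: t)
  next
    case 3
    have t: "\<mu> ?x (e 2) = e 3" "\<mu> ?x (e 3) = e 4" "\<mu> ?x (e 4) = e 5" "\<mu> ?x (e 5) = e 6"
      unfolding vec_eq_iff forall_6 by (simp_all add: 3 g8_def alg_def axis_nth)
    let ?S = "vec.span {?x, e 2, e 3, e 4, e 5, e 6}"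
    have b: "?x \<in> ?S" "e 2 \<in> ?S" "e 3 \<in> ?S" "e 4 \<in> ?S" "e 5 \<in> ?S" "e 6 \<in> ?S"
      by (auto intro: vec.span_base)
    then have "e 1 \<in> ?S" using span_add_cancel_right by blast
    then have "?S = UNIV" using b by (intro span_e_intro)
    then show False using class5[of ?x "e 2"] by (simp add: t)
  next
    case 4
    have t: "\<mu> ?x (e 2) = e 3" "\<mu> ?x (e 3) = e 4 + e 5" "\<mu> (e 2) (e 3) = e 5" "\<mu> ?x (e 4 + e 5) = 2 *s e 6"
      unfolding vec_eq_iff forall_6 by (simp_all add: 4 g14_def alg_def axis_nth)
    let ?S = "vec.span {?x, e 2, e 3, e 4 + e 5, e 5, 2 *s e 6}"
    have b: "?x \<in> ?S" "e 2 \<in> ?S" "e 3 \<in> ?S" "e 4 + e 5 \<in> ?S" "e 5 \<in> ?S" "2 *s e 6 \<in> ?S"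
      by (auto intro: vec.span_base)
    have "e 1 \<in> ?S" "e 4 \<in> ?S" using b span_add_cancel_right by blast+
    moreover have "e 6 = (1 / 2) *s (2 *s e 6)" by simp
    then have "e 6 \<in> ?S" using b by (metis vec.span_scale)
    ultimately have "?S = UNIV" using b by (intro span_e_intro)
    then show False using class4[of ?x "e 2"] by (simp add: t)
  next
    case 5
    have "\<mu> (e 1) (e 2) = e 3" "\<mu> (e 1) (e 3) = e 4" "\<mu> (e 2) (e 3) = e 6" "\<mu> (e 1) (e 4) = e 5"
      by (simp_all add: 5 g23_def alg_def axis_nth)
    then show False using class4[of "e 1" "e 2"] span_e by (simp add: insert_commute)
  qed
qed

lemma g_orbit_not_in_closure:
  assumes "\<nu> \<in> {g5, g6, g7, g8, g9, g14, g23}" "\<mu> \<in> orbit \<nu>"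
  shows "\<mu> \<notin> zariski closure_of M6_orbits"
  using g_two_generated[OF assms(1)] closure_not_two_generated
    closure_M6_orbits_orbit[OF _ orbit_sym[OF assms(2)]] by blast

section \<open>The orbit of \<open>g6\<close> is open\<close>

text \<open>In \<open>g6\<close> and \<open>g8\<close> the product \<open>w(tw)\<close> with \<open>w = xy\<close> is a linear form in \<open>t\<close>, up to a fixed
  vector, and \<open>z\<close> spans its kernel in the plane of \<open>x\<close> and \<open>y\<close>.  The identity \<open>z(zw) = 0\<close>
  separates \<open>g8\<close> from \<open>g6\<close>; in all other algebras \<open>w(tw)\<close> vanishes.\<close>

definition g6_covariant :: "complex ^ 6 \<Rightarrow> complex ^ 6 \<Rightarrow> complex ^ 6 \<Rightarrow> 6 multiplication \<Rightarrow> complex ^ 6" where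
  "g6_covariant l x y \<mu> =
    (let w = \<mu> x y; p = \<Sum>k\<in>UNIV. l $ k * \<mu> w (\<mu> x w) $ k; q = \<Sum>k\<in>UNIV. l $ k * \<mu> w (\<mu> y w) $ k;
         z = q *s x - p *s y
     in \<mu> z (\<mu> z w))"

definition g6_covariant_locus :: "6 multiplication set" where
  "g6_covariant_locus = {\<mu> \<in> bilinear_maps. \<forall>(l, x, y)\<in>UNIV. g6_covariant l x y \<mu> = 0}"

lemma g6_covariant_locus_iff:
  "\<mu> \<in> g6_covariant_locus \<longleftrightarrow> \<mu> \<in> bilinear_maps \<and> (\<forall>l x y. g6_covariant l x y \<mu> = 0)"
  by (simp add: g6_covariant_locus_def)

lemma closedin_g6_covariant_locus: "closedin zariski g6_covariant_locus"
  unfolding g6_covariant_locus_def case_prod_unfold g6_covariant_def Let_def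
  by (intro closedin_polymap polymap_intros regular_sum regular_mult regular_const)

text \<open>The functional \<open>l\<close> is pulled back along \<open>f\<close>. As the locus
  quantifies over all functionals, it is a union of orbits.\<close>

lemma g6_covariant_iso:
  assumes f: "Vector_Spaces.linear (*s) (*s) f" and hom: "\<And>x y. f (\<mu> x y) = \<nu> (f x) (f y)"
  shows "g6_covariant l (f x) (f y) \<nu> = f (g6_covariant (\<chi> i. \<Sum>k\<in>UNIV. l $ k * f (axis i 1) $ k) x y \<mu>)"
proof -
  have dot: "(\<Sum>k\<in>UNIV. l $ k * f v $ k) = (\<Sum>i\<in>UNIV. (\<chi> i. \<Sum>k\<in>UNIV. l $ k * f (axis i 1) $ k) $ i * v $ i)" for v
  proof -
    have "f v = f (\<Sum>i\<in>UNIV. v $ i *s axis i 1)" by (simp only: basis_expansion)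
    also have "\<dots> = (\<Sum>i\<in>UNIV. v $ i *s f (axis i 1))"
      by (simp add: vec.linear_sum[OF f] vec.linear_scale[OF f])
    finally have "(\<Sum>k\<in>UNIV. l $ k * f v $ k) = (\<Sum>k\<in>UNIV. \<Sum>i\<in>UNIV. l $ k * (v $ i * f (axis i 1) $ k))"
      by (simp add: sum_distrib_left)
    also have "\<dots> = (\<Sum>i\<in>UNIV. \<Sum>k\<in>UNIV. l $ k * (v $ i * f (axis i 1) $ k))" by (rule sum.swap)
    finally show ?thesis by (simp add: sum_distrib_left sum_distrib_right algebra_simps)
  qed
  define l' where "l' = (\<chi> i. \<Sum>k\<in>UNIV. l $ k * f (axis i 1) $ k)"
  define w where "w = \<mu> x y"
  define p where "p = (\<Sum>k\<in>UNIV. l' $ k * \<mu> w (\<mu> x w) $ k)"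
  define q where "q = (\<Sum>k\<in>UNIV. l' $ k * \<mu> w (\<mu> y w) $ k)"
  define z where "z = q *s x - p *s y"
  have w: "\<nu> (f x) (f y) = f w" by (simp only: w_def hom)
  have "p = (\<Sum>k\<in>UNIV. l $ k * f (\<mu> w (\<mu> x w)) $ k)" "q = (\<Sum>k\<in>UNIV. l $ k * f (\<mu> w (\<mu> y w)) $ k)"
    unfolding p_def q_def l'_def by (rule dot[symmetric])+
  then have p: "(\<Sum>k\<in>UNIV. l $ k * \<nu> (f w) (\<nu> (f x) (f w)) $ k) = p"
    and q: "(\<Sum>k\<in>UNIV. l $ k * \<nu> (f w) (\<nu> (f y) (f w)) $ k) = q"
    by (simp_all only: hom)
  have z: "q *s f x - p *s f y = f z"
    by (simp only: z_def vec.linear_diff[OF f] vec.linear_scale[OF f])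
  have "g6_covariant l (f x) (f y) \<nu> = f (\<mu> z (\<mu> z w))"
    unfolding g6_covariant_def Let_def w p q z by (simp only: hom)
  also have "\<mu> z (\<mu> z w) = g6_covariant l' x y \<mu>"
    unfolding g6_covariant_def Let_def by (simp only: z_def p_def q_def w_def)
  finally show ?thesis by (simp only: l'_def)
qed

lemma g6_covariant_locus_orbit:
  assumes "\<mu> \<in> g6_covariant_locus" "\<nu> \<in> orbit \<mu>"
  shows "\<nu> \<in> g6_covariant_locus"
proof -
  obtain f where f: "Vector_Spaces.linear (*s) (*s) f" "bij f" "\<And>x y. f (\<mu> x y) = \<nu> (f x) (f y)"
    using assms(2) unfolding orbit_iff by blast
  have "g6_covariant l x y \<nu> = 0" for l x y
  proof -
    obtain x' y' where "x = f x'" "y = f y'" using f(2) by (metis bij_pointE)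
    then show ?thesis
      using g6_covariant_iso[where \<mu> = \<mu> and \<nu> = \<nu>, OF f(1,3)] assms(1) vec.linear_0[OF f(1)]
      by (simp add: g6_covariant_locus_iff)
  qed
  then show ?thesis
    using orbit_bilinear assms by (auto simp: g6_covariant_locus_iff)
qed

text \<open>Both scalars in the covariant are read off products of two elements of A^2, so
  \<open>z\<close> is zero.\<close>

lemma g6_covariant_abelian_square:
  assumes "\<mu> \<in> bilinear_maps" "\<And>a b c d. \<mu> (\<mu> a b) (\<mu> c d) = 0"
  shows "\<mu> \<in> g6_covariant_locus"
  unfolding g6_covariant_locus_iff g6_covariant_def Let_def
  by (simp add: assms bilinear_mapsD[OF assms(1)])

lemma g8_nth:
  "g8 x y $ 1 = 0" "g8 x y $ 2 = 0" "g8 x y $ 3 = x $ 1 * y $ 2 - x $ 2 * y $ 1"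
  "g8 x y $ 4 = x $ 1 * y $ 3 - x $ 3 * y $ 1" "g8 x y $ 5 = x $ 1 * y $ 4 - x $ 4 * y $ 1"
  "g8 x y $ 6 = x $ 2 * y $ 5 - x $ 5 * y $ 2 - (x $ 3 * y $ 4 - x $ 4 * y $ 3)"
  by (simp_all add: g8_def alg_def axis_nth algebra_simps)

lemma covariant_locus_members:
  assumes "\<mu> \<in> {g5, g7, g8, g9, g14, g23} \<union> range M6"
  shows "\<mu> \<in> g6_covariant_locus"
proof (cases "\<mu> = g8")
  case True
  have "g6_covariant l x y g8 = 0" for l x y
  proof -
    define w where "w = g8 x y"
    define p where "p = (\<Sum>k\<in>UNIV. l $ k * g8 w (g8 x w) $ k)"
    define q where "q = (\<Sum>k\<in>UNIV. l $ k * g8 w (g8 y w) $ k)"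
    define z where "z = q *s x - p *s y"
    have w: "w $ 1 = 0" "w $ 2 = 0" by (simp_all add: w_def g8_nth)
    \<comment> \<open>The same factor multiplies \<open>x $ 1\<close> and \<open>y $ 1\<close>, so
      \<open>z\<close> loses its first coordinate; such a \<open>z\<close> maps \<open>w\<close>
      into the line of \<open>e 6\<close>, which is annihilated by everything.\<close>
    have "p = - (l $ 6 * (w $ 3)\<^sup>2) * x $ 1" "q = - (l $ 6 * (w $ 3)\<^sup>2) * y $ 1"
      unfolding p_def q_def sum_6 by (simp_all add: g8_nth w power2_eq_square algebra_simps)
    then have z: "z $ 1 = 0" by (simp add: z_def algebra_simps)
    have "g8 z (g8 z w) = 0"
      unfolding vec_eq_iff forall_6 by (simp add: g8_nth w z)
    then show ?thesis
      unfolding g6_covariant_def Let_def by (simp only: w_def p_def q_def z_def)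
  qed
  then show ?thesis
    unfolding True g6_covariant_locus_iff by (simp add: g8_def alg_bilinear)
next
  case False
  then have "\<mu> \<in> {g5, g7, g9, g14, g23} \<union> range M6" using assms by blast
  then show ?thesis
  proof (intro g6_covariant_abelian_square)
    assume \<mu>: "\<mu> \<in> {g5, g7, g9, g14, g23} \<union> range M6"
    then show "\<mu> \<in> bilinear_maps"
      by (auto simp: g5_def g7_def g9_def g14_def g23_def alg_bilinear M6_bilinear)
    have "\<mu> \<in> {g5, g7, g9, g14, g23} \<Longrightarrow> v $ 1 = 0 \<Longrightarrow> v $ 2 = 0 \<Longrightarrow> u $ 1 = 0 \<Longrightarrow> u $ 2 = 0 \<Longrightarrow> \<mu> u v = 0"
      "\<mu> \<in> {g5, g7, g9, g14, g23} \<Longrightarrow> \<mu> x y $ 1 = 0" "\<mu> \<in> {g5, g7, g9, g14, g23} \<Longrightarrow> \<mu> x y $ 2 = 0" for u v x y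
      by (auto simp: g5_def g7_def g9_def g14_def g23_def alg_def axis_nth)
    moreover have "M6 \<epsilon> (M6 \<epsilon> a b) (M6 \<epsilon> c d) = 0" for \<epsilon> a b c d
      unfolding vec_eq_iff forall_6 by (simp add: M6_nth)
    ultimately show "\<mu> (\<mu> a b) (\<mu> c d) = 0" for a b c d
      using \<mu> by (cases "\<mu> \<in> {g5, g7, g9, g14, g23}") auto
  qed
qed

lemma g6_not_in_covariant_locus: "g6 \<notin> g6_covariant_locus"
proof
  assume "g6 \<in> g6_covariant_locus"
  \<comment> \<open>Here \<open>w = e 3\<close>, \<open>p = -1\<close> and \<open>q = 0\<close>, so
    \<open>z = e 2\<close> and the covariant is \<open>e 2 e 5 = e 6\<close>.\<close>
  then have "g6_covariant (e 6) (e 1) (e 2) g6 = 0" by (simp add: g6_covariant_locus_iff)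
  moreover have "g6 (e 1) (e 2) = e 3" "g6 (e 1) (e 3) = e 4" "g6 (e 2) (e 3) = e 5" "g6 (e 3) (e 4) = - e 6"
    "g6 (e 3) (e 5) = 0" "g6 (e 2) (e 5) = e 6"
    by (simp_all add: g6_def alg_def axis_nth)
  ultimately have "e 6 = 0"
    by (simp add: g6_covariant_def Let_def sum_6 axis_nth)
  then show False by (simp add: vec_eq_iff axis_nth forall_6)
qed

section \<open>Components and rigid algebras\<close>

abbreviation two_generated_orbits :: "6 multiplication set" where
  "two_generated_orbits \<equiv>
    orbit g6 \<union> orbit g5 \<union> orbit g8 \<union> orbit g7 \<union> orbit g14 \<union> orbit g9 \<union> orbit g23"

lemma NMal_algebra_6: "\<mu> \<in> NMal \<Longrightarrow> anticomm_algebra_6 \<mu>"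
  by (simp add: anticomm_algebra_6_def anticomm_algebra_def NMal_iff malcev_def)

lemma small_square_closure:
  assumes "\<mu> \<in> NMal" "small_square \<mu>"
  shows "\<mu> \<in> zariski closure_of M6_orbits"
    and "lie \<mu> \<Longrightarrow> \<mu> \<in> zariski closure_of (orbit (M6 1))"
proof -
  interpret anticomm_algebra_6 \<mu> using assms(1) by (rule NMal_algebra_6)
  obtain b1 b2 b3 b4 b5 b6 where "filtered_basis b1 b2 b3 b4 b5 b6"
    using small_square_filtered assms by (auto simp: NMal_iff)
  from filtered_basis_closure[OF this]
  show "\<mu> \<in> zariski closure_of M6_orbits" "lie \<mu> \<Longrightarrow> \<mu> \<in> zariski closure_of (orbit (M6 1))"
    by auto
qed

lemma large_square:
  assumes "\<mu> \<in> NMal" "\<not> small_square \<mu>"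
  shows "\<mu> \<in> two_generated_orbits" and "\<mu> \<in> zariski closure_of (orbit g6)"
proof -
  interpret anticomm_algebra_6 \<mu> using assms(1) by (rule NMal_algebra_6)
  have "malcev \<mu>" "nilpotent \<mu>" using assms(1) by (simp_all add: NMal_iff)
  then have "\<mu> \<in> two_generated_orbits \<and> \<mu> \<in> zariski closure_of (orbit g6)"
    by (rule disjE[OF two_generated_cases[OF _ _ assms(2)]]; elim exE conjE)
      (use class5_classification class5_in_closure in blast, use class4_isotropic class4_in_closure in blast)
  then show "\<mu> \<in> two_generated_orbits" "\<mu> \<in> zariski closure_of (orbit g6)" by auto
qed

lemma closure_g6: "zariski closure_of (orbit g6) = NLie"
proof
  have "orbit g6 \<subseteq> NLie" using NLie_g6 NLie_orbit by blast
  then show "zariski closure_of (orbit g6) \<subseteq> NLie"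
    by (rule closure_of_minimal[OF _ closedin_NLie])
  have "orbit (M6 1) \<subseteq> zariski closure_of (orbit g6)"
    using closure_orbit_orbit[OF g6_bilinear M6_1_in_closure] by blast
  then have M: "zariski closure_of (orbit (M6 1)) \<subseteq> zariski closure_of (orbit g6)"
    by (rule closure_of_minimal) simp
  show "NLie \<subseteq> zariski closure_of (orbit g6)"
  proof
    fix \<mu> :: "6 multiplication" assume "\<mu> \<in> NLie"
    then have "\<mu> \<in> NMal" "lie \<mu>" using NLie_subset_NMal by (auto simp: NLie_iff)
    then show "\<mu> \<in> zariski closure_of (orbit g6)"
      using small_square_closure(2) large_square(2) M by blast
  qed
qed

lemma closure_M6: "zariski closure_of M6_orbits = NMal - two_generated_orbits"
proof
  have "M6_orbits \<subseteq> NMal" using NMal_M6 NMal_orbit by blast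
  then have "zariski closure_of M6_orbits \<subseteq> NMal"
    by (rule closure_of_minimal[OF _ closedin_NMal])
  then show "zariski closure_of M6_orbits \<subseteq> NMal - two_generated_orbits"
    using g_orbit_not_in_closure by blast
  show "NMal - two_generated_orbits \<subseteq> zariski closure_of M6_orbits"
    using small_square_closure(1) large_square(1) by blast
qed

text \<open>By \<open>closure_M6\<close>, \<open>NMal\<close> consists of seven orbits and the
  closure of the family; the covariant vanishes on every piece except the orbit of
  \<open>g6\<close>.\<close>

lemma orbit_g6_eq: "orbit g6 = NMal - g6_covariant_locus"
proof
  show "orbit g6 \<subseteq> NMal - g6_covariant_locus"
    using NLie_g6 NLie_orbit NLie_subset_NMal g6_not_in_covariant_locus
      g6_covariant_locus_orbit[OF _ orbit_sym] by blast
  have "M6_orbits \<subseteq> g6_covariant_locus"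
    using covariant_locus_members g6_covariant_locus_orbit by blast
  then have "zariski closure_of M6_orbits \<subseteq> g6_covariant_locus"
    by (rule closure_of_minimal[OF _ closedin_g6_covariant_locus])
  moreover have "orbit g5 \<union> orbit g8 \<union> orbit g7 \<union> orbit g14 \<union> orbit g9 \<union> orbit g23 \<subseteq> g6_covariant_locus"
    using covariant_locus_members g6_covariant_locus_orbit by blast
  ultimately show "NMal - g6_covariant_locus \<subseteq> orbit g6"
    using closure_M6 by blast
qed

lemma irreducible_components_two:
  assumes A: "closedin X A" "irreducible_in X A" and B: "closedin X B" "irreducible_in X B"
    and cover: "topspace X = A \<union> B" and "\<not> A \<subseteq> B" "\<not> B \<subseteq> A"
  shows "irreducible_components X = {A, B}"
proof (rule set_eqI)
  fix D
  have sub: "D \<subseteq> A \<or> D \<subseteq> B" if "irreducible_in X D" for D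
    using that A(1) B(1) cover unfolding irreducible_in_def by metis
  have "D \<in> irreducible_components X \<longleftrightarrow> closedin X D \<and> irreducible_in X D \<and>
      (\<forall>E. closedin X E \<and> irreducible_in X E \<and> D \<subseteq> E \<longrightarrow> E = D)"
    by (simp add: irreducible_components_def)
  also have "\<dots> \<longleftrightarrow> D = A \<or> D = B"
  proof
    assume D: "closedin X D \<and> irreducible_in X D \<and>
      (\<forall>E. closedin X E \<and> irreducible_in X E \<and> D \<subseteq> E \<longrightarrow> E = D)"
    then consider "D \<subseteq> A" | "D \<subseteq> B" using sub by blast
    then show "D = A \<or> D = B" by cases (use D A B in auto)
  next
    have "E = A" if "irreducible_in X E" "A \<subseteq> E" for E
      using sub[OF that(1)] that(2) assms(6) by blast
    moreover have "E = B" if "irreducible_in X E" "B \<subseteq> E" for E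
      using sub[OF that(1)] that(2) assms(7) by blast
    moreover assume "D = A \<or> D = B"
    ultimately show "closedin X D \<and> irreducible_in X D \<and>
      (\<forall>E. closedin X E \<and> irreducible_in X E \<and> D \<subseteq> E \<longrightarrow> E = D)"
      using A B by auto
  qed
  finally show "D \<in> irreducible_components X \<longleftrightarrow> D \<in> {A, B}" by simp
qed

lemma irreducible_in_subtopology:
  assumes "closedin X Y" "S \<subseteq> Y" "irreducible_in X S"
  shows "irreducible_in (subtopology X Y) S"
proof -
  have "closedin X A" if "closedin (subtopology X Y) A" for A
    using that assms(1) closedin_closed_subtopology by blast
  then show ?thesis
    using assms(2,3) unfolding irreducible_in_def by simp
qed

lemma openin_orbit_g6:
  assumes "orbit g6 \<subseteq> Y" "Y \<subseteq> NMal"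
  shows "openin (subtopology zariski Y) (orbit g6)"
proof -
  have "openin zariski (bilinear_maps - g6_covariant_locus)"
    using openin_diff[OF openin_topspace closedin_g6_covariant_locus] by simp
  moreover have "orbit g6 = (bilinear_maps - g6_covariant_locus) \<inter> Y"
    using assms orbit_g6_eq by (auto simp: NMal_iff)
  ultimately show ?thesis unfolding openin_subtopology by blast
qed

text \<open>An open orbit with a point in the closure of the orbit of \<open>g6\<close> meets that
  orbit, and two orbits that meet are equal.\<close>

lemma rigid_in_closure_g6:
  assumes "openin (subtopology zariski Y) (orbit \<mu>)" "orbit g6 \<subseteq> Y" "\<mu> \<in> zariski closure_of (orbit g6)"
  shows "orbit \<mu> = orbit g6"
proof -
  obtain U where U: "openin zariski U" "orbit \<mu> = U \<inter> Y"
    using assms(1) unfolding openin_subtopology by blast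
  then have "\<mu> \<in> U" using orbit_refl[of \<mu>] by blast
  then obtain \<nu> where "\<nu> \<in> orbit g6" "\<nu> \<in> U"
    using assms(3) U(1) unfolding in_closure_of by blast
  then have "\<nu> \<in> orbit \<mu>" "\<nu> \<in> orbit g6" using U(2) assms(2) by auto
  then show ?thesis using orbit_eq by metis
qed

text \<open>An open orbit meeting the family \<open>M6 \<epsilon>\<close> would contain \<open>M6 \<epsilon>\<close> for all parameters in a
  disc.\<close>

lemma not_rigid_in_closure_M6:
  assumes "openin (subtopology zariski NMal) (orbit \<mu>)" "\<mu> \<in> zariski closure_of M6_orbits"
  shows False
proof -
  obtain U where U: "openin zariski U" "orbit \<mu> = U \<inter> NMal"
    using assms(1) unfolding openin_subtopology by blast
  then have "\<mu> \<in> U" using orbit_refl[of \<mu>] by blast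
  then obtain \<nu> \<epsilon> where "\<nu> \<in> orbit (M6 \<epsilon>)" "\<nu> \<in> U"
    using assms(2) U(1) unfolding in_closure_of by blast
  then have "\<nu> \<in> orbit \<mu>" "\<nu> \<in> orbit (M6 \<epsilon>)" using U(2) NMal_M6 NMal_orbit by blast+
  then have eq: "orbit \<mu> = orbit (M6 \<epsilon>)" using orbit_eq by metis
  then have "M6 \<epsilon> \<in> U" using U(2) orbit_refl[of "M6 \<epsilon>"] by blast
  moreover have "M6 \<epsilon> \<in> bilinear_maps - U"
  proof (rule closedin_zariski_limit[where F = "\<lambda>t. M6 (\<epsilon> + t)"])
    show "closedin zariski (bilinear_maps - U)"
      using U(1) closedin_diff[OF closedin_topspace] by fastforce
    have "\<forall>\<^sub>F t in at 0. t \<noteq> (0 :: complex)" by (rule eventually_neq_at_within)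
    then show "\<forall>\<^sub>F t in at 0. M6 (\<epsilon> + t) \<in> bilinear_maps - U"
    proof eventually_elim
      case (elim t)
      then have "M6 (\<epsilon> + t) \<notin> orbit (M6 \<epsilon>)" using M6_orbit_inj[of "\<epsilon> + t" \<epsilon>] by auto
      then show ?case using U(2) eq NMal_M6 M6_bilinear by blast
    qed
    have "((\<lambda>t. M6 (p t) x y $ k) \<longlongrightarrow> M6 q x y $ k) F" if "(p \<longlongrightarrow> q) F" for p q F x y k
      unfolding M6_def alg_def using that by (simp, intro tendsto_intros)
    then show "((\<lambda>t. M6 (\<epsilon> + t) (e i) (e j) $ k) \<longlongrightarrow> M6 \<epsilon> (e i) (e j) $ k) (at 0)" for i j k
      using tendsto_shift by blast
  qed (rule M6_bilinear)
  ultimately show False by blast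
qed

theorem corollary9:
  shows "\<exists>C1 C2 :: 6 multiplication set.
    C1 \<noteq> C2 \<and>
    irreducible_components (subtopology zariski NMal) = {C1, C2} \<and>
    C1 = zariski closure_of (orbit g6) \<and>
    C1 = NLie \<and>
    C2 = zariski closure_of (\<Union>\<epsilon>. orbit (M6 \<epsilon>)) \<and>
    C2 = NMal - (orbit g6 \<union> orbit g5 \<union> orbit g8 \<union> orbit g7 \<union> orbit g14 \<union> orbit g9 \<union> orbit g23) \<and>
    Rig (NMal :: 6 multiplication set) = {orbit g6} \<and>
    Rig (NLie :: 6 multiplication set) = {orbit g6}"
proof (intro exI conjI)
  let ?C1 = "zariski closure_of (orbit g6)" and ?C2 = "zariski closure_of M6_orbits"
  have g6: "orbit g6 \<subseteq> NLie" using NLie_g6 NLie_orbit by blast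
  have cover: "NMal = ?C1 \<union> ?C2"
    using small_square_closure(1) large_square(2) closure_g6 closure_M6 NLie_subset_NMal by blast
  have 12: "\<not> ?C1 \<subseteq> ?C2"
    using orbit_subset_closure[OF g6_bilinear] orbit_refl[of g6] closure_M6 by blast
  \<comment> \<open>\<open>M6 0\<close> is not Lie, which keeps the second component out of the
    first.\<close>
  have "M6 0 \<in> ?C2"
    using closure_of_subset[of M6_orbits zariski] M6_orbits_bilinear orbit_refl[of "M6 0"] by auto
  then have 21: "\<not> ?C2 \<subseteq> ?C1"
    using not_lie_M6_0 closure_g6 by blast
  show "?C1 \<noteq> ?C2" using 12 by blast
  \<comment> \<open>A single orbit is treated as a constant family.\<close>
  have "irreducible_in zariski (\<Union>s::complex. orbit g6)"
    by (rule irreducible_in_orbit_family) (simp_all add: polynomial_fun_const g6_bilinear)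
  then have irr1: "irreducible_in zariski ?C1" by (simp add: irreducible_in_closure_of)
  have irr2: "irreducible_in zariski ?C2"
  proof (intro irreducible_in_closure_of irreducible_in_orbit_family M6_bilinear)
    show "polynomial_fun (\<lambda>s. M6 s (e i) (e j) $ k)" for i j k
      unfolding M6_def alg_def by (simp, intro polynomial_fun_intros)
  qed
  show "irreducible_components (subtopology zariski NMal) = {?C1, ?C2}"
  proof (rule irreducible_components_two)
    show "closedin (subtopology zariski NMal) ?C1" "closedin (subtopology zariski NMal) ?C2"
      using cover by (auto simp: closedin_closed_subtopology[OF closedin_NMal])
    show "irreducible_in (subtopology zariski NMal) ?C1" "irreducible_in (subtopology zariski NMal) ?C2"
      using cover by (auto intro: irreducible_in_subtopology[OF closedin_NMal] irr1 irr2)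
    show "topspace (subtopology zariski NMal) = ?C1 \<union> ?C2"
      using cover closedin_subset[OF closedin_NMal] by auto
  qed (use 12 21 in auto)
  show "?C1 = NLie" by (rule closure_g6)
  show "?C2 = NMal - two_generated_orbits" by (rule closure_M6)
  show "Rig (NMal :: 6 multiplication set) = {orbit g6}"
  proof
    show "Rig NMal \<subseteq> {orbit g6}"
      using cover rigid_in_closure_g6[of NMal] not_rigid_in_closure_M6 g6 NLie_subset_NMal
      unfolding Rig_def by blast
    show "{orbit g6} \<subseteq> Rig NMal"
      using openin_orbit_g6[of NMal] g6 NLie_subset_NMal orbit_refl[of g6] unfolding Rig_def by blast
  qed
  show "Rig (NLie :: 6 multiplication set) = {orbit g6}"
  proof
    show "Rig NLie \<subseteq> {orbit g6}"
      using rigid_in_closure_g6[of NLie] g6 closure_g6 unfolding Rig_def by blast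
    show "{orbit g6} \<subseteq> Rig NLie"
      using openin_orbit_g6[OF g6 NLie_subset_NMal] g6 orbit_refl[of g6] unfolding Rig_def by blast
  qed
qed (rule refl)+

end
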